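(* Let $m\ge 2$ and let $(\varphi_1,\ldots,\varphi_m;\rho_1,\ldots,\rho_m)$ be a conformal iterated function system on $[0,1]$ with self-conformal measure $\mu=\mu(\varphi_1,\ldots,\varphi_m;\rho_1,\ldots,\rho_m)$. Assume that $\sum_{i=1}^m\|\varphi_i'\|_\infty<1$ and that $(\varphi_1,\ldots,\varphi_m)$ satisfies the strong bounded distortion property. For each $i$ let $x_i\in[0,1]$ be the unique fixed point of $\varphi_i$. Then $$N(\lambda,\mu)\asymp\lambda^D,$$ i.e. there exist constants $C_1,C_2>0$ such that $C_1\lambda^D\le N(\lambda,\mu)\le C_2\lambda^D$ for all $\lambda\ge0$, where $D\in(0,\tfrac12)$ is the only solution of $$\sum_{i=1}^m\bigl(\rho_i|\varphi_i'(x_i)|\bigr)^D=1.$$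
   Context: Conformal iterated function system on $[0,1]$ ($m\ge2$): a tuple $(\varphi_1,\ldots,\varphi_m;\rho_1,\ldots,\rho_m)$ such that, for some $\gamma>0$: (1) each $\varphi_i:[0,1]\to\varphi_i([0,1])$ is a $C^{1+\gamma}$ diffeomorphism (derivative Hölder continuous with exponent $\gamma$); (2) $\varphi_i((0,1))\subset(0,1)$ and $\varphi_i((0,1))\cap\varphi_j((0,1))=\varnothing$ for $i\ne j$; (3) $0<|\varphi_i'(x)|<1$ for all $i$ and all $x\in[0,1]$; (4) $\rho_i>0$ and $\sum_{i=1}^m\rho_i=1$. The maps are numbered in ascending order: $\varphi_i(x)\le\varphi_{i+1}(y)$ for all $x,y\in[0,1]$. Self-conformal measure $\mu(\varphi_1,\ldots,\varphi_m;\rho_1,\ldots,\rho_m)$: the unique Borel probability measure $\mu$ on $[0,1]$ with $\mu(E)=\sum_{i=1}^m\rho_i\,\mu(\varphi_i^{-1}(E))$ for all measurable $E$ (it has no atoms). Words: $\Sigma_k=\{1,\ldots,m\}^k$, $\Sigma_*=\bigcup_{k\ge0}\Sigma_k$; for $w=(i_1,\ldots,i_k)$, $|w|=k$ and $\varphi_w=\varphi_{i_1}\circ\cdots\circ\varphi_{i_k}$ (identity if $k=0$). For a permutation $\sigma$ of $\{1,\dots,|w|\}$, $\sigma w$ is the word obtained from $w$ by permuting its letters by $\sigma$. Strong bounded distortion property: there is a constant $C\ge1$ such that $C^{-1}\le\left|\varphi_w'(x)/\varphi_{\sigma w}'(y)\right|\le C$ for all $x,y\in[0,1]$, all $w\in\Sigma_*$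 and all permutations $\sigma$ of $\{1,\dots,|w|\}$. Spectrum: for a finite atomless Borel measure $\mu$ on $[0,1]$ consider the Neumann problem $-y''=\lambda\mu y$, $y'(0)=y'(1)=0$. A number $\lambda$ is an eigenvalue if there is a nonzero $y\in W_2^1[0,1]$ with $\int_0^1y'\eta'\,dx=\lambda\int_0^1y\eta\,d\mu$ for all $\eta\in W_2^1[0,1]$. The eigenvalues are numbered in ascending order $\lambda_n(\mu)$, and $N(\lambda,\mu)=\#\{n:\lambda_n(\mu)<\lambda\}$.
   Formalization: Since 0 is a Neumann eigenvalue, N(λ,μ) ≥ 1 for all λ>0 and the upper bound fails as λ→0+; it is proved instead for λ=0 and all λ ≥ λ₀, for every λ₀>0, with C₂ depending on λ₀, while the lower bound holds for all λ ≥ 0. *)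

theory Defs
  imports "HOL-Probability.Probability" "HOL-Combinatorics.Permutations"
begin

text \<open>Derivatives are taken within the domain, hence are one-sided at end points.\<close>

abbreviation deriv_within :: "real set \<Rightarrow> (real \<Rightarrow> real) \<Rightarrow> real \<Rightarrow> real" where
  "deriv_within S f x \<equiv> vector_derivative f (at x within S)"

abbreviation deriv01 :: "(real \<Rightarrow> real) \<Rightarrow> real \<Rightarrow> real" where
  "deriv01 \<equiv> deriv_within {0..1}"

definition C1_holder :: "real \<Rightarrow> real set \<Rightarrow> (real \<Rightarrow> real) \<Rightarrow> bool" where
  "C1_holder \<gamma> S f \<longleftrightarrow> f differentiable_on S \<and>
     (\<exists>K. \<forall>x\<in>S. \<forall>y\<in>S. \<bar>deriv_within S f x - deriv_within S f y\<bar> \<le> K * \<bar>x - y\<bar> powr \<gamma>)"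

definition C1_holder_diffeo :: "real \<Rightarrow> real set \<Rightarrow> (real \<Rightarrow> real) \<Rightarrow> bool" where
  "C1_holder_diffeo \<gamma> S f \<longleftrightarrow> inj_on f S \<and> C1_holder \<gamma> S f \<and>
     C1_holder \<gamma> (f ` S) (the_inv_into S f)"

text \<open>
  Only the values of the maps on \<open>{0..1}\<close> matter.  The last clause is the convention that the
  maps are numbered from left to right.
\<close>

definition conformal_IFS :: "nat \<Rightarrow> (nat \<Rightarrow> real \<Rightarrow> real) \<Rightarrow> (nat \<Rightarrow> real) \<Rightarrow> bool" where
  "conformal_IFS m \<phi> \<rho> \<longleftrightarrow>
     (\<exists>\<gamma>>0. \<forall>i\<in>{1..m}. C1_holder_diffeo \<gamma> {0..1} (\<phi> i)) \<and>
     (\<forall>i\<in>{1..m}. \<phi> i ` {0<..<1} \<subseteq> {0<..<1}) \<and>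
     (\<forall>i\<in>{1..m}. \<forall>j\<in>{1..m}. i \<noteq> j \<longrightarrow> \<phi> i ` {0<..<1} \<inter> \<phi> j ` {0<..<1} = {}) \<and>
     (\<forall>i\<in>{1..m}. \<forall>x\<in>{0..1}. 0 < \<bar>deriv01 (\<phi> i) x\<bar> \<and> \<bar>deriv01 (\<phi> i) x\<bar> < 1) \<and>
     (\<forall>i\<in>{1..m}. \<rho> i > 0) \<and> (\<Sum>i=1..m. \<rho> i) = 1 \<and>
     (\<forall>i\<in>{1..<m}. \<forall>x\<in>{0..1}. \<forall>y\<in>{0..1}. \<phi> i x \<le> \<phi> (Suc i) y)"

text \<open>
  For a conformal iterated function system there is exactly one such measure.
\<close>

definition self_conformal_measure ::
    "nat \<Rightarrow> (nat \<Rightarrow> real \<Rightarrow> real) \<Rightarrow> (nat \<Rightarrow> real) \<Rightarrow> real measure \<Rightarrow> bool" where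
  "self_conformal_measure m \<phi> \<rho> \<mu> \<longleftrightarrow>
     prob_space \<mu> \<and> sets \<mu> = sets (restrict_space borel {0..1}) \<and>
     (\<forall>E\<in>sets \<mu>. measure \<mu> E = (\<Sum>i=1..m. \<rho> i * measure \<mu> (\<phi> i -` E \<inter> {0..1})))"

primrec word_map :: "(nat \<Rightarrow> real \<Rightarrow> real) \<Rightarrow> nat list \<Rightarrow> real \<Rightarrow> real" where
  "word_map \<phi> [] = id"
| "word_map \<phi> (i # w) = \<phi> i \<circ> word_map \<phi> w"

text \<open>Letters of a word are at positions \<open>0, \<dots>, length w - 1\<close>.\<close>

definition strong_bounded_distortion :: "nat \<Rightarrow> (nat \<Rightarrow> real \<Rightarrow> real) \<Rightarrow> bool" where
  "strong_bounded_distortion m \<phi> \<longleftrightarrow>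
     (\<exists>C\<ge>1. \<forall>w\<in>lists {1..m}. \<forall>\<sigma>. \<sigma> permutes {..<length w} \<longrightarrow>
        (\<forall>x\<in>{0..1}. \<forall>y\<in>{0..1}.
           inverse C \<le> \<bar>deriv01 (word_map \<phi> w) x / deriv01 (word_map \<phi> (permute_list \<sigma> w)) y\<bar> \<and>
           \<bar>deriv01 (word_map \<phi> w) x / deriv01 (word_map \<phi> (permute_list \<sigma> w)) y\<bar> \<le> C))"

text \<open>
  \<open>W12 y g\<close>: on \<open>{0..1}\<close>, \<open>y\<close> is (the continuous representative of) an element of the Sobolev
  space \<open>W\<^sub>2\<^sup>1[0,1]\<close>, i.e. absolutely continuous with square integrable derivative, and \<open>g\<close> is a
  version of its derivative.
\<close>

definition W12 :: "(real \<Rightarrow> real) \<Rightarrow> (real \<Rightarrow> real) \<Rightarrow> bool" where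
  "W12 y g \<longleftrightarrow>
     set_borel_measurable lborel {0..1} g \<and>
     set_integrable lborel {0..1} (\<lambda>x. (g x)\<^sup>2) \<and>
     (\<forall>x\<in>{0..1}. y x = y 0 + (LINT t:{0..x}|lborel. g t))"

definition neumann_eigenvalue :: "real measure \<Rightarrow> real \<Rightarrow> bool" where
  "neumann_eigenvalue \<mu> l \<longleftrightarrow>
     (\<exists>y y'. W12 y y' \<and> (\<exists>x\<in>{0..1}. y x \<noteq> 0) \<and>
        (\<forall>\<eta> \<eta>'. W12 \<eta> \<eta>' \<longrightarrow>
           (LINT x:{0..1}|lborel. y' x * \<eta>' x) = l * (LINT x|\<mu>. y x * \<eta> x)))"

text \<open>
  All eigenvalues are simple: an eigenfunction satisfies \<open>y'(x) = - l \<integral> y d\<mu>\<close> over \<open>[0,x]\<close>,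
  so it is determined by \<open>y(0)\<close>.  Hence counting distinct eigenvalues is the same as counting with
  multiplicity.  Note that \<open>card\<close> of an infinite set is \<open>0\<close>, so any positive lower bound for this
  number includes the finiteness of the set.
\<close>

definition neumann_count :: "real \<Rightarrow> real measure \<Rightarrow> nat" where
  "neumann_count L \<mu> = card {l. neumann_eigenvalue \<mu> l \<and> l < L}"

text \<open>
  Constants are eigenfunctions for the eigenvalue \<open>0\<close>.  Hence the counting function is at least
  \<open>1\<close> on \<open>{0<..}\<close> and, for \<open>D > 0\<close>, admits no upper bound \<open>C * L powr D\<close> for \<open>L\<close> near \<open>0\<close>.
\<close>

lemma neumann_eigenvalue_zero: "neumann_eigenvalue \<mu> 0"
  unfolding neumann_eigenvalue_def
proof (intro exI conjI)
  show "W12 (\<lambda>_. 1) (\<lambda>_. 0)"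
    by (simp add: W12_def set_borel_measurable_def set_integrable_def)
  show "\<exists>x\<in>{0..1::real}. (1::real) \<noteq> 0"
    by (auto intro: bexI[of _ 0])
qed simp

end

theory Submission
  imports Defs "HOL-Complex_Analysis.Great_Picard" "HOL-Library.Sublist"
begin

text \<open>
  Strong bounded distortion, applied after sorting the letters of a word, shows that the cell of a
  word \<open>w\<close> has length comparable to the product of the numbers \<open>|\<phi>\<^sub>i'(x\<^sub>i)|\<close> over the letters of
  \<open>w\<close>, while its mass is exactly the product of the \<open>\<rho>\<^sub>i\<close>.  Hence mass times length is, up to a
  constant, a product of the \<open>s\<^sub>i = \<rho>\<^sub>i |\<phi>\<^sub>i'(x\<^sub>i)|\<close>.  Stopping each word as soon as this product drops
  below \<open>t\<close>, of order \<open>1/\<lambda>\<close>, leaves about \<open>\<lambda>\<^sup>D\<close> cells, because the \<open>D\<close>-th powers of the products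
  over the stopped words sum to \<open>1\<close>.

  If there were more eigenvalues below \<open>\<lambda>\<close> than cells, some combination of eigenfunctions would vanish
  at the left end of every cell, and Cauchy-Schwarz on each cell would bound its Rayleigh quotient
  from below by \<open>\<lambda>\<close>, a contradiction.  If there were fewer, some combination of tents on the
  cells, each with Rayleigh quotient below \<open>\<lambda>\<close>, would be orthogonal to all these eigenfunctions, and
  maximising the compact inverse operator on their orthogonal complement would give one more
  eigenvalue below \<open>\<lambda>\<close>; here one uses that eigenvalues are simple.
\<close>

section \<open>Functions with square integrable derivative\<close>

text \<open>Mass times length is the quantity to stop at because, on a cell of length
  \<open>l\<close> and mass \<open>p\<close>, both the Cauchy-Schwarz bound and the tent give a
  Rayleigh quotient of order \<open>1 / (l * p)\<close>. For the tent this needs a definite share of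
  the mass of the cell away from its ends; self-conformality copies that share from one fixed
  central interval. Fixed points enter because the \<open>n\<close>-th iterate of
  \<open>\<phi> i\<close> has derivative exactly \<open>r i ^ n\<close> in modulus at
  \<open>x i\<close>. A sorted word consists of \<open>m\<close> such blocks, possibly empty, so
  distortion costs a constant that does not depend on the length of the word. The scalar product of
  L2 over \<open>\<mu>\<close> is only semidefinite on continuous functions, since
  \<open>\<mu>\<close> may vanish on subintervals. Positivity of a norm is therefore always derived,
  never read off from the function being nonzero. The compactness argument stays inside the
  continuous functions: the inverse operator maps bounded sequences in the \<open>\<mu>\<close>-norm
  to equicontinuous ones, so limits are taken uniformly. One new eigenvector orthogonal to finitely
  many eigenfunctions is all that it has to produce.\<close>

lemma homogeneous_system_nontrivial:
  fixes M :: "'b \<Rightarrow> 'a \<Rightarrow> 'c::field"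
  assumes "finite B" "finite A" "card B < card A"
  shows "\<exists>c. (\<exists>a\<in>A. c a \<noteq> 0) \<and> (\<forall>b\<in>B. (\<Sum>a\<in>A. c a * M b a) = 0)"
  using assms
proof (induction B arbitrary: A M rule: finite_induct)
  case empty
  then have "A \<noteq> {}" by auto
  then show ?case by (auto intro!: exI[of _ "\<lambda>_. 1"])
next
  case (insert b B)
  show ?case
  proof (cases "\<forall>a\<in>A. M b a = 0")
    case True
    with insert.IH[of A M] insert.prems insert.hyps show ?thesis by auto
  next
    case False
    \<comment> \<open>A nonzero coefficient serves as pivot: equation \<open>b\<close> is solved for
      the unknown \<open>a0\<close>, which is thereby eliminated from the other equations.\<close>
    then obtain a0 where a0: "a0 \<in> A" "M b a0 \<noteq> 0" by auto
    let ?A = "A - {a0}"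
    have "card B < card ?A"
      using insert a0 by auto
    then obtain c where c: "\<exists>a\<in>?A. c a \<noteq> 0"
      "\<And>b'. b' \<in> B \<Longrightarrow> (\<Sum>a\<in>?A. c a * (M b' a - M b' a0 * M b a / M b a0)) = 0"
      using insert.IH[of ?A "\<lambda>b' a. M b' a - M b' a0 * M b a / M b a0"] insert.prems by auto
    define s where "s = (\<Sum>a\<in>?A. c a * M b a)"
    define d where "d = c(a0 := - s / M b a0)"
    have split: "(\<Sum>a\<in>A. d a * M b' a) = (\<Sum>a\<in>?A. c a * M b' a) - s / M b a0 * M b' a0" for b'
    proof -
      have "(\<Sum>a\<in>A. d a * M b' a) = d a0 * M b' a0 + (\<Sum>a\<in>?A. d a * M b' a)"
        using a0 insert.prems by (simp add: sum.remove)
      also have "(\<Sum>a\<in>?A. d a * M b' a) = (\<Sum>a\<in>?A. c a * M b' a)"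
        by (rule sum.cong) (auto simp: d_def)
      finally show ?thesis by (simp add: d_def)
    qed
    have "(\<Sum>a\<in>A. d a * M b' a) = 0" if "b' \<in> B" for b'
    proof -
      have "0 = (\<Sum>a\<in>?A. c a * M b' a) - (\<Sum>a\<in>?A. c a * M b a * (M b' a0 / M b a0))"
        using c(2)[OF that] by (simp add: algebra_simps sum_subtractf)
      also have "(\<Sum>a\<in>?A. c a * M b a * (M b' a0 / M b a0)) = s * (M b' a0 / M b a0)"
        unfolding s_def by (rule sum_distrib_right[symmetric])
      finally show ?thesis unfolding split by simp
    qed
    moreover have "(\<Sum>a\<in>A. d a * M b a) = 0"
      unfolding split using a0 by (simp add: s_def)
    moreover have "\<exists>a\<in>A. d a \<noteq> 0"
      using c(1) by (auto simp: d_def)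
    ultimately show ?thesis by blast
  qed
qed

text \<open>Both parts rest on squares: the product is dominated by the sum of squares, and the
  integral of the square of \<open>u * f - v * g\<close> is a nonnegative quadratic form in
  \<open>u\<close> and \<open>v\<close>.\<close>

lemma cauchy_schwarz_integral:
  fixes f g :: "'a \<Rightarrow> real"
  assumes [measurable]: "f \<in> borel_measurable M" "g \<in> borel_measurable M"
    and f2: "integrable M (\<lambda>x. (f x)\<^sup>2)" and g2: "integrable M (\<lambda>x. (g x)\<^sup>2)"
  shows "integrable M (\<lambda>x. f x * g x)"
    and "(\<integral>x. f x * g x \<partial>M)\<^sup>2 \<le> (\<integral>x. (f x)\<^sup>2 \<partial>M) * (\<integral>x. (g x)\<^sup>2 \<partial>M)"
proof -
  have "integrable M (\<lambda>x. (f x)\<^sup>2 + (g x)\<^sup>2)"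
    using f2 g2 by simp
  then show fg: "integrable M (\<lambda>x. f x * g x)"
  proof (rule Bochner_Integration.integrable_bound)
    show "AE x in M. norm (f x * g x) \<le> norm ((f x)\<^sup>2 + (g x)\<^sup>2)"
    proof (rule AE_I2)
      fix x
      have "u * v \<le> u\<^sup>2 + v\<^sup>2" if "0 \<le> u" "0 \<le> v" for u v :: real
      proof -
        have "2 * u * v \<le> u\<^sup>2 + v\<^sup>2" by (rule sum_squares_bound)
        moreover have "0 \<le> u * v" using that by simp
        ultimately show ?thesis by linarith
      qed
      from this[of "\<bar>f x\<bar>" "\<bar>g x\<bar>"] have "\<bar>f x\<bar> * \<bar>g x\<bar> \<le> (f x)\<^sup>2 + (g x)\<^sup>2"
        by simp
      then show "norm (f x * g x) \<le> norm ((f x)\<^sup>2 + (g x)\<^sup>2)"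
        by (simp add: abs_mult)
    qed
  qed simp
  define a where "a = (\<integral>x. (f x)\<^sup>2 \<partial>M)"
  define b where "b = (\<integral>x. f x * g x \<partial>M)"
  define c where "c = (\<integral>x. (g x)\<^sup>2 \<partial>M)"
  have "0 \<le> a" "0 \<le> c" by (auto simp: a_def c_def)
  have *: "0 \<le> a * u\<^sup>2 - 2 * b * u * v + c * v\<^sup>2" for u v
  proof -
    have "0 \<le> (\<integral>x. (u * f x - v * g x)\<^sup>2 \<partial>M)" by simp
    also have "(\<lambda>x. (u * f x - v * g x)\<^sup>2) =
        (\<lambda>x. u\<^sup>2 * (f x)\<^sup>2 - 2 * u * v * (f x * g x) + v\<^sup>2 * (g x)\<^sup>2)"
      by (auto simp: power2_eq_square algebra_simps)
    also have "(\<integral>x. u\<^sup>2 * (f x)\<^sup>2 - 2 * u * v * (f x * g x) + v\<^sup>2 * (g x)\<^sup>2 \<partial>M) =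
        u\<^sup>2 * a - 2 * u * v * b + v\<^sup>2 * c"
      using fg f2 g2 by (simp add: a_def b_def c_def)
    finally show ?thesis by (simp add: algebra_simps)
  qed
  have "b\<^sup>2 \<le> a * c"
  proof (cases "c = 0")
    case True
    \<comment> \<open>With \<open>u = 1\<close> the form is affine in \<open>v\<close> and bounded
      below, so its slope must vanish; the chosen \<open>v\<close> would give the value -1.\<close>
    have "0 \<le> a - 2 * b * v" for v using *[of 1 v] True by simp
    from this[of "(a + 1) / (2 * b)"] have "b = 0"
      by (cases "b = 0") simp_all
    then show ?thesis using True by simp
  next
    case False
    then have "c > 0" using \<open>0 \<le> c\<close> by simp
    \<comment> \<open>The minimising direction is \<open>u = c\<close>,
      \<open>v = b\<close>.\<close>
    have "0 \<le> c * (a * c - b\<^sup>2)"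
      using *[of c b] by (simp add: power2_eq_square algebra_simps)
    then show ?thesis using \<open>c > 0\<close> by (simp add: zero_le_mult_iff)
  qed
  then show "(\<integral>x. f x * g x \<partial>M)\<^sup>2 \<le> (\<integral>x. (f x)\<^sup>2 \<partial>M) * (\<integral>x. (g x)\<^sup>2 \<partial>M)"
    by (simp add: a_def b_def c_def)
qed

text \<open>Extension by zero outside the unit interval lets every integral run over the whole line,
  so that indicators of half-lines serve as cutoffs.\<close>

definition L2_unit :: "(real \<Rightarrow> real) \<Rightarrow> bool" where
  "L2_unit g \<longleftrightarrow> g \<in> borel_measurable borel \<and> (\<forall>t. t \<notin> {0..1} \<longrightarrow> g t = 0) \<and>
     integrable lborel (\<lambda>t. (g t)\<^sup>2)"

lemma L2_unit_measurable: "L2_unit g \<Longrightarrow> g \<in> borel_measurable borel"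
  by (simp add: L2_unit_def)

lemma L2_unit_outside: "L2_unit g \<Longrightarrow> t \<notin> {0..1} \<Longrightarrow> g t = 0"
  by (simp add: L2_unit_def)

lemma L2_unit_mult_integrable:
  assumes "L2_unit f" "L2_unit g"
  shows "integrable lborel (\<lambda>t. f t * g t)"
  using assms unfolding L2_unit_def by (intro cauchy_schwarz_integral(1)) auto

lemma L2_unit_bounded:
  assumes [measurable]: "g \<in> borel_measurable borel" and "\<And>t. t \<notin> {0..1} \<Longrightarrow> g t = 0"
    and "\<And>t. \<bar>g t\<bar> \<le> B"
  shows "L2_unit g"
proof -
  have "integrable lborel (\<lambda>t. B\<^sup>2 * indicator {0..1::real} t)"
    by simp
  then have "integrable lborel (\<lambda>t. (g t)\<^sup>2)"
  proof (rule Bochner_Integration.integrable_bound)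
    show "AE t in lborel. norm ((g t)\<^sup>2) \<le> norm (B\<^sup>2 * indicator {0..1} t)"
    proof (rule AE_I2)
      fix t
      have "\<bar>g t\<bar>\<^sup>2 \<le> B\<^sup>2" using assms(3) by (intro power_mono) auto
      then show "norm ((g t)\<^sup>2) \<le> norm (B\<^sup>2 * indicator {0..1} t)"
        using assms(2)[of t] by (auto simp: indicator_def)
    qed
  qed simp
  with assms show ?thesis by (simp add: L2_unit_def)
qed

lemma L2_unit_indicator: "A \<in> sets borel \<Longrightarrow> A \<subseteq> {0..1} \<Longrightarrow> L2_unit (indicator A)"
  by (rule L2_unit_bounded[where B = 1]) (auto simp: indicator_def)

lemma L2_unit_mult_indicator:
  assumes "L2_unit g" "A \<in> sets borel"
  shows "L2_unit (\<lambda>t. g t * indicator A t)"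
proof -
  have [measurable]: "g \<in> borel_measurable borel" "A \<in> sets borel"
    using assms by (auto simp: L2_unit_def)
  have "integrable lborel (\<lambda>t. (g t)\<^sup>2 * indicator A t)"
    using assms by (intro integrable_real_mult_indicator) (auto simp: L2_unit_def)
  then have "integrable lborel (\<lambda>t. (g t * indicator A t)\<^sup>2)"
    by (rule back_subst[where P = "integrable lborel"]) (auto simp: indicator_def)
  with assms show ?thesis by (auto simp: L2_unit_def)
qed

lemma L2_unit_integrable:
  assumes "L2_unit g" shows "integrable lborel g"
proof -
  have "integrable lborel (\<lambda>t. g t * indicator {0..1} t)"
    using assms by (intro L2_unit_mult_integrable L2_unit_indicator) auto
  moreover have "(\<lambda>t. g t * indicator {0..1} t) = g"
    using L2_unit_outside[OF assms] by (auto simp: indicator_def fun_eq_iff)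
  ultimately show ?thesis by simp
qed

lemma L2_unit_add: "L2_unit f \<Longrightarrow> L2_unit g \<Longrightarrow> L2_unit (\<lambda>t. f t + g t)"
  using L2_unit_mult_integrable[of f g]
  by (auto simp: L2_unit_def power2_sum mult.assoc)

lemma L2_unit_cmult: "L2_unit g \<Longrightarrow> L2_unit (\<lambda>t. c * g t)"
  by (auto simp: L2_unit_def power_mult_distrib)

lemma L2_unit_sum: "(\<And>i. i \<in> I \<Longrightarrow> L2_unit (g i)) \<Longrightarrow> L2_unit (\<lambda>t. \<Sum>i\<in>I. g i t)"
proof (induction I rule: infinite_finite_induct)
  case (insert i I)
  then show ?case using L2_unit_add by auto
qed (auto simp: L2_unit_def)

text \<open>The pairs of \<open>W12\<close>, with the derivative replaced by its extension by zero.
  The lower limit 0 of the integral is implicit, since \<open>g\<close> vanishes on the negative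
  half-line.\<close>

definition antideriv :: "(real \<Rightarrow> real) \<Rightarrow> (real \<Rightarrow> real) \<Rightarrow> bool" where
  "antideriv y g \<longleftrightarrow> L2_unit g \<and>
     (\<forall>x\<in>{0..1}. y x - y 0 = (\<integral>t. g t * indicator {..<x} t \<partial>lborel))"

lemma antideriv_L2: "antideriv y g \<Longrightarrow> L2_unit g"
  by (simp add: antideriv_def)

lemma antideriv_eq:
  "antideriv y g \<Longrightarrow> x \<in> {0..1} \<Longrightarrow> y x = y 0 + (\<integral>t. g t * indicator {..<x} t \<partial>lborel)"
  unfolding antideriv_def by (drule conjunct2, drule (1) bspec) linarith

lemma integral_lborel_indicator_atMost:
  fixes g :: "real \<Rightarrow> real"
  assumes [measurable]: "g \<in> borel_measurable borel"
  shows "(\<integral>t. g t * indicator {..x} t \<partial>lborel) = (\<integral>t. g t * indicator {..<x} t \<partial>lborel)"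
proof -
  have "AE t in lborel. t \<noteq> x" by (rule AE_lborel_singleton)
  then show ?thesis
    by (intro integral_cong_AE) (auto simp: indicator_def)
qed

lemma antideriv_W12:
  assumes "antideriv y g" shows "W12 y g"
proof -
  have g: "L2_unit g" using assms by (simp add: antideriv_def)
  have [measurable]: "g \<in> borel_measurable borel" using L2_unit_measurable[OF g] .
  have eq: "(\<lambda>x. indicat_real {0..1} x *\<^sub>R (g x)\<^sup>2) = (\<lambda>x. (g x)\<^sup>2)"
    using L2_unit_outside[OF g] by (auto simp: indicator_def fun_eq_iff)
  show ?thesis
    unfolding W12_def
  proof (intro conjI ballI)
    show "set_borel_measurable lborel {0..1} g" by (simp add: set_borel_measurable_def)
    show "set_integrable lborel {0..1} (\<lambda>x. (g x)\<^sup>2)"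
      using g unfolding set_integrable_def eq by (simp add: L2_unit_def)
    fix x :: real assume x: "x \<in> {0..1}"
    have "y x = y 0 + (\<integral>t. g t * indicator {..x} t \<partial>lborel)"
      using antideriv_eq[OF assms x] by (simp add: integral_lborel_indicator_atMost)
    also have "(\<lambda>t. g t * indicator {..x} t) = (\<lambda>t. indicat_real {0..x} t *\<^sub>R g t)"
      using L2_unit_outside[OF g] by (auto simp: indicator_def fun_eq_iff)
    finally show "y x = y 0 + (LINT t:{0..x}|lborel. g t)"
      by (simp add: set_lebesgue_integral_def)
  qed
qed

lemma W12_antideriv:
  assumes "W12 y g"
  shows "antideriv y (\<lambda>t. indicator {0..1} t * g t)"
proof -
  let ?g = "\<lambda>t. indicator {0..1} t * g t"
  have eq: "(\<lambda>x. indicat_real {0..1} x *\<^sub>R (g x)\<^sup>2) = (\<lambda>x. (?g x)\<^sup>2)"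
    by (auto simp: indicator_def fun_eq_iff)
  have g: "L2_unit ?g"
    unfolding L2_unit_def
  proof (intro conjI allI impI)
    show "?g \<in> borel_measurable borel"
      using assms unfolding W12_def set_borel_measurable_def by simp
    have "set_integrable lborel {0..1} (\<lambda>x. (g x)\<^sup>2)" using assms unfolding W12_def by blast
    then show "integrable lborel (\<lambda>t. (?g t)\<^sup>2)" unfolding set_integrable_def eq .
  qed (simp add: indicator_def)
  have "y x - y 0 = (\<integral>t. ?g t * indicator {..<x} t \<partial>lborel)" if x: "x \<in> {0..1}" for x
  proof -
    have "y x = y 0 + (LINT t:{0..x}|lborel. g t)" using assms x unfolding W12_def by blast
    also have "(LINT t:{0..x}|lborel. g t) = (\<integral>t. ?g t * indicator {..x} t \<partial>lborel)"
      unfolding set_lebesgue_integral_def using x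
      by (intro Bochner_Integration.integral_cong) (auto simp: indicator_def)
    finally show ?thesis
      using L2_unit_measurable[OF g] by (simp add: integral_lborel_indicator_atMost)
  qed
  with g show ?thesis by (simp add: antideriv_def)
qed

lemma antideriv_diff:
  assumes "antideriv y g" "x \<in> {0..1}" "z \<in> {0..1}" "x \<le> z"
  shows "y z - y x = (\<integral>t. g t * indicator {x..<z} t \<partial>lborel)"
proof -
  have int: "integrable lborel (\<lambda>t. g t * indicator {..<a} t)" for a
    using L2_unit_integrable[OF L2_unit_mult_indicator[OF antideriv_L2[OF assms(1)]]] by simp
  have "y z - y x = (\<integral>t. g t * indicator {..<z} t \<partial>lborel) - (\<integral>t. g t * indicator {..<x} t \<partial>lborel)"
    using antideriv_eq[OF assms(1,2)] antideriv_eq[OF assms(1,3)] by simp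
  also have "\<dots> = (\<integral>t. g t * indicator {..<z} t - g t * indicator {..<x} t \<partial>lborel)"
    using int by simp
  also have "\<dots> = (\<integral>t. g t * indicator {x..<z} t \<partial>lborel)"
    using assms(4) by (intro Bochner_Integration.integral_cong) (auto simp: indicator_def)
  finally show ?thesis .
qed

text \<open>Cauchy-Schwarz against the indicator of \<open>[p, x)\<close>. Energy is counted on the
  open interval, so that these bounds can be added over cells that share end points.\<close>

lemma antideriv_diff_square:
  assumes "antideriv y g" "p \<in> {0..1}" "q \<in> {0..1}" "p \<le> x" "x \<le> q"
  shows "(y x - y p)\<^sup>2 \<le> (q - p) * (\<integral>t. (g t)\<^sup>2 * indicator {p<..<q} t \<partial>lborel)"
proof -
  have g: "L2_unit g" using assms by (simp add: antideriv_def)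
  let ?f = "\<lambda>t. g t * indicator {p<..<q} t"
  let ?h = "indicator {p..<x} :: real \<Rightarrow> real"
  have f: "L2_unit ?f" using L2_unit_mult_indicator[OF g] by simp
  have h: "L2_unit ?h" using assms by (intro L2_unit_indicator) auto
  have ae: "AE t in lborel. t \<noteq> p" by (rule AE_lborel_singleton)
  have "y x - y p = (\<integral>t. g t * indicator {p..<x} t \<partial>lborel)"
    using assms by (intro antideriv_diff) auto
  also have "\<dots> = (\<integral>t. ?f t * ?h t \<partial>lborel)"
    using ae assms L2_unit_measurable[OF f] L2_unit_measurable[OF g]
    by (intro integral_cong_AE) (auto simp: indicator_def)
  finally have "(y x - y p)\<^sup>2 \<le> (\<integral>t. (?f t)\<^sup>2 \<partial>lborel) * (\<integral>t. (?h t)\<^sup>2 \<partial>lborel)"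
    using f h cauchy_schwarz_integral(2)[of ?f lborel ?h] by (auto simp: L2_unit_def)
  also have "(\<integral>t. (?h t)\<^sup>2 \<partial>lborel) = x - p"
  proof -
    have "(\<lambda>t. (?h t)\<^sup>2) = ?h" by (auto simp: indicator_def)
    then show ?thesis using assms by simp
  qed
  also have "(\<lambda>t. (?f t)\<^sup>2) = (\<lambda>t. (g t)\<^sup>2 * indicator {p<..<q} t)"
    by (auto simp: indicator_def)
  also have "(\<integral>t. (g t)\<^sup>2 * indicator {p<..<q} t \<partial>lborel) * (x - p) \<le>
      (\<integral>t. (g t)\<^sup>2 * indicator {p<..<q} t \<partial>lborel) * (q - p)"
    using assms by (intro mult_left_mono) auto
  finally show ?thesis by (simp add: mult.commute)
qed

text \<open>The preceding bound, taken between two arbitrary points, is Hoelder continuity of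
  exponent 1/2.\<close>

lemma antideriv_continuous:
  assumes "antideriv y g" shows "continuous_on {0..1} y"
proof -
  have g: "L2_unit g" using assms by (simp add: antideriv_def)
  define B where "B = (\<integral>t. (g t)\<^sup>2 \<partial>lborel)"
  have bd: "(y x - y p)\<^sup>2 \<le> B * \<bar>x - p\<bar>" if xp: "x \<in> {0..1}" "p \<in> {0..1}" "p \<le> x" for x p
  proof -
    have "(y x - y p)\<^sup>2 \<le> (x - p) * (\<integral>t. (g t)\<^sup>2 * indicator {p<..<x} t \<partial>lborel)"
      using assms xp by (intro antideriv_diff_square) auto
    also have "\<dots> \<le> (x - p) * B"
      unfolding B_def using xp g
      by (intro mult_left_mono integral_mono integrable_real_mult_indicator)
        (auto simp: L2_unit_def indicator_def)
    finally show ?thesis using xp by (simp add: mult.commute)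
  qed
  have bd': "(y x - y p)\<^sup>2 \<le> B * \<bar>x - p\<bar>" if "x \<in> {0..1}" "p \<in> {0..1}" for x p
    using bd[of x p] bd[of p x] that by (cases "p \<le> x") (auto simp: power2_commute abs_minus_commute)
  have "(y \<longlongrightarrow> y p) (at p within {0..1})" if p: "p \<in> {0..1}" for p
  proof -
    have "((\<lambda>x. sqrt (B * \<bar>x - p\<bar>)) \<longlongrightarrow> sqrt (B * \<bar>p - p\<bar>)) (at p within {0..1})"
      by (intro tendsto_intros)
    then have "((\<lambda>x. sqrt (B * \<bar>x - p\<bar>)) \<longlongrightarrow> 0) (at p within {0..1})" by simp
    moreover have "eventually (\<lambda>x. norm (y x - y p) \<le> sqrt (B * \<bar>x - p\<bar>)) (at p within {0..1})"
      unfolding eventually_at_filter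
      using bd'[OF _ p] by (auto intro!: always_eventually real_le_rsqrt)
    ultimately have "((\<lambda>x. y x - y p) \<longlongrightarrow> 0) (at p within {0..1})"
      by (rule Lim_null_comparison[rotated])
    then show ?thesis by (simp add: LIM_zero_iff)
  qed
  then show ?thesis by (simp add: continuous_on_def)
qed

lemma antideriv_sum:
  assumes "finite I" "\<And>i. i \<in> I \<Longrightarrow> antideriv (y i) (g i)"
  shows "antideriv (\<lambda>x. \<Sum>i\<in>I. c i * y i x) (\<lambda>x. \<Sum>i\<in>I. c i * g i x)"
proof -
  have int: "integrable lborel (\<lambda>t. g i t * indicator {..<a} t)" if "i \<in> I" for a i
    using L2_unit_integrable[OF L2_unit_mult_indicator[OF antideriv_L2[OF assms(2)[OF that]]]] by simp
  have "L2_unit (\<lambda>x. \<Sum>i\<in>I. c i * g i x)"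
    using assms by (intro L2_unit_sum L2_unit_cmult) (auto simp: antideriv_def)
  moreover have "(\<Sum>i\<in>I. c i * y i x) - (\<Sum>i\<in>I. c i * y i 0) =
      (\<integral>t. (\<Sum>i\<in>I. c i * g i t) * indicator {..<x} t \<partial>lborel)" if x: "x \<in> {0..1}" for x
  proof -
    have "(\<integral>t. (\<Sum>i\<in>I. c i * g i t) * indicator {..<x} t \<partial>lborel) =
        (\<Sum>i\<in>I. c i * (\<integral>t. g i t * indicator {..<x} t \<partial>lborel))"
      using int by (simp add: sum_distrib_right mult.assoc)
    moreover have "(\<Sum>i\<in>I. c i * y i x) =
        (\<Sum>i\<in>I. c i * y i 0 + c i * (\<integral>t. g i t * indicator {..<x} t \<partial>lborel))"
      using antideriv_eq[OF assms(2) x] by (intro sum.cong) (auto simp: distrib_left)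
    ultimately show ?thesis by (simp add: sum.distrib)
  qed
  ultimately show ?thesis by (simp add: antideriv_def)
qed

lemma antideriv_const: "antideriv (\<lambda>_. c) (\<lambda>_. 0)"
  by (simp add: antideriv_def L2_unit_def)

lemma antideriv_integral:
  "L2_unit g \<Longrightarrow> antideriv (\<lambda>x. a + (\<integral>t. g t * indicator {..<x} t \<partial>lborel)) g"
proof -
  assume g: "L2_unit g"
  have "(\<lambda>t. g t * indicator {..<0} t) = (\<lambda>_. 0)"
    using L2_unit_outside[OF g] by (auto simp: indicator_def fun_eq_iff)
  with g show ?thesis by (simp add: antideriv_def)
qed

lemma antideriv_cong:
  "antideriv y g \<Longrightarrow> (\<And>x. x \<in> {0..1} \<Longrightarrow> z x = y x) \<Longrightarrow> antideriv z g"
  by (auto simp: antideriv_def)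

section \<open>Eigenpairs of a measure on the unit interval\<close>

locale unit_interval_measure = prob_space \<mu> for \<mu> :: "real measure" +
  assumes sets_eq: "sets \<mu> = sets (restrict_space borel {0..1})"
begin

lemma space_eq: "space \<mu> = {0..1}"
  using sets_eq_imp_space_eq[OF sets_eq] by (simp add: space_restrict_space)

lemma measurable_continuous:
  fixes f :: "real \<Rightarrow> real"
  assumes "continuous_on {0..1} f" shows "f \<in> borel_measurable \<mu>"
  using borel_measurable_continuous_on_restrict[OF assms] measurable_cong_sets[OF sets_eq refl] by auto

lemma measurable_ident [measurable]: "(\<lambda>x. x) \<in> borel_measurable \<mu>"
  by (rule measurable_continuous) simp

lemma integrable_bounded:
  fixes f :: "real \<Rightarrow> real"
  assumes "f \<in> borel_measurable \<mu>" "\<And>x. x \<in> {0..1} \<Longrightarrow> \<bar>f x\<bar> \<le> B"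
  shows "integrable \<mu> f"
  using assms by (intro integrable_const_bound[of _ B]) (auto simp: space_eq)

lemma integrable_continuous:
  fixes f :: "real \<Rightarrow> real"
  assumes "continuous_on {0..1} f" shows "integrable \<mu> f"
proof -
  have "bounded (f ` {0..1})"
    using assms by (intro compact_imp_bounded compact_continuous_image) auto
  then obtain B where "\<forall>x\<in>{0..1}. \<bar>f x\<bar> \<le> B"
    by (auto simp: bounded_iff)
  then show ?thesis
    by (intro integrable_bounded[of f B] measurable_continuous assms) auto
qed

lemma abs_integral_le:
  fixes f :: "real \<Rightarrow> real"
  assumes "f \<in> borel_measurable \<mu>" "\<And>x. x \<in> {0..1} \<Longrightarrow> \<bar>f x\<bar> \<le> B"
  shows "\<bar>\<integral>x. f x \<partial>\<mu>\<bar> \<le> B"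
proof -
  have "\<bar>\<integral>x. f x \<partial>\<mu>\<bar> \<le> (\<integral>x. \<bar>f x\<bar> \<partial>\<mu>)" by simp
  also have "\<dots> \<le> (\<integral>x. B \<partial>\<mu>)"
    using assms by (intro integral_mono integrable_abs integrable_bounded[of f B]) (auto simp: space_eq)
  finally show ?thesis by (simp add: prob_space)
qed

lemma integral_cong_unit:
  fixes f g :: "real \<Rightarrow> real"
  shows "(\<And>x. x \<in> {0..1} \<Longrightarrow> f x = g x) \<Longrightarrow> (\<integral>x. f x \<partial>\<mu>) = (\<integral>x. g x \<partial>\<mu>)"
  by (intro Bochner_Integration.integral_cong) (auto simp: space_eq)

text \<open>Distribution function of the signed measure with density \<open>f\<close>; up to sign it
  is the derivative of the solution of \<open>- y'' = f \<mu>\<close> with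
  \<open>y'(0) = 0\<close>.\<close>

definition cumul :: "(real \<Rightarrow> real) \<Rightarrow> real \<Rightarrow> real" where
  "cumul f s = (\<integral>x. f x * indicator {..<s} x \<partial>\<mu>)"

lemma measurable_mult_lessThan:
  fixes f :: "real \<Rightarrow> real"
  assumes [measurable]: "f \<in> borel_measurable \<mu>"
  shows "(\<lambda>(s, x). f x * indicator {..<s} x) \<in> borel_measurable (lborel \<Otimes>\<^sub>M \<mu>)"
proof -
  have [measurable]: "(\<lambda>p. snd p) \<in> borel_measurable (lborel \<Otimes>\<^sub>M \<mu>)"
    "(\<lambda>p. fst p) \<in> borel_measurable (lborel \<Otimes>\<^sub>M \<mu>)"
    using measurable_compose[OF measurable_snd measurable_ident] by auto
  have eq: "(\<lambda>(s, x). f x * indicator {..<s} x) = (\<lambda>p. f (snd p) * (if snd p < fst p then 1 else 0))"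
    by (auto simp: indicator_def)
  show ?thesis
    unfolding eq using measurable_compose[OF measurable_snd assms]
    by (intro borel_measurable_times measurable_If borel_measurable_const borel_measurable_less) auto
qed

lemma integrable_mult_lessThan:
  fixes f :: "real \<Rightarrow> real"
  assumes "continuous_on {0..1} f"
  shows "integrable \<mu> (\<lambda>x. f x * indicator {..<s} x)"
proof -
  have "{..<s} \<inter> {0..1} \<in> sets \<mu>"
    unfolding sets_eq by (auto simp: sets_restrict_space Int_commute)
  then have "integrable \<mu> (\<lambda>x. f x * indicator ({..<s} \<inter> {0..1}) x)"
    by (rule integrable_real_mult_indicator[OF _ integrable_continuous[OF assms]])
  then show ?thesis
    by (rule Bochner_Integration.integrable_cong[THEN iffD1, rotated -1]) (auto simp: indicator_def space_eq)
qed

lemma cumul_measurable [measurable]: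
  "continuous_on {0..1} f \<Longrightarrow> cumul f \<in> borel_measurable borel"
  using borel_measurable_lebesgue_integral[OF measurable_mult_lessThan[OF measurable_continuous]]
  by (simp add: cumul_def[abs_def])

lemma cumul_linear:
  assumes "continuous_on {0..1} f" "continuous_on {0..1} h"
  shows "cumul (\<lambda>x. a * f x + b * h x) s = a * cumul f s + b * cumul h s"
proof -
  have "cumul (\<lambda>x. a * f x + b * h x) s =
      (\<integral>x. a * (f x * indicator {..<s} x) + b * (h x * indicator {..<s} x) \<partial>\<mu>)"
    unfolding cumul_def by (intro Bochner_Integration.integral_cong) (auto simp: algebra_simps)
  also have "\<dots> = a * cumul f s + b * cumul h s"
    using assms unfolding cumul_def by (simp add: integrable_mult_lessThan)
  finally show ?thesis .
qed

lemma cumul_bound: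
  assumes f: "continuous_on {0..1} f"
  shows "\<bar>cumul f s\<bar> \<le> sqrt (\<integral>x. (f x)\<^sup>2 \<partial>\<mu>)"
proof -
  have f2: "integrable \<mu> (\<lambda>x. (f x)\<^sup>2)"
    by (intro integrable_continuous continuous_intros f)
  let ?i = "\<lambda>x. indicator {..<s} x :: real"
  have eq: "(\<lambda>x. (?i x)\<^sup>2) = ?i" by (auto simp: indicator_def)
  have i: "integrable \<mu> ?i"
    using integrable_mult_lessThan[of "\<lambda>_. 1" s, OF continuous_on_const] unfolding mult_1 .
  have "(cumul f s)\<^sup>2 \<le> (\<integral>x. (f x)\<^sup>2 \<partial>\<mu>) * (\<integral>x. (?i x)\<^sup>2 \<partial>\<mu>)"
    unfolding cumul_def using f2 i
    by (intro cauchy_schwarz_integral measurable_continuous[OF f]) (auto simp: eq)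
  also have "\<dots> \<le> (\<integral>x. (f x)\<^sup>2 \<partial>\<mu>) * 1"
  proof (rule mult_left_mono)
    have "(\<integral>x. ?i x \<partial>\<mu>) \<le> (\<integral>x. 1 \<partial>\<mu>)"
      using i by (intro integral_mono) (auto simp: indicator_def)
    then show "(\<integral>x. (?i x)\<^sup>2 \<partial>\<mu>) \<le> 1" unfolding eq by (simp add: prob_space)
  qed simp
  finally have "(cumul f s)\<^sup>2 \<le> (\<integral>x. (f x)\<^sup>2 \<partial>\<mu>)" by simp
  then show ?thesis by (simp add: real_le_rsqrt)
qed

text \<open>Mean zero is the solvability condition of the Neumann problem: it makes
  \<open>cumul f\<close> vanish beyond 1 as well as before 0, which is what puts it into
  \<open>L2_unit\<close>.\<close>

lemma cumul_outside:
  assumes "(\<integral>x. f x \<partial>\<mu>) = 0" "s \<notin> {0..1}" shows "cumul f s = 0"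
proof (cases "s < 0")
  case True
  then have "cumul f s = (\<integral>x. 0 \<partial>\<mu>)"
    unfolding cumul_def by (intro integral_cong_unit) (auto simp: indicator_def)
  then show ?thesis by simp
next
  case False
  with assms have "cumul f s = (\<integral>x. f x \<partial>\<mu>)"
    unfolding cumul_def by (intro integral_cong_unit) (auto simp: indicator_def)
  then show ?thesis using assms by simp
qed

lemma cumul_L2:
  assumes "continuous_on {0..1} f" "(\<integral>x. f x \<partial>\<mu>) = 0"
  shows "L2_unit (cumul f)"
  using cumul_measurable[OF assms(1)] cumul_outside[OF assms(2)] cumul_bound[OF assms(1)]
  by (rule L2_unit_bounded)

text \<open>Fubini, after writing \<open>y x\<close> as \<open>y 1\<close> minus the integral of
  \<open>g\<close> over \<open>t > x\<close>. Anchoring at 1 makes the inner integral equal to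
  \<open>cumul f t\<close>, and the boundary term disappears whenever \<open>f\<close> has mean
  zero.\<close>

lemma integral_by_parts:
  assumes f: "continuous_on {0..1} f" and y: "antideriv y g"
  shows "(\<integral>x. f x * y x \<partial>\<mu>) = y 1 * (\<integral>x. f x \<partial>\<mu>) - (\<integral>s. g s * cumul f s \<partial>lborel)"
proof -
  have g: "L2_unit g" using y by (rule antideriv_L2)
  have [measurable]: "g \<in> borel_measurable borel" "f \<in> borel_measurable \<mu>"
    using L2_unit_measurable[OF g] measurable_continuous[OF f] by auto
  have gint: "integrable lborel g" by (rule L2_unit_integrable[OF g])
  have gind: "integrable lborel (\<lambda>t. g t * indicator {..x} t)" for x
    using gint by (intro integrable_real_mult_indicator) auto
  have y1: "y x = y 1 - (\<integral>t. g t * indicator {..<t} x \<partial>lborel)" if x: "x \<in> {0..1}" for x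
  proof -
    have "y x = y 0 + (\<integral>t. g t * indicator {..x} t \<partial>lborel)"
      using antideriv_eq[OF y x] by (simp add: integral_lborel_indicator_atMost)
    moreover have "y 1 = y 0 + (\<integral>t. g t * indicator {..1} t \<partial>lborel)"
      using antideriv_eq[OF y, of 1] by (simp add: integral_lborel_indicator_atMost)
    ultimately have "y 1 - y x = (\<integral>t. g t * indicator {..1} t - g t * indicator {..x} t \<partial>lborel)"
      using gind by simp
    also have "\<dots> = (\<integral>t. g t * indicator {..<t} x \<partial>lborel)"
      using x L2_unit_outside[OF g]
      by (intro Bochner_Integration.integral_cong) (auto simp: indicator_def)
    finally show ?thesis by simp
  qed
  interpret pair_sigma_finite lborel \<mu>
    by (intro pair_sigma_finite.intro sigma_finite_lborel) unfold_locales
  have meas: "(\<lambda>(t, x). f x * g t * indicator {..<t} x) \<in> borel_measurable (lborel \<Otimes>\<^sub>M \<mu>)"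
  proof -
    have "(\<lambda>p. g (fst p) * (case p of (s, x) \<Rightarrow> f x * indicator {..<s} x)) \<in> borel_measurable (lborel \<Otimes>\<^sub>M \<mu>)"
      using measurable_mult_lessThan[of f] by measurable
    also have "(\<lambda>p. g (fst p) * (case p of (s, x) \<Rightarrow> f x * indicator {..<s} x)) =
        (\<lambda>(t, x). f x * g t * indicator {..<t} x)"
      by auto
    finally show ?thesis .
  qed
  \<comment> \<open>The product without the cutoff is integrable and dominates the integrand of the
    double integral.\<close>
  have prod: "integrable (lborel \<Otimes>\<^sub>M \<mu>) (\<lambda>p. f (snd p) * g (fst p))"
  proof (rule Fubini_integrable)
    show "(\<lambda>p. f (snd p) * g (fst p)) \<in> borel_measurable (lborel \<Otimes>\<^sub>M \<mu>)" by measurable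
    show "integrable lborel (\<lambda>x. \<integral>y. norm (f (snd (x, y)) * g (fst (x, y))) \<partial>\<mu>)"
      using gint by (simp add: abs_mult)
    show "AE x in lborel. integrable \<mu> (\<lambda>y. f (snd (x, y)) * g (fst (x, y)))"
      using integrable_continuous[OF f] by simp
  qed
  have int: "integrable (lborel \<Otimes>\<^sub>M \<mu>) (\<lambda>(t, x). f x * g t * indicator {..<t} x)"
    by (rule Bochner_Integration.integrable_bound[OF prod meas])
      (auto intro!: AE_I2 simp: indicator_def)
  have fub: "(\<integral>x. (\<integral>t. f x * g t * indicator {..<t} x \<partial>lborel) \<partial>\<mu>) =
      (\<integral>t. (\<integral>x. f x * g t * indicator {..<t} x \<partial>\<mu>) \<partial>lborel)"
    by (rule Fubini_integral[OF int])
  have int2: "integrable \<mu> (\<lambda>x. \<integral>t. f x * g t * indicator {..<t} x \<partial>lborel)"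
    using integrable_snd[OF int] by simp
  have "(\<integral>x. f x * y x \<partial>\<mu>) =
      (\<integral>x. y 1 * f x - (\<integral>t. f x * g t * indicator {..<t} x \<partial>lborel) \<partial>\<mu>)"
  proof (rule integral_cong_unit)
    fix x :: real assume x: "x \<in> {0..1}"
    show "f x * y x = y 1 * f x - (\<integral>t. f x * g t * indicator {..<t} x \<partial>lborel)"
      unfolding y1[OF x] mult.assoc integral_mult_right_zero by (simp add: right_diff_distrib mult.commute)
  qed
  also have "\<dots> = y 1 * (\<integral>x. f x \<partial>\<mu>) - (\<integral>x. (\<integral>t. f x * g t * indicator {..<t} x \<partial>lborel) \<partial>\<mu>)"
    using int2 integrable_continuous[OF f] by simp
  also have "(\<integral>x. (\<integral>t. f x * g t * indicator {..<t} x \<partial>lborel) \<partial>\<mu>) = (\<integral>s. g s * cumul f s \<partial>lborel)"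
  proof -
    have "(\<integral>x. f x * g t * indicator {..<t} x \<partial>\<mu>) = g t * cumul f t" for t
      unfolding cumul_def mult.commute[of "f _"] mult.assoc by (rule integral_mult_right_zero)
    then show ?thesis unfolding fub by simp
  qed
  finally show ?thesis .
qed

definition eigenpair :: "real \<Rightarrow> (real \<Rightarrow> real) \<Rightarrow> (real \<Rightarrow> real) \<Rightarrow> bool" where
  "eigenpair l y g \<longleftrightarrow> antideriv y g \<and>
     (\<forall>\<eta> \<eta>'. antideriv \<eta> \<eta>' \<longrightarrow> (\<integral>t. g t * \<eta>' t \<partial>lborel) = l * (\<integral>x. y x * \<eta> x \<partial>\<mu>))"

lemma eigenpairD:
  "eigenpair l y g \<Longrightarrow> antideriv \<eta> \<eta>' \<Longrightarrow> (\<integral>t. g t * \<eta>' t \<partial>lborel) = l * (\<integral>x. y x * \<eta> x \<partial>\<mu>)"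
  unfolding eigenpair_def by blast

lemma eigenpair_antideriv: "eigenpair l y g \<Longrightarrow> antideriv y g"
  unfolding eigenpair_def by blast

lemma neumann_eigenvalue_iff:
  "neumann_eigenvalue \<mu> l \<longleftrightarrow> (\<exists>y g. eigenpair l y g \<and> (\<exists>x\<in>{0..1}. y x \<noteq> 0))"
proof
  assume "neumann_eigenvalue \<mu> l"
  then obtain y g where W: "W12 y g" and nz: "\<exists>x\<in>{0..1}. y x \<noteq> 0" and
    eq: "\<And>\<eta> \<eta>'. W12 \<eta> \<eta>' \<Longrightarrow> (LINT x:{0..1}|lborel. g x * \<eta>' x) = l * (LINT x|\<mu>. y x * \<eta> x)"
    unfolding neumann_eigenvalue_def by blast
  have "eigenpair l y (\<lambda>t. indicator {0..1} t * g t)"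
    unfolding eigenpair_def
  proof (intro conjI allI impI W12_antideriv[OF W])
    fix \<eta> \<eta>' assume "antideriv \<eta> \<eta>'"
    from eq[OF antideriv_W12[OF this]]
    show "(\<integral>t. indicator {0..1} t * g t * \<eta>' t \<partial>lborel) = l * (\<integral>x. y x * \<eta> x \<partial>\<mu>)"
      by (simp add: set_lebesgue_integral_def mult.assoc)
  qed
  with nz show "\<exists>y g. eigenpair l y g \<and> (\<exists>x\<in>{0..1}. y x \<noteq> 0)" by blast
next
  assume "\<exists>y g. eigenpair l y g \<and> (\<exists>x\<in>{0..1}. y x \<noteq> 0)"
  then obtain y g where e: "eigenpair l y g" and nz: "\<exists>x\<in>{0..1}. y x \<noteq> 0" by blast
  have y: "antideriv y g" by (rule eigenpair_antideriv[OF e])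
  show "neumann_eigenvalue \<mu> l"
    unfolding neumann_eigenvalue_def
  proof (intro exI conjI allI impI)
    show "W12 y g" using y by (rule antideriv_W12)
    fix \<eta> \<eta>' assume "W12 \<eta> \<eta>'"
    from eigenpairD[OF e W12_antideriv[OF this]]
    show "(LINT x:{0..1}|lborel. g x * \<eta>' x) = l * (LINT x|\<mu>. y x * \<eta> x)"
      by (simp add: set_lebesgue_integral_def mult.left_commute)
  qed (rule nz)
qed

end

section \<open>Upper bound for the number of eigenvalues\<close>

text \<open>Pythagoras. It is applied with the same coefficients to functions under
  \<open>\<mu>\<close> and to their derivatives under Lebesgue measure, so that a bound on each
  Rayleigh quotient passes to the combination.\<close>

lemma integral_square_sum_orthogonal:
  fixes f :: "'i \<Rightarrow> 'a \<Rightarrow> real"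
  assumes "finite I" and int: "\<And>i j. i \<in> I \<Longrightarrow> j \<in> I \<Longrightarrow> integrable M (\<lambda>x. f i x * f j x)"
    and orth: "\<And>i j. i \<in> I \<Longrightarrow> j \<in> I \<Longrightarrow> i \<noteq> j \<Longrightarrow> (\<integral>x. f i x * f j x \<partial>M) = 0"
  shows "(\<integral>x. (\<Sum>i\<in>I. c i * f i x)\<^sup>2 \<partial>M) = (\<Sum>i\<in>I. (c i)\<^sup>2 * (\<integral>x. (f i x)\<^sup>2 \<partial>M))"
proof -
  have "(\<integral>x. (\<Sum>i\<in>I. c i * f i x)\<^sup>2 \<partial>M) =
      (\<integral>x. (\<Sum>i\<in>I. \<Sum>j\<in>I. (c i * c j) * (f i x * f j x)) \<partial>M)"
    by (simp add: power2_eq_square sum_product mult_ac)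
  also have "\<dots> = (\<Sum>i\<in>I. \<Sum>j\<in>I. (c i * c j) * (\<integral>x. f i x * f j x \<partial>M))"
    using int by (simp add: Bochner_Integration.integral_sum)
  also have "\<dots> = (\<Sum>i\<in>I. \<Sum>j\<in>I. if j = i then (c i)\<^sup>2 * (\<integral>x. (f i x)\<^sup>2 \<partial>M) else 0)"
    using orth by (intro sum.cong) (auto simp: power2_eq_square)
  also have "\<dots> = (\<Sum>i\<in>I. (c i)\<^sup>2 * (\<integral>x. (f i x)\<^sup>2 \<partial>M))"
    using assms(1) by (simp add: sum.delta)
  finally show ?thesis .
qed

lemma antideriv_constant:
  assumes "antideriv y g" "(\<integral>t. (g t)\<^sup>2 \<partial>lborel) = 0" "x \<in> {0..1}"
  shows "y x = y 0"
proof -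
  have g: "L2_unit g" by (rule antideriv_L2[OF assms(1)])
  have "(y x - y 0)\<^sup>2 \<le> (1 - 0) * (\<integral>t. (g t)\<^sup>2 * indicator {0<..<1} t \<partial>lborel)"
    using assms by (intro antideriv_diff_square) auto
  also have "(\<integral>t. (g t)\<^sup>2 * indicator {0<..<1} t \<partial>lborel) \<le> (\<integral>t. (g t)\<^sup>2 \<partial>lborel)"
    using g by (intro integral_mono integrable_real_mult_indicator) (auto simp: L2_unit_def indicator_def)
  finally show ?thesis using assms(2) by simp
qed

context unit_interval_measure
begin

lemma eigenpair_energy:
  "eigenpair l y g \<Longrightarrow> (\<integral>t. (g t)\<^sup>2 \<partial>lborel) = l * (\<integral>x. (y x)\<^sup>2 \<partial>\<mu>)"
  using eigenpairD[OF _ eigenpair_antideriv] by (simp add: power2_eq_square)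

text \<open>Each weak equation is tested with the other eigenfunction; this evaluates one symmetric
  form in two ways, which differ by the factor \<open>l - l'\<close> times the scalar
  product.\<close>

lemma eigenpair_orthogonal:
  assumes "eigenpair l y g" "eigenpair l' z h" "l \<noteq> l'"
  shows "(\<integral>x. y x * z x \<partial>\<mu>) = 0" "(\<integral>t. g t * h t \<partial>lborel) = 0"
proof -
  have 1: "(\<integral>t. g t * h t \<partial>lborel) = l * (\<integral>x. y x * z x \<partial>\<mu>)"
    by (rule eigenpairD[OF assms(1) eigenpair_antideriv[OF assms(2)]])
  have "(\<integral>t. h t * g t \<partial>lborel) = l' * (\<integral>x. z x * y x \<partial>\<mu>)"
    by (rule eigenpairD[OF assms(2) eigenpair_antideriv[OF assms(1)]])
  then have "(l - l') * (\<integral>x. y x * z x \<partial>\<mu>) = 0"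
    using 1 by (simp add: mult.commute algebra_simps)
  then show "(\<integral>x. y x * z x \<partial>\<mu>) = 0" using assms(3) by simp
  with 1 show "(\<integral>t. g t * h t \<partial>lborel) = 0" by simp
qed

lemma eigenpair_continuous: "eigenpair l y g \<Longrightarrow> continuous_on {0..1} y"
  using eigenpair_antideriv antideriv_continuous by blast

text \<open>A continuous function may be nonzero only where \<open>\<mu>\<close> has no mass, so the
  eigenvalue equation has to help: zero norm forces zero energy, hence a constant, and a probability
  measure sees every nonzero constant.\<close>

lemma eigenpair_norm_pos:
  assumes "eigenpair l y g" "\<exists>x\<in>{0..1}. y x \<noteq> 0"
  shows "(\<integral>x. (y x)\<^sup>2 \<partial>\<mu>) > 0"
proof (rule ccontr)
  assume "\<not> ?thesis"
  moreover have "0 \<le> (\<integral>x. (y x)\<^sup>2 \<partial>\<mu>)" by simp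
  ultimately have n: "(\<integral>x. (y x)\<^sup>2 \<partial>\<mu>) = 0" by linarith
  then have "(\<integral>t. (g t)\<^sup>2 \<partial>lborel) = 0" using eigenpair_energy[OF assms(1)] by simp
  note c = antideriv_constant[OF eigenpair_antideriv[OF assms(1)] this]
  have "(\<integral>x. (y x)\<^sup>2 \<partial>\<mu>) = (\<integral>x. (y 0)\<^sup>2 \<partial>\<mu>)"
    by (rule integral_cong_unit) (metis c)
  then have "y 0 = 0" using n by (simp add: prob_space)
  with c assms(2) show False by metis
qed

lemma atLeastAtMost_sets: "0 \<le> p \<Longrightarrow> q \<le> 1 \<Longrightarrow> {p..q} \<in> sets \<mu>"
  unfolding sets_eq by (auto simp: sets_restrict_space image_iff intro!: bexI[of _ "{p..q}"])

text \<open>Closed cells that meet at end points do no harm: overlaps only increase the mass side of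
  the estimate, while the energies are added over disjoint open cells.\<close>

lemma eigenvalue_count_le:
  assumes "finite J" and pq: "\<And>j. j \<in> J \<Longrightarrow> 0 \<le> p j \<and> p j \<le> q j \<and> q j \<le> 1"
    and disj: "disjoint_family_on (\<lambda>j. {p j<..<q j}) J"
    and cover: "prob (\<Union>j\<in>J. {p j..q j}) = 1"
    and small: "\<And>j. j \<in> J \<Longrightarrow> L * ((q j - p j) * prob {p j..q j}) \<le> 1"
    and "L > 0"
  shows "finite {l. neumann_eigenvalue \<mu> l \<and> l < L} \<and> card {l. neumann_eigenvalue \<mu> l \<and> l < L} \<le> card J"
proof (rule finite_if_finite_subsets_card_bdd)
  \<comment> \<open>Bounding all finite sets of eigenvalues yields finiteness of the whole set at
    the same time.\<close>
  fix G assume G: "G \<subseteq> {l. neumann_eigenvalue \<mu> l \<and> l < L}" "finite G"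
  have "\<forall>l\<in>G. \<exists>yg. eigenpair l (fst yg) (snd yg) \<and> (\<exists>x\<in>{0..1}. fst yg x \<noteq> 0)"
    using G(1) by (auto simp: neumann_eigenvalue_iff)
  then obtain Z where Z: "\<And>l. l \<in> G \<Longrightarrow> eigenpair l (fst (Z l)) (snd (Z l))"
    "\<And>l. l \<in> G \<Longrightarrow> \<exists>x\<in>{0..1}. fst (Z l) x \<noteq> 0" by metis
  define Y where "Y l = fst (Z l)" for l
  define Y' where "Y' l = snd (Z l)" for l
  have e: "eigenpair l (Y l) (Y' l)" if "l \<in> G" for l using Z(1)[OF that] by (simp add: Y_def Y'_def)
  have pos: "(\<integral>x. (Y l x)\<^sup>2 \<partial>\<mu>) > 0" if "l \<in> G" for l
    using eigenpair_norm_pos[OF e[OF that]] Z(2)[OF that] by (simp add: Y_def)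
  show "card G \<le> card J"
  proof (rule ccontr)
    assume "\<not> card G \<le> card J"
    then obtain c where c: "\<exists>l\<in>G. c l \<noteq> 0" "\<And>j. j \<in> J \<Longrightarrow> (\<Sum>l\<in>G. c l * Y l (p j)) = 0"
      using homogeneous_system_nontrivial[OF assms(1) G(2), of "\<lambda>j l. Y l (p j)"] by auto
    define y where "y x = (\<Sum>l\<in>G. c l * Y l x)" for x
    define g where "g x = (\<Sum>l\<in>G. c l * Y' l x)" for x
    have y: "antideriv y g"
      unfolding y_def[abs_def] g_def[abs_def]
      by (rule antideriv_sum[OF G(2)]) (rule eigenpair_antideriv[OF e])
    have g: "L2_unit g" by (rule antideriv_L2[OF y])
    have cont: "continuous_on {0..1} y" by (rule antideriv_continuous[OF y])
    have ny: "(\<integral>x. (y x)\<^sup>2 \<partial>\<mu>) = (\<Sum>l\<in>G. (c l)\<^sup>2 * (\<integral>x. (Y l x)\<^sup>2 \<partial>\<mu>))"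
      unfolding y_def using eigenpair_continuous[OF e] eigenpair_orthogonal(1)[OF e e]
      by (intro integral_square_sum_orthogonal[OF G(2)] integrable_continuous continuous_on_mult) auto
    have ng: "(\<integral>x. (g x)\<^sup>2 \<partial>lborel) = (\<Sum>l\<in>G. (c l)\<^sup>2 * (\<integral>x. (Y' l x)\<^sup>2 \<partial>lborel))"
      unfolding g_def using antideriv_L2[OF eigenpair_antideriv[OF e]] eigenpair_orthogonal(2)[OF e e]
      by (intro integral_square_sum_orthogonal[OF G(2)] L2_unit_mult_integrable) auto
    \<comment> \<open>Strictness comes from one eigenvalue below \<open>L\<close> that has a nonzero
      coefficient and an eigenfunction of positive norm.\<close>
    have "(\<integral>x. (g x)\<^sup>2 \<partial>lborel) < (\<Sum>l\<in>G. (c l)\<^sup>2 * (L * (\<integral>x. (Y l x)\<^sup>2 \<partial>\<mu>)))"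
      unfolding ng
    proof (rule sum_strict_mono_ex1[OF G(2)])
      show "\<forall>l\<in>G. (c l)\<^sup>2 * (\<integral>x. (Y' l x)\<^sup>2 \<partial>lborel) \<le> (c l)\<^sup>2 * (L * (\<integral>x. (Y l x)\<^sup>2 \<partial>\<mu>))"
        using G(1) pos eigenpair_energy[OF e] by (auto intro!: mult_left_mono)
      from c(1) obtain l where l: "l \<in> G" "c l \<noteq> 0" by blast
      then have "l < L" using G(1) by auto
      with pos[OF l(1)] have "l * (\<integral>x. (Y l x)\<^sup>2 \<partial>\<mu>) < L * (\<integral>x. (Y l x)\<^sup>2 \<partial>\<mu>)"
        by (intro mult_strict_right_mono)
      with l show "\<exists>l\<in>G. (c l)\<^sup>2 * (\<integral>x. (Y' l x)\<^sup>2 \<partial>lborel) < (c l)\<^sup>2 * (L * (\<integral>x. (Y l x)\<^sup>2 \<partial>\<mu>))"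
        using eigenpair_energy[OF e[OF l(1)]] by (intro bexI[of _ l]) auto
    qed
    also have "\<dots> = L * (\<integral>x. (y x)\<^sup>2 \<partial>\<mu>)"
      unfolding ny sum_distrib_left by (intro sum.cong) auto
    finally have less: "(\<integral>x. (g x)\<^sup>2 \<partial>lborel) < L * (\<integral>x. (y x)\<^sup>2 \<partial>\<mu>)" .

    define E where "E j = (\<integral>t. (g t)\<^sup>2 * indicator {p j<..<q j} t \<partial>lborel)" for j
    have y2: "integrable \<mu> (\<lambda>x. (y x)\<^sup>2)" by (intro integrable_continuous continuous_intros cont)
    have y2i: "integrable \<mu> (\<lambda>x. (y x)\<^sup>2 * indicator {p j..q j} x)" if "j \<in> J" for j
      using pq[OF that] by (intro integrable_real_mult_indicator y2 atLeastAtMost_sets) auto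
    have g2i: "integrable lborel (\<lambda>t. (g t)\<^sup>2 * indicator {p j<..<q j} t)" for j
      using g by (intro integrable_real_mult_indicator) (auto simp: L2_unit_def)
    have cell: "L * (\<integral>x. (y x)\<^sup>2 * indicator {p j..q j} x \<partial>\<mu>) \<le> E j" if j: "j \<in> J" for j
    proof -
      have m: "{p j..q j} \<in> sets \<mu>" using pq[OF j] by (intro atLeastAtMost_sets) auto
      have E: "E j \<ge> 0" unfolding E_def by (intro Bochner_Integration.integral_nonneg) auto
      \<comment> \<open>The zero at the left end turns the bound for increments into a bound for
        \<open>y\<close> itself.\<close>
      have "y (p j) = 0" using c(2)[OF j] by (simp add: y_def)
      then have "(y x)\<^sup>2 \<le> (q j - p j) * E j" if "x \<in> {p j..q j}" for x
        using antideriv_diff_square[OF y, of "p j" "q j" x] pq[OF j] that by (auto simp: E_def)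
      moreover have "integrable \<mu> (\<lambda>x. (q j - p j) * E j * indicator {p j..q j} x)"
        using m by (intro integrable_real_mult_indicator integrable_const)
      ultimately have "(\<integral>x. (y x)\<^sup>2 * indicator {p j..q j} x \<partial>\<mu>) \<le>
          (\<integral>x. (q j - p j) * E j * indicator {p j..q j} x \<partial>\<mu>)"
        by (intro integral_mono y2i[OF j]) (auto simp: indicator_def)
      also have "\<dots> = (q j - p j) * E j * prob {p j..q j}"
        using m by simp
      finally have "L * (\<integral>x. (y x)\<^sup>2 * indicator {p j..q j} x \<partial>\<mu>) \<le>
          (L * ((q j - p j) * prob {p j..q j})) * E j"
        using \<open>L > 0\<close> by (simp add: mult_ac)
      also have "\<dots> \<le> 1 * E j" using small[OF j] E by (intro mult_right_mono)
      finally show ?thesis by simp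
    qed
    have ev: "(\<Union>j\<in>J. {p j..q j}) \<in> sets \<mu>"
      using pq by (intro sets.finite_UN assms(1) atLeastAtMost_sets) auto
    have "AE x in \<mu>. x \<in> (\<Union>j\<in>J. {p j..q j})" using AE_prob_1[OF cover] .
    then have "AE x in \<mu>. (y x)\<^sup>2 \<le> (\<Sum>j\<in>J. (y x)\<^sup>2 * indicator {p j..q j} x)"
    proof (rule AE_mp, intro AE_I2 impI)
      fix x assume "x \<in> (\<Union>j\<in>J. {p j..q j})"
      then obtain j where j: "j \<in> J" "x \<in> {p j..q j}" by blast
      have "(y x)\<^sup>2 * indicator {p j..q j} x \<le> (\<Sum>j\<in>J. (y x)\<^sup>2 * indicator {p j..q j} x)"
        using j assms(1) by (intro member_le_sum) auto
      then show "(y x)\<^sup>2 \<le> (\<Sum>j\<in>J. (y x)\<^sup>2 * indicator {p j..q j} x)" using j by simp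
    qed
    then have "(\<integral>x. (y x)\<^sup>2 \<partial>\<mu>) \<le> (\<integral>x. (\<Sum>j\<in>J. (y x)\<^sup>2 * indicator {p j..q j} x) \<partial>\<mu>)"
      by (intro integral_mono_AE y2 Bochner_Integration.integrable_sum y2i)
    also have "\<dots> = (\<Sum>j\<in>J. \<integral>x. (y x)\<^sup>2 * indicator {p j..q j} x \<partial>\<mu>)"
      by (rule Bochner_Integration.integral_sum) (rule y2i)
    finally have "L * (\<integral>x. (y x)\<^sup>2 \<partial>\<mu>) \<le> (\<Sum>j\<in>J. L * (\<integral>x. (y x)\<^sup>2 * indicator {p j..q j} x \<partial>\<mu>))"
      using \<open>L > 0\<close> by (simp flip: sum_distrib_left)
    also have "\<dots> \<le> (\<Sum>j\<in>J. E j)" by (rule sum_mono) (rule cell)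
    also have "\<dots> = (\<integral>t. (\<Sum>j\<in>J. (g t)\<^sup>2 * indicator {p j<..<q j} t) \<partial>lborel)"
      unfolding E_def by (rule Bochner_Integration.integral_sum[symmetric]) (rule g2i)
    also have "\<dots> \<le> (\<integral>t. (g t)\<^sup>2 \<partial>lborel)"
    proof (rule integral_mono)
      show "integrable lborel (\<lambda>t. \<Sum>j\<in>J. (g t)\<^sup>2 * indicator {p j<..<q j} t)"
        using g2i by (rule Bochner_Integration.integrable_sum)
      show "integrable lborel (\<lambda>t. (g t)\<^sup>2)" using g by (simp add: L2_unit_def)
      fix t
      have "(\<Sum>j\<in>J. (g t)\<^sup>2 * indicator {p j<..<q j} t) = (g t)\<^sup>2 * indicator (\<Union>j\<in>J. {p j<..<q j}) t"
        by (simp add: indicator_UN_disjoint[OF assms(1) disj] sum_distrib_left)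
      also have "\<dots> \<le> (g t)\<^sup>2" by (simp add: indicator_def)
      finally show "(\<Sum>j\<in>J. (g t)\<^sup>2 * indicator {p j<..<q j} t) \<le> (g t)\<^sup>2" .
    qed
    finally show False using less by simp
  qed
qed

end

section \<open>Simplicity of eigenvalues and the inverse operator\<close>

context unit_interval_measure
begin

text \<open>The weak equation is tested with the function whose derivative is the indicator of
  \<open>[0, x)\<close>; integration by parts makes it a Volterra integral equation with initial
  value \<open>w 0\<close>.\<close>

lemma eigenpair_volterra:
  assumes w: "eigenpair l w h" and x: "x \<in> {0..1}"
  shows "w x = w 0 - l * (\<integral>t. cumul w t * indicator {..<x} t \<partial>lborel)"
proof -
  have aw: "antideriv w h" by (rule eigenpair_antideriv[OF w])
  have cw: "continuous_on {0..1} w" by (rule antideriv_continuous[OF aw])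
  \<comment> \<open>Testing with the constant 1; this removes the boundary term below, also for
    \<open>l = 0\<close>.\<close>
  have zero: "l * (\<integral>x. w x \<partial>\<mu>) = 0"
    using eigenpairD[OF w antideriv_const[of 1]] by simp
  have "L2_unit (\<lambda>t. indicator {0..1} t * indicator {..<x} t)"
    by (intro L2_unit_mult_indicator L2_unit_indicator) auto
  note \<eta> = antideriv_integral[OF this, of 0]
  let ?\<eta> = "\<lambda>x'. 0 + (\<integral>t. indicator {0..1} t * indicator {..<x} t * indicator {..<x'} t \<partial>lborel) :: real"
  have "(\<integral>t. h t * (indicator {0..1} t * indicator {..<x} t) \<partial>lborel) = l * (\<integral>x. w x * ?\<eta> x \<partial>\<mu>)"
    by (rule eigenpairD[OF w \<eta>])
  also have "(\<integral>x. w x * ?\<eta> x \<partial>\<mu>) = ?\<eta> 1 * (\<integral>x. w x \<partial>\<mu>) -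
      (\<integral>s. indicator {0..1} s * indicator {..<x} s * cumul w s \<partial>lborel)"
    by (rule integral_by_parts[OF cw \<eta>])
  finally have main: "(\<integral>t. h t * (indicator {0..1} t * indicator {..<x} t) \<partial>lborel) =
      ?\<eta> 1 * (l * (\<integral>x. w x \<partial>\<mu>)) - l * (\<integral>s. indicator {0..1} s * indicator {..<x} s * cumul w s \<partial>lborel)"
    by (simp only: right_diff_distrib mult.left_commute)
  have r1: "(\<lambda>t. h t * (indicator {0..1} t * indicator {..<x} t)) = (\<lambda>t. h t * indicator {..<x} t)"
    using L2_unit_outside[OF antideriv_L2[OF aw]] by (auto simp: indicator_def fun_eq_iff)
  have "cumul w s = 0" if "s \<le> 0" for s
  proof -
    have "cumul w s = (\<integral>x. 0 \<partial>\<mu>)"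
      unfolding cumul_def using that by (intro integral_cong_unit) (auto simp: indicator_def)
    then show ?thesis by simp
  qed
  then have r2: "(\<lambda>s. indicator {0..1} s * indicator {..<x} s * cumul w s) = (\<lambda>s. cumul w s * indicator {..<x} s)"
    using x by (auto simp: indicator_def fun_eq_iff)
  show ?thesis
    using main antideriv_eq[OF aw x] unfolding r1 r2 zero by linarith
qed

text \<open>Iteration of the Volterra equation: every round gains a factor \<open>K * x\<close> and
  a further factor of the factorial, so the bounds are terms of an exponential series and tend to
  zero.\<close>

lemma eigenpair_zero:
  assumes w: "eigenpair l w h" and w0: "w 0 = 0" and x: "x \<in> {0..1}"
  shows "w x = 0"
proof -
  have cw: "continuous_on {0..1} w" by (rule eigenpair_continuous[OF w])
  have "bounded (w ` {0..1})"
    using cw by (intro compact_imp_bounded compact_continuous_image) auto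
  then obtain M where M: "\<forall>x\<in>{0..1}. \<bar>w x\<bar> \<le> M" by (auto simp: bounded_iff)
  have M0: "0 \<le> M" using M abs_ge_zero order_trans by (metis atLeastAtMost_iff order_refl zero_le_one)
  define K where "K = \<bar>l\<bar>"
  have bound: "\<bar>w x\<bar> \<le> M * (K * x) ^ n / fact n" if "x \<in> {0..1}" for n x
    using that
  proof (induction n arbitrary: x)
    case 0
    then show ?case using M by simp
  next
    case (Suc n)
    \<comment> \<open>Integration against the probability measure \<open>\<mu>\<close> merely
      preserves the bound, which increases with the argument; the gain comes from the Lebesgue
      integral around it.\<close>
    have cb: "\<bar>cumul w s\<bar> \<le> M * (K * s) ^ n / fact n" if s: "s \<in> {0..1}" for s
      unfolding cumul_def
    proof (rule abs_integral_le)
      show "(\<lambda>x. w x * indicator {..<s} x) \<in> borel_measurable \<mu>"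
        using integrable_mult_lessThan[OF cw] by (rule borel_measurable_integrable)
      fix x :: real assume x: "x \<in> {0..1}"
      show "\<bar>w x * indicator {..<s} x\<bar> \<le> M * (K * s) ^ n / fact n"
      proof (cases "x < s")
        case True
        have "\<bar>w x\<bar> \<le> M * (K * x) ^ n / fact n" using Suc.IH[OF x] .
        also have "\<dots> \<le> M * (K * s) ^ n / fact n"
          using True x M0 by (intro divide_right_mono mult_left_mono power_mono) (auto simp: K_def)
        finally show ?thesis using True by simp
      next
        case False
        then show ?thesis using M0 s by (simp add: K_def)
      qed
    qed
    have c0: "cumul w s = 0" if "s < 0" for s
    proof -
      have "cumul w s = (\<integral>x. 0 \<partial>\<mu>)"
        unfolding cumul_def using that by (intro integral_cong_unit) (auto simp: indicator_def)
      then show ?thesis by simp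
    qed
    have hp: "has_bochner_integral lborel (\<lambda>s. s ^ n * indicator {0..x} s) (x ^ Suc n / Suc n)"
    proof -
      have d: "((\<lambda>s. s ^ Suc n / Suc n) has_real_derivative s ^ n) (at s)" for s :: real
        by (intro derivative_eq_intros) auto
      have "has_bochner_integral lborel (\<lambda>s. s ^ n * indicator {0..x} s)
          (x ^ Suc n / Suc n - 0 ^ Suc n / Suc n)"
        using Suc.prems by (intro has_bochner_integral_FTC_Icc_real d) auto
      then show ?thesis by simp
    qed
    have "\<bar>w x\<bar> = K * \<bar>\<integral>t. cumul w t * indicator {..<x} t \<partial>lborel\<bar>"
      using eigenpair_volterra[OF w Suc.prems] w0 by (simp add: K_def abs_mult)
    also have "\<bar>\<integral>t. cumul w t * indicator {..<x} t \<partial>lborel\<bar> \<le> (\<integral>t. \<bar>cumul w t * indicator {..<x} t\<bar> \<partial>lborel)"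
      by simp
    also have "\<dots> \<le> (\<integral>t. M * K ^ n / fact n * (t ^ n * indicator {0..x} t) \<partial>lborel)"
    proof (rule integral_mono')
      show "integrable lborel (\<lambda>t. M * K ^ n / fact n * (t ^ n * indicator {0..x} t))"
        using hp by (intro integrable_mult_right) (simp add: has_bochner_integral_iff)
      fix t
      show "\<bar>cumul w t * indicator {..<x} t\<bar> \<le> M * K ^ n / fact n * (t ^ n * indicator {0..x} t)"
        using cb[of t] c0[of t] Suc.prems by (auto simp: indicator_def power_mult_distrib)
      show "0 \<le> M * K ^ n / fact n * (t ^ n * indicator {0..x} t)"
        using M0 by (auto simp: K_def indicator_def)
    qed
    also have "\<dots> = M * K ^ n / fact n * (x ^ Suc n / Suc n)"
      using hp by (simp add: has_bochner_integral_iff)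
    finally have "\<bar>w x\<bar> \<le> K * (M * K ^ n / fact n * (x ^ Suc n / Suc n))"
      by (simp add: K_def mult_left_mono)
    also have "\<dots> = M * (K * x) ^ Suc n / fact (Suc n)"
      by (simp add: power_mult_distrib field_simps)
    finally show ?case .
  qed
  have "(\<lambda>n. M * (inverse (fact n) * (K * x) ^ n)) \<longlonglongrightarrow> M * 0"
    by (intro tendsto_mult tendsto_const summable_LIMSEQ_zero summable_exp)
  then have "\<bar>w x\<bar> \<le> M * 0"
    by (rule LIMSEQ_le_const) (use bound[OF x] in \<open>auto simp: divide_inverse mult_ac\<close>)
  then show ?thesis by simp
qed

lemma eigenpair_combination:
  assumes "eigenpair l y g" "eigenpair l z h"
  shows "eigenpair l (\<lambda>x. a * y x + b * z x) (\<lambda>x. a * g x + b * h x)"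
  unfolding eigenpair_def
proof (intro conjI allI impI)
  have y: "antideriv y g" and z: "antideriv z h"
    using assms by (auto intro: eigenpair_antideriv)
  from antideriv_sum[of UNIV "\<lambda>i. if i then y else z" "\<lambda>i. if i then g else h" "\<lambda>i. if i then a else b"] y z
  show "antideriv (\<lambda>x. a * y x + b * z x) (\<lambda>x. a * g x + b * h x)"
    by (simp add: UNIV_bool add.commute)
  fix \<eta> \<eta>' assume \<eta>: "antideriv \<eta> \<eta>'"
  have "integrable lborel (\<lambda>t. g t * \<eta>' t)" "integrable lborel (\<lambda>t. h t * \<eta>' t)"
    using y z \<eta> by (auto intro: L2_unit_mult_integrable antideriv_L2)
  moreover have "integrable \<mu> (\<lambda>x. y x * \<eta> x)" "integrable \<mu> (\<lambda>x. z x * \<eta> x)"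
    using y z \<eta> by (auto intro!: integrable_continuous continuous_on_mult intro: antideriv_continuous)
  ultimately show "(\<integral>t. (a * g t + b * h t) * \<eta>' t \<partial>lborel) = l * (\<integral>x. (a * y x + b * z x) * \<eta> x \<partial>\<mu>)"
    using eigenpairD[OF assms(1) \<eta>] eigenpairD[OF assms(2) \<eta>]
    by (simp add: distrib_right mult.assoc algebra_simps)
qed

text \<open>The combination \<open>z 0 * y - y 0 * z\<close> vanishes at 0, hence everywhere. So the
  two eigenfunctions are proportional, and orthogonality would make the norm of one of them
  zero.\<close>

lemma eigenvalue_simple:
  assumes y: "eigenpair l y g" "\<exists>x\<in>{0..1}. y x \<noteq> 0" and z: "eigenpair l z h" "\<exists>x\<in>{0..1}. z x \<noteq> 0"
  shows "(\<integral>x. y x * z x \<partial>\<mu>) \<noteq> 0"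
proof
  assume orth: "(\<integral>x. y x * z x \<partial>\<mu>) = 0"
  have "y 0 \<noteq> 0" "z 0 \<noteq> 0"
    using eigenpair_zero[OF y(1)] eigenpair_zero[OF z(1)] y(2) z(2) by auto
  have "z 0 * y x + - y 0 * z x = 0" if "x \<in> {0..1}" for x
    using eigenpair_zero[OF eigenpair_combination[OF y(1) z(1), of "z 0" "- y 0"] _ that] by simp
  then have *: "y 0 * z x = z 0 * y x" if "x \<in> {0..1}" for x
    using that by (simp add: algebra_simps)
  have "0 = y 0 * (\<integral>x. y x * z x \<partial>\<mu>)" using orth by simp
  also have "\<dots> = (\<integral>x. y 0 * (y x * z x) \<partial>\<mu>)" by simp
  also have "\<dots> = (\<integral>x. z 0 * (y x)\<^sup>2 \<partial>\<mu>)"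
  proof (rule integral_cong_unit)
    fix x :: real assume "x \<in> {0..1}"
    from *[OF this] show "y 0 * (y x * z x) = z 0 * (y x)\<^sup>2"
      by (simp add: power2_eq_square algebra_simps)
  qed
  also have "\<dots> = z 0 * (\<integral>x. (y x)\<^sup>2 \<partial>\<mu>)" by simp
  finally show False using \<open>z 0 \<noteq> 0\<close> eigenpair_norm_pos[OF y] by simp
qed

text \<open>Inverse of the Neumann operator on functions of mean zero: the derivative is
  \<open>- cumul f\<close>, and the first term fixes the free constant so that the solution again
  has \<open>\<mu>\<close>-mean zero.\<close>

definition solve :: "(real \<Rightarrow> real) \<Rightarrow> real \<Rightarrow> real" where
  "solve f x = (\<integral>z. (\<integral>t. cumul f t * indicator {..<z} t \<partial>lborel) \<partial>\<mu>) -
     (\<integral>t. cumul f t * indicator {..<x} t \<partial>lborel)"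

lemma solve_antideriv:
  assumes "continuous_on {0..1} f" "(\<integral>x. f x \<partial>\<mu>) = 0"
  shows "antideriv (solve f) (\<lambda>t. - cumul f t)"
proof -
  have "L2_unit (\<lambda>t. - 1 * cumul f t)" by (intro L2_unit_cmult cumul_L2 assms)
  from antideriv_integral[OF this, of "\<integral>z. (\<integral>t. cumul f t * indicator {..<z} t \<partial>lborel) \<partial>\<mu>"]
  show ?thesis by (simp add: solve_def[abs_def])
qed

lemma solve_continuous:
  assumes "continuous_on {0..1} f" "(\<integral>x. f x \<partial>\<mu>) = 0"
  shows "continuous_on {0..1} (solve f)"
  by (rule antideriv_continuous[OF solve_antideriv[OF assms]])

lemma solve_mean_zero:
  assumes "continuous_on {0..1} f" "(\<integral>x. f x \<partial>\<mu>) = 0"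
  shows "(\<integral>x. solve f x \<partial>\<mu>) = 0"
proof -
  define a where "a = (\<integral>z. (\<integral>t. cumul f t * indicator {..<z} t \<partial>lborel) \<partial>\<mu>)"
  have eq: "(\<lambda>x. \<integral>t. cumul f t * indicator {..<x} t \<partial>lborel) = (\<lambda>x. a - solve f x)"
    by (auto simp: solve_def a_def)
  have "a = (\<integral>x. a - solve f x \<partial>\<mu>)" unfolding eq[symmetric] by (simp add: a_def)
  also have "\<dots> = a - (\<integral>x. solve f x \<partial>\<mu>)"
    using integrable_continuous[OF solve_continuous[OF assms]] by (simp add: prob_space)
  finally show ?thesis by simp
qed

text \<open>Makes \<open>solve\<close> visibly symmetric and positive: its quadratic form is the
  squared L2 norm of \<open>cumul f\<close>.\<close>

lemma integral_mult_solve: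
  assumes f: "continuous_on {0..1} f" "(\<integral>x. f x \<partial>\<mu>) = 0"
    and h: "continuous_on {0..1} h" "(\<integral>x. h x \<partial>\<mu>) = 0"
  shows "(\<integral>x. h x * solve f x \<partial>\<mu>) = (\<integral>s. cumul f s * cumul h s \<partial>lborel)"
  using integral_by_parts[OF h(1) solve_antideriv[OF f]] h(2) by simp

lemma solve_linear:
  assumes f: "continuous_on {0..1} f" "(\<integral>x. f x \<partial>\<mu>) = 0"
    and h: "continuous_on {0..1} h" "(\<integral>x. h x \<partial>\<mu>) = 0"
    and x: "x \<in> {0..1}"
  shows "solve (\<lambda>x. a * f x + b * h x) x = a * solve f x + b * solve h x"
proof -
  define P where "P f x = (\<integral>t. cumul f t * indicator {..<x} t \<partial>lborel)" for f x
  have i: "integrable lborel (\<lambda>t. cumul f t * indicator {..<x} t)"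
    "integrable lborel (\<lambda>t. cumul h t * indicator {..<x} t)" for x
    using f h by (auto intro!: L2_unit_integrable L2_unit_mult_indicator cumul_L2)
  have P: "P (\<lambda>x. a * f x + b * h x) x = a * P f x + b * P h x" for x
    unfolding P_def cumul_linear[OF f(1) h(1)] using i by (simp add: distrib_right mult.assoc)
  have "continuous_on {0..1} (P f)" "continuous_on {0..1} (P h)"
    using f h unfolding P_def by (auto intro!: antideriv_continuous[OF antideriv_integral[of _ 0, simplified]] cumul_L2)
  then have "integrable \<mu> (P f)" "integrable \<mu> (P h)" by (auto intro: integrable_continuous)
  then show ?thesis
    unfolding solve_def P_def[symmetric] P by (simp add: algebra_simps)
qed

text \<open>The slope \<open>- cumul f\<close> is bounded by the \<open>\<mu>\<close>-norm of
  \<open>f\<close>. This is the equicontinuity behind the compactness of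
  \<open>solve\<close>.\<close>

lemma solve_lipschitz:
  assumes f: "continuous_on {0..1} f" "(\<integral>x. f x \<partial>\<mu>) = 0" and x: "x \<in> {0..1}" "z \<in> {0..1}"
  shows "\<bar>solve f x - solve f z\<bar> \<le> sqrt (\<integral>x. (f x)\<^sup>2 \<partial>\<mu>) * \<bar>x - z\<bar>"
proof -
  define N where "N = sqrt (\<integral>x. (f x)\<^sup>2 \<partial>\<mu>)"
  have N0: "0 \<le> N" by (simp add: N_def)
  have *: "\<bar>solve f z - solve f x\<bar> \<le> N * (z - x)" if "x \<in> {0..1}" "z \<in> {0..1}" "x \<le> z" for x z
  proof -
    have "solve f z - solve f x = (\<integral>t. - cumul f t * indicator {x..<z} t \<partial>lborel)"
      by (rule antideriv_diff[OF solve_antideriv[OF f] that])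
    also have "\<bar>\<dots>\<bar> \<le> (\<integral>t. \<bar>- cumul f t * indicator {x..<z} t\<bar> \<partial>lborel)" by simp
    also have "\<dots> \<le> (\<integral>t. N * indicator {x..<z} t \<partial>lborel)"
    proof (rule integral_mono')
      show "integrable lborel (\<lambda>t. N * indicator {x..<z} t)"
        using that by (intro integrable_mult_right integrable_real_indicator) auto
    qed (use cumul_bound[OF f(1)] N0 in \<open>auto simp: indicator_def N_def\<close>)
    also have "\<dots> = N * (z - x)" using that by simp
    finally show ?thesis .
  qed
  show ?thesis
    using *[of x z] *[of z x] x by (cases "x \<le> z") (auto simp: N_def abs_minus_commute)
qed

text \<open>A function of mean zero is the average of its differences of values, and these are
  controlled by the Lipschitz constant on an interval of length 1.\<close>

lemma solve_bound:
  assumes f: "continuous_on {0..1} f" "(\<integral>x. f x \<partial>\<mu>) = 0" and x: "x \<in> {0..1}"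
  shows "\<bar>solve f x\<bar> \<le> sqrt (\<integral>x. (f x)\<^sup>2 \<partial>\<mu>)"
proof -
  have c: "continuous_on {0..1} (solve f)" by (rule solve_continuous[OF f])
  have "solve f x = (\<integral>z. solve f x - solve f z \<partial>\<mu>)"
    using integrable_continuous[OF c] solve_mean_zero[OF f] by (simp add: prob_space)
  also have "\<bar>\<dots>\<bar> \<le> sqrt (\<integral>x. (f x)\<^sup>2 \<partial>\<mu>)"
  proof (rule abs_integral_le)
    show "(\<lambda>z. solve f x - solve f z) \<in> borel_measurable \<mu>"
      by (intro measurable_continuous continuous_intros c)
    fix z :: real assume z: "z \<in> {0..1}"
    have "\<bar>solve f x - solve f z\<bar> \<le> sqrt (\<integral>x. (f x)\<^sup>2 \<partial>\<mu>) * \<bar>x - z\<bar>"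
      by (rule solve_lipschitz[OF f x z])
    also have "\<dots> \<le> sqrt (\<integral>x. (f x)\<^sup>2 \<partial>\<mu>) * 1"
      using x z by (intro mult_left_mono) auto
    finally show "\<bar>solve f x - solve f z\<bar> \<le> sqrt (\<integral>x. (f x)\<^sup>2 \<partial>\<mu>)" by simp
  qed
  finally show ?thesis .
qed

end

section \<open>Lower bound for the number of eigenvalues\<close>

context unit_interval_measure
begin

text \<open>The orthogonal complement is taken inside the continuous functions; the maximising
  argument stays there because its limits are uniform.\<close>

definition orth :: "(real \<Rightarrow> real) set \<Rightarrow> (real \<Rightarrow> real) \<Rightarrow> bool" where
  "orth E f \<longleftrightarrow> continuous_on {0..1} f \<and> (\<forall>e\<in>E. (\<integral>x. f x * e x \<partial>\<mu>) = 0)"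

abbreviation norm2 :: "(real \<Rightarrow> real) \<Rightarrow> real" where
  "norm2 f \<equiv> (\<integral>x. (f x)\<^sup>2 \<partial>\<mu>)"

text \<open>The form \<open>\<integral> f * solve f\<close>, by \<open>integral_mult_solve\<close>;
  it is the Dirichlet energy of \<open>solve f\<close> and not that of \<open>f\<close>.\<close>

abbreviation energy :: "(real \<Rightarrow> real) \<Rightarrow> real" where
  "energy f \<equiv> (\<integral>s. (cumul f s)\<^sup>2 \<partial>lborel)"

lemma energy_le_norm2:
  assumes "continuous_on {0..1} f" "(\<integral>x. f x \<partial>\<mu>) = 0"
  shows "energy f \<le> norm2 f"
proof -
  have "energy f \<le> (\<integral>s. norm2 f * indicator {0..1::real} s \<partial>lborel)"
  proof (rule integral_mono')
    fix s
    show "(cumul f s)\<^sup>2 \<le> norm2 f * indicator {0..1} s"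
    proof (cases "s \<in> {0..1}")
      case True
      have "\<bar>cumul f s\<bar>\<^sup>2 \<le> (sqrt (norm2 f))\<^sup>2"
        using cumul_bound[OF assms(1)] by (intro power_mono) auto
      then show ?thesis using True by simp
    qed (simp add: cumul_outside[OF assms(2)])
  qed auto
  then show ?thesis by simp
qed

text \<open>The supremum \<open>\<kappa>\<close> of \<open>energy\<close> over the unit sphere of
  the complement is attained. A maximising sequence is bounded only in the
  \<open>\<mu>\<close>-norm, but its images under \<open>solve\<close> have a uniform limit
  \<open>h\<close>, and that limit is close to \<open>\<kappa>\<close> times the sequence.\<close>

lemma compact_eigenvector:
  assumes one: "(\<lambda>_. 1) \<in> E"
    and contE: "\<And>e. e \<in> E \<Longrightarrow> continuous_on {0..1} e"
    and inv: "\<And>f. orth E f \<Longrightarrow> orth E (solve f)"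
    and u: "orth E u" "energy u > 0"
  shows "\<exists>h \<kappa>. orth E h \<and> norm2 h > 0 \<and> energy u \<le> \<kappa> * norm2 u \<and> \<kappa> > 0 \<and>
    (\<forall>x\<in>{0..1}. solve h x = \<kappa> * h x)"
proof -
  have cont: "continuous_on {0..1} f" if "orth E f" for f using that by (simp add: orth_def)
  have mean: "(\<integral>x. f x \<partial>\<mu>) = 0" if "orth E f" for f
    using that one by (force simp: orth_def)
  have scale: "orth E (\<lambda>x. c * f x)" if "orth E f" for c f
    using that by (auto simp: orth_def mult.assoc intro!: continuous_intros)
  define Q where "Q = energy ` {f. orth E f \<and> norm2 f = 1}"
  define \<kappa> where "\<kappa> = Sup Q"
  have bdd: "bdd_above Q"
    unfolding Q_def using energy_le_norm2[OF cont mean] by (intro bdd_aboveI2[of _ _ 1]) force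
  have n2: "norm2 (\<lambda>x. c * f x) = c\<^sup>2 * norm2 f" for c f by (simp add: power_mult_distrib)
  have e2: "energy (\<lambda>x. c * f x) = c\<^sup>2 * energy f" if "orth E f" for c f
    using cumul_linear[OF cont[OF that] cont[OF that], of c 0] by (simp add: power_mult_distrib)
  have normalise: "energy f / norm2 f \<in> Q" if f: "orth E f" "norm2 f > 0" for f
  proof -
    define c where "c = 1 / sqrt (norm2 f)"
    have c2: "c\<^sup>2 = 1 / norm2 f" using f(2) by (simp add: c_def power_divide)
    have "energy (\<lambda>x. c * f x) \<in> Q"
      unfolding Q_def using scale[OF f(1)] n2[of c f] c2 f(2) by (intro imageI) auto
    then show ?thesis unfolding e2[OF f(1)] c2 by simp
  qed
  have le: "energy f \<le> \<kappa> * norm2 f" if f: "orth E f" for f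
  proof (cases "norm2 f > 0")
    case True
    have "energy f / norm2 f \<le> \<kappa>"
      unfolding \<kappa>_def using normalise[OF f True] bdd by (rule cSup_upper)
    then show ?thesis using True by (simp add: field_simps)
  next
    case False
    moreover have "norm2 f \<ge> 0" by simp
    ultimately have "norm2 f = 0" by linarith
    then show ?thesis using energy_le_norm2[OF cont[OF f] mean[OF f]] by simp
  qed
  have u0: "norm2 u > 0" using energy_le_norm2[OF cont[OF u(1)] mean[OF u(1)]] u(2) by simp
  have "0 < \<kappa> * norm2 u" using le[OF u(1)] u(2) by linarith
  then have \<kappa>: "\<kappa> > 0" using u0 by (simp add: zero_less_mult_iff)
  have "\<exists>f. orth E f \<and> norm2 f = 1 \<and> energy f > \<kappa> - 1 / Suc n" for n :: nat
  proof -
    have "\<kappa> - 1 / Suc n < Sup Q" by (simp add: \<kappa>_def)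
    moreover have "Q \<noteq> {}" using normalise[OF u(1) u0] by auto
    ultimately obtain z where "z \<in> Q" "\<kappa> - 1 / Suc n < z" using less_cSup_iff[OF _ bdd] by blast
    then show ?thesis unfolding Q_def by blast
  qed
  then obtain f where f: "\<And>n. orth E (f n)" "\<And>n. norm2 (f n) = 1" "\<And>n. energy (f n) > \<kappa> - 1 / Suc n"
    by metis
  \<comment> \<open>Cauchy-Schwarz for the positive form \<open>(f, g) \<mapsto> \<integral> solve f * g\<close> gives \<open>norm2 (solve f) \<le> \<kappa>\<^sup>2 * norm2 f\<close>,
    so maximising sequences are approximate eigenvectors.\<close>
  have solve_le: "norm2 (solve g) \<le> \<kappa>\<^sup>2 * norm2 g" if g: "orth E g" for g
  proof (cases "norm2 (solve g) > 0")
    case True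
    let ?h = "solve g"
    have h: "orth E ?h" by (rule inv[OF g])
    have "norm2 ?h = (\<integral>x. ?h x * solve g x \<partial>\<mu>)" by (simp add: power2_eq_square)
    also have "\<dots> = (\<integral>s. cumul g s * cumul ?h s \<partial>lborel)"
      by (rule integral_mult_solve[OF cont[OF g] mean[OF g] cont[OF h] mean[OF h]])
    finally have "(norm2 ?h)\<^sup>2 = (\<integral>s. cumul g s * cumul ?h s \<partial>lborel)\<^sup>2" by simp
    also have "\<dots> \<le> energy g * energy ?h"
      using cumul_L2[OF cont[OF g] mean[OF g]] cumul_L2[OF cont[OF h] mean[OF h]]
      by (intro cauchy_schwarz_integral(2)) (auto simp: L2_unit_def)
    also have "\<dots> \<le> (\<kappa> * norm2 g) * (\<kappa> * norm2 ?h)"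
      using le[OF g] le[OF h] \<kappa> by (intro mult_mono) auto
    finally have "norm2 ?h * norm2 ?h \<le> (\<kappa>\<^sup>2 * norm2 g) * norm2 ?h"
      by (simp add: power2_eq_square mult_ac)
    then show ?thesis using True by (rule mult_right_le_imp_le)
  next
    case False
    have "0 \<le> \<kappa>\<^sup>2 * norm2 g" by simp
    then show ?thesis using False by linarith
  qed
  \<comment> \<open>Expanding the square and inserting \<open>solve_le\<close> leaves
    \<open>2 * \<kappa> * (\<kappa> - energy (f n))\<close>, which the choice of \<open>f\<close>
    makes small.\<close>
  have approx: "norm2 (\<lambda>x. solve (f n) x - \<kappa> * f n x) \<le> 2 * \<kappa> / Suc n" for n
  proof -
    have c: "continuous_on {0..1} (f n)" "continuous_on {0..1} (solve (f n))"
      using cont f(1) inv by blast+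
    have i: "integrable \<mu> (\<lambda>x. (solve (f n) x)\<^sup>2)" "integrable \<mu> (\<lambda>x. f n x * solve (f n) x)"
      "integrable \<mu> (\<lambda>x. (f n x)\<^sup>2)"
      by (intro integrable_continuous continuous_intros c)+
    have "(\<lambda>x. (solve (f n) x - \<kappa> * f n x)\<^sup>2) =
        (\<lambda>x. (solve (f n) x)\<^sup>2 - 2 * \<kappa> * (f n x * solve (f n) x) + \<kappa>\<^sup>2 * (f n x)\<^sup>2)"
      by (auto simp: power2_eq_square algebra_simps)
    then have "norm2 (\<lambda>x. solve (f n) x - \<kappa> * f n x) =
        norm2 (solve (f n)) - 2 * \<kappa> * (\<integral>x. f n x * solve (f n) x \<partial>\<mu>) + \<kappa>\<^sup>2 * norm2 (f n)"
      using i by simp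
    also have "(\<integral>x. f n x * solve (f n) x \<partial>\<mu>) = energy (f n)"
      using integral_mult_solve[OF cont mean cont mean, OF f(1) f(1) f(1) f(1)]
      by (simp add: power2_eq_square)
    also have "norm2 (solve (f n)) - 2 * \<kappa> * energy (f n) + \<kappa>\<^sup>2 * norm2 (f n) \<le>
        2 * \<kappa> * (\<kappa> - energy (f n))"
      using solve_le[OF f(1)[of n]] f(2)[of n] by (simp add: power2_eq_square algebra_simps)
    also have "\<dots> \<le> 2 * \<kappa> * (1 / Suc n)"
      using f(3)[of n] \<kappa> by (intro mult_left_mono) auto
    finally show ?thesis by simp
  qed
  \<comment> \<open>Arzela-Ascoli for the images: since every \<open>f n\<close> has norm 1, both
    the uniform bound and the Lipschitz constant are 1.\<close>
  obtain h k where h: "continuous_on {0..1} h" and k: "strict_mono (k :: nat \<Rightarrow> nat)"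
    and conv: "\<And>e. 0 < e \<Longrightarrow> \<exists>N. \<forall>n x. n \<ge> N \<and> x \<in> {0..1} \<longrightarrow> norm (solve (f (k n)) x - h x) < e"
  proof (rule Arzela_Ascoli[of "{0..1::real}" "\<lambda>n. solve (f n)" 1])
    show "norm (solve (f n) x) \<le> 1" if "x \<in> {0..1}" for n x
      using solve_bound[OF cont mean, OF f(1) f(1) that] f(2) by simp
    show "\<exists>d. 0 < d \<and> (\<forall>n y. y \<in> {0..1} \<and> norm (x - y) < d \<longrightarrow> norm (solve (f n) x - solve (f n) y) < e)"
      if "x \<in> {0..1}" "0 < e" for x e
    proof (intro exI[of _ e] conjI allI impI)
      fix n y assume y: "y \<in> {0..1} \<and> norm (x - y) < e"
      then show "norm (solve (f n) x - solve (f n) y) < e"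
        using solve_lipschitz[OF cont mean, OF f(1) f(1) that(1), of y n] f(2)[of n] by auto
    qed (rule that(2))
  qed auto
  define g where "g n = f (k n)" for n
  have g: "orth E (g n)" "norm2 (g n) = 1" for n using f by (auto simp: g_def)
  have approx': "norm2 (\<lambda>x. solve (g n) x - \<kappa> * g n x) \<le> 2 * \<kappa> / Suc n" for n
  proof -
    have "n \<le> k n" using k by (rule seq_suble)
    then have "2 * \<kappa> / Suc (k n) \<le> 2 * \<kappa> / Suc n"
      using \<kappa> by (intro divide_left_mono) auto
    with approx[of "k n"] show ?thesis unfolding g_def by linarith
  qed
  define \<delta> where "\<delta> n = Sup ((\<lambda>x. \<bar>solve (g n) x - h x\<bar>) ` {0..1})" for n
  have \<delta>: "\<bar>solve (g n) x - h x\<bar> \<le> \<delta> n" if "x \<in> {0..1}" for n x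
    unfolding \<delta>_def
  proof (rule cSup_upper)
    have "continuous_on {0..1} (\<lambda>x. \<bar>solve (g n) x - h x\<bar>)"
      by (intro continuous_intros h cont[OF inv[OF g(1)]])
    then show "bdd_above ((\<lambda>x. \<bar>solve (g n) x - h x\<bar>) ` {0..1})"
      by (intro bounded_imp_bdd_above compact_imp_bounded compact_continuous_image) auto
  qed (use that in auto)
  have \<delta>0: "0 \<le> \<delta> n" for n using \<delta>[of 0 n] by (simp add: abs_ge_zero order_trans[OF abs_ge_zero])
  have \<delta>lim: "\<delta> \<longlonglongrightarrow> 0"
  proof (rule LIMSEQ_I)
    fix r :: real assume "0 < r"
    from conv[of "r / 2"] this obtain N where
      N: "\<And>n x. n \<ge> N \<Longrightarrow> x \<in> {0..1} \<Longrightarrow> \<bar>solve (g n) x - h x\<bar> < r / 2"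
      unfolding g_def by auto
    have "\<delta> n \<le> r / 2" if "n \<ge> N" for n
      unfolding \<delta>_def using N[OF that] by (intro cSup_least) (auto intro: less_imp_le)
    then show "\<exists>no. \<forall>n\<ge>no. norm (\<delta> n - 0) < r"
      using \<open>0 < r\<close> \<delta>0 by (intro exI[of _ N]) (smt (verit) field_sum_of_halves real_norm_def)
  qed
  have cg: "continuous_on {0..1} (g n)" "continuous_on {0..1} (solve (g n))" for n
    using cont g(1) inv by blast+
  have orth_h: "orth E h"
    unfolding orth_def
  proof (intro conjI ballI h)
    fix e assume e: "e \<in> E"
    have i: "integrable \<mu> (\<lambda>x. h x * e x)" "integrable \<mu> (\<lambda>x. solve (g n) x * e x)" for n
      by (intro integrable_continuous continuous_intros h cg contE[OF e])+
    have ie: "integrable \<mu> (\<lambda>x. \<bar>e x\<bar>)" using contE[OF e] by (intro integrable_continuous continuous_intros)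
    have "\<bar>\<integral>x. h x * e x \<partial>\<mu>\<bar> \<le> \<delta> n * (\<integral>x. \<bar>e x\<bar> \<partial>\<mu>)" for n
    proof -
      have "(\<integral>x. solve (g n) x * e x \<partial>\<mu>) = 0"
        using inv[OF g(1)[of n]] e by (simp add: orth_def)
      then have "(\<integral>x. h x * e x \<partial>\<mu>) = (\<integral>x. h x * e x - solve (g n) x * e x \<partial>\<mu>)"
        using i by simp
      also have "\<bar>\<dots>\<bar> \<le> (\<integral>x. \<bar>h x * e x - solve (g n) x * e x\<bar> \<partial>\<mu>)" by simp
      also have "\<dots> \<le> (\<integral>x. \<delta> n * \<bar>e x\<bar> \<partial>\<mu>)"
      proof (rule integral_mono)
        fix x assume "x \<in> space \<mu>"
        then have x: "x \<in> {0..1}" by (simp add: space_eq)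
        have "\<bar>h x * e x - solve (g n) x * e x\<bar> = \<bar>solve (g n) x - h x\<bar> * \<bar>e x\<bar>"
          by (simp add: abs_mult[symmetric] left_diff_distrib abs_minus_commute)
        also have "\<dots> \<le> \<delta> n * \<bar>e x\<bar>" using \<delta>[OF x] by (intro mult_right_mono) auto
        finally show "\<bar>h x * e x - solve (g n) x * e x\<bar> \<le> \<delta> n * \<bar>e x\<bar>" .
      qed (use i ie in auto)
      finally show ?thesis by simp
    qed
    moreover have "(\<lambda>n. \<delta> n * (\<integral>x. \<bar>e x\<bar> \<partial>\<mu>)) \<longlonglongrightarrow> 0 * (\<integral>x. \<bar>e x\<bar> \<partial>\<mu>)"
      by (intro tendsto_intros \<delta>lim)
    ultimately have "\<bar>\<integral>x. h x * e x \<partial>\<mu>\<bar> \<le> 0 * (\<integral>x. \<bar>e x\<bar> \<partial>\<mu>)"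
      by (intro LIMSEQ_le_const[of _ _ "\<bar>\<integral>x. h x * e x \<partial>\<mu>\<bar>"]) auto
    then show "(\<integral>x. h x * e x \<partial>\<mu>) = 0" by simp
  qed
  \<comment> \<open>Squared distance of \<open>h\<close> to \<open>\<kappa> * g n\<close> in the
    \<open>\<mu>\<close>-norm; it is estimated by passing through
    \<open>solve (g n)\<close>.\<close>
  define \<epsilon> where "\<epsilon> n = norm2 (\<lambda>x. h x - \<kappa> * g n x)" for n
  have \<epsilon>: "\<epsilon> n \<le> 2 * (\<delta> n)\<^sup>2 + 2 * (2 * \<kappa> / Suc n)" for n
  proof -
    have i: "integrable \<mu> (\<lambda>x. (solve (g n) x - \<kappa> * g n x)\<^sup>2)" "integrable \<mu> (\<lambda>x. (h x - \<kappa> * g n x)\<^sup>2)"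
      by (intro integrable_continuous continuous_intros h cg)+
    have "\<epsilon> n \<le> (\<integral>x. 2 * (\<delta> n)\<^sup>2 + 2 * (solve (g n) x - \<kappa> * g n x)\<^sup>2 \<partial>\<mu>)"
      unfolding \<epsilon>_def
    proof (rule integral_mono)
      fix x assume "x \<in> space \<mu>"
      then have x: "x \<in> {0..1}" by (simp add: space_eq)
      have "(h x - \<kappa> * g n x)\<^sup>2 \<le> 2 * (h x - solve (g n) x)\<^sup>2 + 2 * (solve (g n) x - \<kappa> * g n x)\<^sup>2"
      proof -
        have "(a + b)\<^sup>2 \<le> 2 * a\<^sup>2 + 2 * b\<^sup>2" for a b :: real
          using zero_le_power2[of "a - b"] by (simp add: power2_eq_square algebra_simps)
        from this[of "h x - solve (g n) x" "solve (g n) x - \<kappa> * g n x"] show ?thesis by simp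
      qed
      moreover have "\<bar>h x - solve (g n) x\<bar>\<^sup>2 \<le> (\<delta> n)\<^sup>2"
        using \<delta>[OF x, of n] by (intro power_mono) (auto simp: abs_minus_commute)
      ultimately show "(h x - \<kappa> * g n x)\<^sup>2 \<le> 2 * (\<delta> n)\<^sup>2 + 2 * (solve (g n) x - \<kappa> * g n x)\<^sup>2"
        by simp
    qed (use i in auto)
    also have "\<dots> = 2 * (\<delta> n)\<^sup>2 + 2 * norm2 (\<lambda>x. solve (g n) x - \<kappa> * g n x)"
      using i by (simp add: prob_space)
    finally show ?thesis using approx'[of n] by linarith
  qed
  have \<epsilon>lim: "\<epsilon> \<longlonglongrightarrow> 0"
  proof (rule tendsto_sandwich[OF _ _ tendsto_const])
    have "(\<lambda>n. 2 * (\<delta> n)\<^sup>2 + 2 * (2 * \<kappa> / Suc n)) \<longlonglongrightarrow> 2 * 0\<^sup>2 + 2 * 0"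
      by (intro tendsto_intros \<delta>lim LIMSEQ_Suc lim_const_over_n)
    then show "(\<lambda>n. 2 * (\<delta> n)\<^sup>2 + 2 * (2 * \<kappa> / Suc n)) \<longlonglongrightarrow> 0" by simp
    show "\<forall>\<^sub>F n in sequentially. \<epsilon> n \<le> 2 * (\<delta> n)\<^sup>2 + 2 * (2 * \<kappa> / Suc n)"
      using \<epsilon> by (rule always_eventually[OF allI])
  qed (simp add: \<epsilon>_def)
  have eig: "solve h x = \<kappa> * h x" if x: "x \<in> {0..1}" for x
  proof -
    have "\<bar>solve h x - \<kappa> * h x\<bar> \<le> sqrt (\<epsilon> n) + \<kappa> * \<delta> n" for n
    proof -
      \<comment> \<open>The difference lies in the complement again, so \<open>solve_bound\<close>
        upgrades its norm \<open>sqrt (\<epsilon> n)\<close> to a uniform estimate for its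
        image.\<close>
      have "orth E (\<lambda>x. 1 * h x + - \<kappa> * g n x)"
        unfolding orth_def
      proof (intro conjI ballI)
        fix e assume e: "e \<in> E"
        have "integrable \<mu> (\<lambda>x. h x * e x)" "integrable \<mu> (\<lambda>x. g n x * e x)"
          by (intro integrable_continuous continuous_intros h cg contE[OF e])+
        then have "(\<integral>x. (1 * h x + - \<kappa> * g n x) * e x \<partial>\<mu>) =
            (\<integral>x. h x * e x \<partial>\<mu>) - \<kappa> * (\<integral>x. g n x * e x \<partial>\<mu>)"
          by (simp add: left_diff_distrib mult.assoc)
        then show "(\<integral>x. (1 * h x + - \<kappa> * g n x) * e x \<partial>\<mu>) = 0"
          using orth_h g(1)[of n] e by (simp add: orth_def)
      qed (intro continuous_intros h cg)
      from solve_bound[OF cont[OF this] mean[OF this] x]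
      have "\<bar>solve (\<lambda>x. 1 * h x + - \<kappa> * g n x) x\<bar> \<le> sqrt (\<epsilon> n)"
        by (simp add: \<epsilon>_def)
      then have "\<bar>solve h x - \<kappa> * solve (g n) x\<bar> \<le> sqrt (\<epsilon> n)"
        using solve_linear[OF cont[OF orth_h] mean[OF orth_h] cont[OF g(1)[of n]] mean[OF g(1)[of n]] x,
            where a = 1 and b = "- \<kappa>"]
        by simp
      moreover have "\<bar>\<kappa> * solve (g n) x - \<kappa> * h x\<bar> \<le> \<kappa> * \<delta> n"
        using \<delta>[OF x, of n] \<kappa> by (simp add: right_diff_distrib[symmetric] abs_mult)
      ultimately show ?thesis by linarith
    qed
    moreover have "(\<lambda>n. sqrt (\<epsilon> n) + \<kappa> * \<delta> n) \<longlonglongrightarrow> sqrt 0 + \<kappa> * 0"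
      by (intro tendsto_intros \<epsilon>lim \<delta>lim)
    ultimately have "\<bar>solve h x - \<kappa> * h x\<bar> \<le> sqrt 0 + \<kappa> * 0"
      by (intro LIMSEQ_le_const[of _ _ "\<bar>solve h x - \<kappa> * h x\<bar>"]) auto
    then show ?thesis by simp
  qed
  \<comment> \<open>Otherwise \<open>\<kappa> * g n\<close> would tend to zero in the
    \<open>\<mu>\<close>-norm, against \<open>norm2 (g n) = 1\<close>.\<close>
  have "norm2 h > 0"
  proof (rule ccontr)
    assume "\<not> norm2 h > 0"
    moreover have "0 \<le> norm2 h" by simp
    ultimately have h0: "norm2 h = 0" by linarith
    have "\<kappa>\<^sup>2 \<le> 2 * \<epsilon> n" for n
    proof -
      have i: "integrable \<mu> (\<lambda>x. (h x)\<^sup>2)" "integrable \<mu> (\<lambda>x. (h x - \<kappa> * g n x)\<^sup>2)" "integrable \<mu> (\<lambda>x. (g n x)\<^sup>2)"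
        by (intro integrable_continuous continuous_intros h cg)+
      have "(\<integral>x. \<kappa>\<^sup>2 * (g n x)\<^sup>2 \<partial>\<mu>) \<le> (\<integral>x. 2 * (h x)\<^sup>2 + 2 * (h x - \<kappa> * g n x)\<^sup>2 \<partial>\<mu>)"
      proof (rule integral_mono)
        fix x
        show "\<kappa>\<^sup>2 * (g n x)\<^sup>2 \<le> 2 * (h x)\<^sup>2 + 2 * (h x - \<kappa> * g n x)\<^sup>2"
          using zero_le_power2[of "2 * h x - \<kappa> * g n x"] by (simp add: power2_eq_square algebra_simps)
      qed (use i in auto)
      then show ?thesis using i g(2)[of n] h0 by (simp add: \<epsilon>_def)
    qed
    moreover have lim: "(\<lambda>n. 2 * \<epsilon> n) \<longlonglongrightarrow> 2 * 0" by (intro tendsto_intros \<epsilon>lim)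
    ultimately have "\<kappa>\<^sup>2 \<le> 2 * 0" using LIMSEQ_le_const[OF lim] by blast
    then show False using \<kappa> by simp
  qed
  then show ?thesis using orth_h eig \<kappa> le[OF u(1)] by blast
qed

section \<open>From eigenvectors of the inverse operator to Neumann eigenvalues\<close>

lemma eigenvalue_nonneg:
  assumes "neumann_eigenvalue \<mu> l" shows "l \<ge> 0"
proof -
  obtain y g where e: "eigenpair l y g" "\<exists>x\<in>{0..1}. y x \<noteq> 0"
    using assms by (auto simp: neumann_eigenvalue_iff)
  have "0 \<le> (\<integral>t. (g t)\<^sup>2 \<partial>lborel)" by simp
  then show ?thesis
    using eigenpair_energy[OF e(1)] eigenpair_norm_pos[OF e] by (simp add: zero_le_mult_iff)
qed

text \<open>Testing the equation of \<open>e\<close> with \<open>solve f\<close> and integrating by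
  parts gives \<open>l * \<integral> e * solve f = \<integral> f * e\<close>. So the complement of
  \<open>e\<close> is invariant under \<open>solve\<close>; for the eigenvalue 0 this role is taken
  by \<open>solve_mean_zero\<close>.\<close>

lemma solve_orth_eigenpair:
  assumes e: "eigenpair l e g" and "l \<noteq> 0"
    and f: "continuous_on {0..1} f" "(\<integral>x. f x \<partial>\<mu>) = 0" and orth: "(\<integral>x. f x * e x \<partial>\<mu>) = 0"
  shows "(\<integral>x. solve f x * e x \<partial>\<mu>) = 0"
proof -
  have "l * (\<integral>x. e x * solve f x \<partial>\<mu>) = (\<integral>t. g t * - cumul f t \<partial>lborel)"
    by (rule eigenpairD[OF e solve_antideriv[OF f], symmetric])
  also have "\<dots> = (\<integral>x. f x * e x \<partial>\<mu>)"
    using integral_by_parts[OF f(1) eigenpair_antideriv[OF e]] f(2) by simp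
  finally show ?thesis using orth \<open>l \<noteq> 0\<close> by (simp add: mult.commute)
qed

text \<open>The eigenvalue relation improves regularity: \<open>h\<close> is only assumed
  continuous, but it equals \<open>solve h / \<kappa>\<close> and inherits a derivative. The weak
  equation is then integration by parts.\<close>

lemma eigenpair_of_solve:
  assumes h: "continuous_on {0..1} h" "(\<integral>x. h x \<partial>\<mu>) = 0" and "\<kappa> \<noteq> 0"
    and eig: "\<And>x. x \<in> {0..1} \<Longrightarrow> solve h x = \<kappa> * h x"
  shows "eigenpair (1 / \<kappa>) h (\<lambda>t. - cumul h t / \<kappa>)"
  unfolding eigenpair_def
proof (intro conjI allI impI)
  have "antideriv (\<lambda>x. \<Sum>i\<in>{()}. (1 / \<kappa>) * solve h x) (\<lambda>x. \<Sum>i\<in>{()}. (1 / \<kappa>) * - cumul h x)"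
    using solve_antideriv[OF h] by (intro antideriv_sum) auto
  then have "antideriv (\<lambda>x. (1 / \<kappa>) * solve h x) (\<lambda>t. - cumul h t / \<kappa>)" by simp
  then show "antideriv h (\<lambda>t. - cumul h t / \<kappa>)"
    by (rule antideriv_cong) (simp add: eig \<open>\<kappa> \<noteq> 0\<close>)
  fix \<eta> \<eta>' assume \<eta>: "antideriv \<eta> \<eta>'"
  have "(\<integral>t. - cumul h t / \<kappa> * \<eta>' t \<partial>lborel) = (\<integral>t. (- 1 / \<kappa>) * (\<eta>' t * cumul h t) \<partial>lborel)"
    by (intro Bochner_Integration.integral_cong) auto
  also have "\<dots> = (- 1 / \<kappa>) * (\<integral>t. \<eta>' t * cumul h t \<partial>lborel)" by (rule integral_mult_right_zero)
  also have "\<dots> = 1 / \<kappa> * (\<integral>x. h x * \<eta> x \<partial>\<mu>)"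
    using integral_by_parts[OF h(1) \<eta>] h(2) by simp
  finally show "(\<integral>t. - cumul h t / \<kappa> * \<eta>' t \<partial>lborel) = 1 / \<kappa> * (\<integral>x. h x * \<eta> x \<partial>\<mu>)" .
qed

text \<open>Disjoint supports keep the Rayleigh quotient of every nontrivial combination below
  \<open>L\<close>. The inverse operator sees another quotient, \<open>energy\<close> over
  \<open>norm2\<close>, and Cauchy-Schwarz relates the two.\<close>

lemma eigenvalue_count_ge:
  assumes J: "finite J" and u: "\<And>j. j \<in> J \<Longrightarrow> antideriv (u j) (u' j)"
    and disj: "\<And>i j x. i \<in> J \<Longrightarrow> j \<in> J \<Longrightarrow> i \<noteq> j \<Longrightarrow> u i x * u j x = 0"
    and disj': "\<And>i j x. i \<in> J \<Longrightarrow> j \<in> J \<Longrightarrow> i \<noteq> j \<Longrightarrow> u' i x * u' j x = 0"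
    and less: "\<And>j. j \<in> J \<Longrightarrow> (\<integral>t. (u' j t)\<^sup>2 \<partial>lborel) < L * norm2 (u j)"
    and "L > 0" and fin: "finite {l. neumann_eigenvalue \<mu> l \<and> l < L}"
  shows "card J \<le> card {l. neumann_eigenvalue \<mu> l \<and> l < L}"
proof (rule ccontr)
  define S where "S = {l. neumann_eigenvalue \<mu> l \<and> l < L}"
  assume "\<not> card J \<le> card {l. neumann_eigenvalue \<mu> l \<and> l < L}"
  then have lt: "card S < card J" by (simp add: S_def)
  have finS: "finite S" using fin by (simp add: S_def)
  have "\<forall>l\<in>S. \<exists>yg. eigenpair l (fst yg) (snd yg) \<and> (\<exists>x\<in>{0..1}. fst yg x \<noteq> 0)"
    by (auto simp: neumann_eigenvalue_iff S_def)
  then obtain Z where Z: "\<And>l. l \<in> S \<Longrightarrow> eigenpair l (fst (Z l)) (snd (Z l))"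
    "\<And>l. l \<in> S \<Longrightarrow> \<exists>x\<in>{0..1}. fst (Z l) x \<noteq> 0" by metis
  \<comment> \<open>For the eigenvalue 0 the constant 1 is the chosen eigenfunction, so that
    orthogonality to \<open>E\<close> includes mean zero.\<close>
  define Y where "Y l = (if l = 0 then (\<lambda>_. 1) else fst (Z l))" for l :: real
  define E where "E = Y ` S"
  have "0 \<in> S" using neumann_eigenvalue_zero \<open>L > 0\<close> by (simp add: S_def)
  then have one: "(\<lambda>_. 1) \<in> E" unfolding E_def Y_def by (auto intro: rev_image_eqI)
  have contE: "continuous_on {0..1} e" if "e \<in> E" for e
    using that eigenpair_continuous[OF Z(1)] by (auto simp: E_def Y_def)
  have mean: "(\<integral>x. f x \<partial>\<mu>) = 0" if "orth E f" for f
    using that one by (force simp: orth_def)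
  have cont: "continuous_on {0..1} f" if "orth E f" for f using that by (simp add: orth_def)
  have inv: "orth E (solve f)" if f: "orth E f" for f
    unfolding orth_def
  proof (intro conjI ballI)
    show "continuous_on {0..1} (solve f)" by (rule solve_continuous[OF cont[OF f] mean[OF f]])
    fix e assume e: "e \<in> E"
    then obtain l where l: "l \<in> S" "e = Y l" by (auto simp: E_def)
    show "(\<integral>x. solve f x * e x \<partial>\<mu>) = 0"
    proof (cases "l = 0")
      case True
      then show ?thesis using l solve_mean_zero[OF cont[OF f] mean[OF f]] by (simp add: Y_def)
    next
      case False
      then have "e = fst (Z l)" using l by (simp add: Y_def)
      then show ?thesis
        using solve_orth_eigenpair[OF Z(1)[OF l(1)] False cont[OF f] mean[OF f]] f e by (simp add: orth_def)
    qed
  qed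
  have cu: "continuous_on {0..1} (u j)" if "j \<in> J" for j
    using u[OF that] by (rule antideriv_continuous)
  have "card E < card J" unfolding E_def using card_image_le[OF finS, of Y] lt by linarith
  then obtain c where c: "\<exists>j\<in>J. c j \<noteq> 0" "\<And>e. e \<in> E \<Longrightarrow> (\<Sum>j\<in>J. c j * (\<integral>x. u j x * e x \<partial>\<mu>)) = 0"
    using homogeneous_system_nontrivial[of E J "\<lambda>e j. \<integral>x. u j x * e x \<partial>\<mu>"] finS J by (auto simp: E_def)
  define w where "w x = (\<Sum>j\<in>J. c j * u j x)" for x
  define w' where "w' x = (\<Sum>j\<in>J. c j * u' j x)" for x
  have w: "antideriv w w'" unfolding w_def[abs_def] w'_def[abs_def] by (rule antideriv_sum[OF J u])
  have orthw: "orth E w"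
    unfolding orth_def
  proof (intro conjI ballI antideriv_continuous[OF w])
    fix e assume e: "e \<in> E"
    have "(\<integral>x. w x * e x \<partial>\<mu>) = (\<integral>x. (\<Sum>j\<in>J. c j * (u j x * e x)) \<partial>\<mu>)"
      by (simp add: w_def sum_distrib_right mult.assoc)
    also have "\<dots> = (\<Sum>j\<in>J. \<integral>x. c j * (u j x * e x) \<partial>\<mu>)"
      by (intro Bochner_Integration.integral_sum integrable_mult_right integrable_continuous
          continuous_on_mult cu contE[OF e])
    also have "\<dots> = 0" using c(2)[OF e] by simp
    finally show "(\<integral>x. w x * e x \<partial>\<mu>) = 0" .
  qed
  have nw: "norm2 w = (\<Sum>j\<in>J. (c j)\<^sup>2 * norm2 (u j))"
    unfolding w_def
    by (intro integral_square_sum_orthogonal[OF J] integrable_continuous continuous_on_mult cu)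
      (simp_all add: disj del: mult_eq_0_iff)
  have ew: "(\<integral>t. (w' t)\<^sup>2 \<partial>lborel) = (\<Sum>j\<in>J. (c j)\<^sup>2 * (\<integral>t. (u' j t)\<^sup>2 \<partial>lborel))"
    unfolding w'_def
    by (intro integral_square_sum_orthogonal[OF J] L2_unit_mult_integrable antideriv_L2[OF u])
      (simp_all add: disj' del: mult_eq_0_iff)
  have "(\<integral>t. (w' t)\<^sup>2 \<partial>lborel) < (\<Sum>j\<in>J. (c j)\<^sup>2 * (L * norm2 (u j)))"
    unfolding ew
  proof (rule sum_strict_mono_ex1[OF J])
    show "\<forall>j\<in>J. (c j)\<^sup>2 * (\<integral>t. (u' j t)\<^sup>2 \<partial>lborel) \<le> (c j)\<^sup>2 * (L * norm2 (u j))"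
      by (intro ballI mult_left_mono less_imp_le[OF less]) auto
    from c(1) obtain j where "j \<in> J" "c j \<noteq> 0" by blast
    then show "\<exists>j\<in>J. (c j)\<^sup>2 * (\<integral>t. (u' j t)\<^sup>2 \<partial>lborel) < (c j)\<^sup>2 * (L * norm2 (u j))"
      using less by (intro bexI[of _ j] mult_strict_left_mono) auto
  qed
  also have "\<dots> = L * norm2 w" unfolding nw sum_distrib_left by (intro sum.cong) auto
  finally have wless: "(\<integral>t. (w' t)\<^sup>2 \<partial>lborel) < L * norm2 w" .
  have "0 \<le> (\<integral>t. (w' t)\<^sup>2 \<partial>lborel)" by simp
  with wless have "0 < L * norm2 w" by linarith
  then have nw0: "0 < norm2 w" using \<open>L > 0\<close> by (simp add: zero_less_mult_iff)
  \<comment> \<open>By parts, \<open>norm2 w\<close> is a scalar product of \<open>w'\<close> with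
    \<open>cumul w\<close>. A Dirichlet energy below \<open>L * norm2 w\<close> therefore forces
    \<open>energy w\<close> above \<open>norm2 w / L\<close>.\<close>
  have "norm2 w = (\<integral>x. w x * w x \<partial>\<mu>)" by (simp add: power2_eq_square)
  also have "\<dots> = - (\<integral>s. w' s * cumul w s \<partial>lborel)"
    using integral_by_parts[OF cont[OF orthw] w] mean[OF orthw] by simp
  finally have "(norm2 w)\<^sup>2 = (\<integral>s. w' s * cumul w s \<partial>lborel)\<^sup>2" by simp
  also have "\<dots> \<le> (\<integral>t. (w' t)\<^sup>2 \<partial>lborel) * energy w"
    using antideriv_L2[OF w] cumul_L2[OF cont[OF orthw] mean[OF orthw]]
    by (intro cauchy_schwarz_integral(2)) (auto simp: L2_unit_def)
  finally have sq: "(norm2 w)\<^sup>2 \<le> (\<integral>t. (w' t)\<^sup>2 \<partial>lborel) * energy w" .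
  have ewpos: "0 < energy w"
  proof -
    have "0 \<le> energy w" by simp
    moreover have "energy w \<noteq> 0" using sq nw0 by auto
    ultimately show ?thesis by linarith
  qed
  with wless sq have "(norm2 w)\<^sup>2 < L * norm2 w * energy w"
    by (meson mult_strict_right_mono order_le_less_trans)
  then have "norm2 w < L * energy w"
    using nw0 by (simp add: power2_eq_square mult_ac)
  moreover obtain h \<kappa> where h: "orth E h" "norm2 h > 0" and \<kappa>: "energy w \<le> \<kappa> * norm2 w" "\<kappa> > 0"
    and eig: "\<And>x. x \<in> {0..1} \<Longrightarrow> solve h x = \<kappa> * h x"
    using compact_eigenvector[OF one contE inv orthw ewpos] by blast
  ultimately have "norm2 w < (L * \<kappa>) * norm2 w"
    using \<open>L > 0\<close> by (smt (verit) mult.assoc mult_left_mono)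
  then have L\<kappa>: "1 / \<kappa> < L" using nw0 \<kappa>(2) by (simp add: field_simps)
  have he: "eigenpair (1 / \<kappa>) h (\<lambda>t. - cumul h t / \<kappa>)"
    using eigenpair_of_solve[OF cont[OF h(1)] mean[OF h(1)] _ eig] \<kappa>(2) by simp
  have hnz: "\<exists>x\<in>{0..1}. h x \<noteq> 0"
  proof (rule ccontr)
    assume "\<not> ?thesis"
    then have "norm2 h = (\<integral>x. 0 \<partial>\<mu>)" by (intro integral_cong_unit) auto
    then show False using h(2) by simp
  qed
  \<comment> \<open>The eigenvalue found is one of those in \<open>S\<close>, so \<open>E\<close>
    already contains an eigenfunction for it; that \<open>h\<close> is orthogonal to it contradicts
    simplicity.\<close>
  have inS: "1 / \<kappa> \<in> S" unfolding S_def using he hnz L\<kappa> by (auto simp: neumann_eigenvalue_iff)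
  have "Y (1 / \<kappa>) = fst (Z (1 / \<kappa>))" using \<kappa>(2) by (simp add: Y_def)
  then have "(\<integral>x. h x * fst (Z (1 / \<kappa>)) x \<partial>\<mu>) = 0"
    using h(1) inS by (force simp: orth_def E_def)
  moreover have "(\<integral>x. h x * fst (Z (1 / \<kappa>)) x \<partial>\<mu>) \<noteq> 0"
    by (rule eigenvalue_simple[OF he hnz Z(1)[OF inS] Z(2)[OF inS]])
  ultimately show False by simp
qed

end

section \<open>Words and cells\<close>

text \<open>Stopped sections of the word tree, grown in \<open>n\<close> rounds from the empty word:
  a word with \<open>P\<close> is frozen, any other is replaced by its children. The cap
  \<open>n\<close> keeps the sections finite and gives an induction variable.\<close>

primrec cutset :: "nat \<Rightarrow> (nat list \<Rightarrow> bool) \<Rightarrow> nat \<Rightarrow> nat list set" where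
  "cutset m P 0 = {[]}"
| "cutset m P (Suc n) = (\<Union>w\<in>cutset m P n. if P w then {w} else (\<lambda>i. w @ [i]) ` {1..m})"

lemma finite_cutset: "finite (cutset m P n)"
  by (induction n) auto

lemma cutset_SucE:
  assumes "w \<in> cutset m P (Suc n)"
  obtains v where "v \<in> cutset m P n" "P v" "w = v"
  | v i where "v \<in> cutset m P n" "\<not> P v" "i \<in> {1..m}" "w = v @ [i]"
  using assms by (auto split: if_splits)

lemma cutset_lists: "w \<in> cutset m P n \<Longrightarrow> w \<in> lists {1..m}"
proof (induction n arbitrary: w)
  case (Suc n)
  from Suc.prems show ?case
    by (rule cutset_SucE) (use Suc.IH in auto)
qed simp

lemma cutset_stop: "w \<in> cutset m P n \<Longrightarrow> P w \<or> length w = n"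
proof (induction n arbitrary: w)
  case (Suc n)
  from Suc.prems show ?case
    by (rule cutset_SucE) (use Suc.IH in auto)
qed simp

lemma cutset_butlast: "w \<in> cutset m P n \<Longrightarrow> w \<noteq> [] \<Longrightarrow> \<not> P (butlast w)"
proof (induction n arbitrary: w)
  case (Suc n)
  from Suc.prems(1) show ?case
    by (rule cutset_SucE) (use Suc in auto)
qed simp

lemma cutset_child_prefix: "v \<in> (if P w then {w} else (\<lambda>i. w @ [i]) ` {1..m}) \<Longrightarrow> prefix w v"
  by (auto split: if_splits)

lemma parallel_extend: "parallel u v \<Longrightarrow> prefix u w \<Longrightarrow> prefix v z \<Longrightarrow> parallel w z"
  by (auto simp: prefix_def intro: parallel_append)

text \<open>Incomparability passes to extensions, and distinct children of one word differ in their
  last letter.\<close>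

lemma cutset_parallel: "w \<in> cutset m P n \<Longrightarrow> v \<in> cutset m P n \<Longrightarrow> w \<noteq> v \<Longrightarrow> parallel w v"
proof (induction n arbitrary: w v)
  case (Suc n)
  let ?B = "\<lambda>u. if P u then {u} else (\<lambda>i. u @ [i]) ` {1..m}"
  obtain w' where w': "w' \<in> cutset m P n" "w \<in> ?B w'" using Suc.prems(1) by auto
  obtain v' where v': "v' \<in> cutset m P n" "v \<in> ?B v'" using Suc.prems(2) by auto
  show ?case
  proof (cases "w' = v'")
    case True
    then have "\<exists>i j. w = w' @ [i] \<and> v = w' @ [j]"
      using w'(2) v'(2) Suc.prems(3) by (cases "P w'") auto
    then show ?thesis using Suc.prems(3) by auto
  next
    case False
    have "prefix w' w" "prefix v' v"
      using cutset_child_prefix[where P = P] w'(2) v'(2) by blast+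
    with Suc.IH[OF w'(1) v'(1) False] show ?thesis by (rule parallel_extend)
  qed
qed simp

text \<open>Conservation law for any quantity that splits additively among children. It serves both
  for masses pulled back along words and for the \<open>D\<close>-th powers of the weights in
  \<open>s\<close>.\<close>

lemma sum_cutset:
  fixes a :: "nat list \<Rightarrow> real"
  assumes "\<And>w. w \<in> lists {1..m} \<Longrightarrow> (\<Sum>i=1..m. a (w @ [i])) = a w"
  shows "(\<Sum>w\<in>cutset m P n. a w) = a []"
proof (induction n)
  case (Suc n)
  let ?B = "\<lambda>w. if P w then {w} else (\<lambda>i. w @ [i]) ` {1..m}"
  have "(\<Sum>w\<in>cutset m P (Suc n). a w) = (\<Sum>w\<in>cutset m P n. \<Sum>v\<in>?B w. a v)"
    unfolding cutset.simps
  proof (rule sum.UNION_disjoint[OF finite_cutset])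
    show "\<forall>w\<in>cutset m P n. finite (?B w)" by auto
    show "\<forall>w\<in>cutset m P n. \<forall>v\<in>cutset m P n. w \<noteq> v \<longrightarrow> ?B w \<inter> ?B v = {}"
    proof (intro ballI impI equals0I)
      fix w v z assume wv: "w \<in> cutset m P n" "v \<in> cutset m P n" "w \<noteq> v" and "z \<in> ?B w \<inter> ?B v"
      then have "prefix w z" "prefix v z" using cutset_child_prefix by blast+
      then show False using cutset_parallel[OF wv] prefix_same_cases by blast
    qed
  qed
  also have "\<dots> = (\<Sum>w\<in>cutset m P n. a w)"
  proof (rule sum.cong[OF refl])
    fix w assume w: "w \<in> cutset m P n"
    have "inj_on (\<lambda>i. w @ [i]) {1..m}" by (auto simp: inj_on_def)
    then show "(\<Sum>v\<in>?B w. a v) = a w"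
      using assms[OF cutset_lists[OF w]] by (simp add: sum.reindex)
  qed
  finally show ?case using Suc.IH by simp
qed simp

text \<open>Sorting into blocks of equal letters; removing all occurrences of \<open>k\<close>
  leaves the blocks of the other letters unchanged.\<close>

lemma mset_concat_filter:
  assumes "distinct ks" "set w \<subseteq> set ks"
  shows "mset (concat (map (\<lambda>i. filter (\<lambda>j. j = i) w) ks)) = mset w"
  using assms
proof (induction ks arbitrary: w)
  case (Cons k ks)
  let ?w = "filter (\<lambda>j. j \<noteq> k) w"
  have eq: "map (\<lambda>i. filter (\<lambda>j. j = i) w) ks = map (\<lambda>i. filter (\<lambda>j. j = i) ?w) ks"
  proof (rule map_cong[OF refl])
    fix i assume "i \<in> set ks"
    then have "i \<noteq> k" using Cons.prems by auto
    then show "filter (\<lambda>j. j = i) w = filter (\<lambda>j. j = i) ?w" by (auto intro!: filter_cong)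
  qed
  have "mset (concat (map (\<lambda>i. filter (\<lambda>j. j = i) w) (k # ks))) =
      mset (filter (\<lambda>j. j = k) w) + mset (concat (map (\<lambda>i. filter (\<lambda>j. j = i) ?w) ks))"
    by (simp only: list.map concat.simps mset_append eq)
  also have "mset (concat (map (\<lambda>i. filter (\<lambda>j. j = i) ?w) ks)) = mset ?w"
    using Cons.prems by (intro Cons.IH) auto
  also have "mset (filter (\<lambda>j. j = k) w) + mset ?w = mset w"
    unfolding mset_filter by (rule multiset_partition[symmetric])
  finally show ?case .
qed simp

lemma word_map_append: "word_map \<phi> (u @ v) = word_map \<phi> u \<circ> word_map \<phi> v"
  by (induction u) (auto simp: comp_assoc)

abbreviation word_weight :: "(nat \<Rightarrow> real) \<Rightarrow> nat list \<Rightarrow> real" where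
  "word_weight r w \<equiv> prod_list (map r w)"

lemma word_weight_pos:
  "(\<And>i. i \<in> A \<Longrightarrow> r i > 0) \<Longrightarrow> w \<in> lists A \<Longrightarrow> word_weight r w > 0"
  by (induction w) auto

lemma word_weight_le_power:
  assumes "\<And>i. i \<in> A \<Longrightarrow> 0 < r i \<and> r i \<le> b" "w \<in> lists A"
  shows "word_weight r w \<le> b ^ length w"
  using assms(2)
proof (induction w)
  case (Cons i w)
  then have "word_weight r w > 0" using assms(1) by (intro word_weight_pos[of A]) auto
  then show ?case using Cons assms(1)[of i] by (auto intro!: mult_mono)
qed simp

lemma word_weight_mset: "mset w = mset v \<Longrightarrow> word_weight r w = word_weight r v"
  by (metis mset_map prod_mset_prod_list)

lemma word_weight_mult: "word_weight (\<lambda>i. r i * s i) w = word_weight r w * word_weight s w"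
  by (induction w) auto

section \<open>Derivatives of word maps under strong bounded distortion\<close>

locale conformal_system =
  fixes m :: nat and \<phi> :: "nat \<Rightarrow> real \<Rightarrow> real" and \<rho> x :: "nat \<Rightarrow> real"
  assumes m2: "m \<ge> 2" and IFS: "conformal_IFS m \<phi> \<rho>" and SBD: "strong_bounded_distortion m \<phi>"
    and fixpoint: "\<And>i. i \<in> {1..m} \<Longrightarrow> x i \<in> {0..1} \<and> \<phi> i (x i) = x i"
begin

definition r :: "nat \<Rightarrow> real" where "r i = \<bar>deriv01 (\<phi> i) (x i)\<bar>"

lemma rho_pos: "i \<in> {1..m} \<Longrightarrow> \<rho> i > 0" and rho_sum: "(\<Sum>i=1..m. \<rho> i) = 1"
  using IFS unfolding conformal_IFS_def by blast+

lemma deriv_bounds: "i \<in> {1..m} \<Longrightarrow> t \<in> {0..1} \<Longrightarrow> 0 < \<bar>deriv01 (\<phi> i) t\<bar> \<and> \<bar>deriv01 (\<phi> i) t\<bar> < 1"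
  using IFS unfolding conformal_IFS_def by blast

lemma r_pos: "i \<in> {1..m} \<Longrightarrow> r i > 0" and r_less_1: "i \<in> {1..m} \<Longrightarrow> r i < 1"
  unfolding r_def using deriv_bounds fixpoint by blast+

lemma letter_deriv:
  assumes "i \<in> {1..m}" "t \<in> {0..1}"
  shows "(\<phi> i has_real_derivative deriv01 (\<phi> i) t) (at t within {0..1})"
proof -
  have "\<phi> i differentiable_on {0..1}"
    using IFS assms unfolding conformal_IFS_def C1_holder_diffeo_def C1_holder_def by blast
  then have "\<phi> i differentiable (at t within {0..1})"
    using assms by (simp add: differentiable_on_def)
  then show ?thesis
    by (simp add: vector_derivative_works has_real_derivative_iff_has_vector_derivative)
qed

text \<open>The definition of the system speaks of open intervals; continuity carries the inclusion
  to the closures.\<close>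

lemma letter_maps: "i \<in> {1..m} \<Longrightarrow> t \<in> {0..1} \<Longrightarrow> \<phi> i t \<in> {0..1}"
proof -
  assume i: "i \<in> {1..m}" and t: "t \<in> {0..1}"
  have "continuous_on {0..1} (\<phi> i)"
    using letter_deriv[OF i] by (rule DERIV_continuous_on)
  moreover have "closure {0<..<1::real} = {0..1}" by simp
  moreover have "\<phi> i ` {0<..<1} \<subseteq> {0..1}"
    using IFS i greaterThanLessThan_subseteq_atLeastAtMost_iff[of 0 1 0 "1::real"]
    unfolding conformal_IFS_def by (smt (verit) subset_trans)
  ultimately have "\<phi> i ` {0..1} \<subseteq> {0..1}"
    by (metis closed_real_atLeastAtMost image_closure_subset)
  then show ?thesis using t by blast
qed

lemma word_maps: "w \<in> lists {1..m} \<Longrightarrow> t \<in> {0..1} \<Longrightarrow> word_map \<phi> w t \<in> {0..1}"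
  by (induction w) (auto simp del: atLeastAtMost_iff intro: letter_maps)

abbreviation d :: "nat list \<Rightarrow> real \<Rightarrow> real" where "d w \<equiv> deriv01 (word_map \<phi> w)"

lemma deriv01_eq:
  "(f has_real_derivative D) (at t within {0..1}) \<Longrightarrow> t \<in> {0..1} \<Longrightarrow> deriv01 f t = D"
  by (intro vector_derivative_within_closed_interval)
    (auto simp: has_real_derivative_iff_has_vector_derivative)

lemma word_image: "w \<in> lists {1..m} \<Longrightarrow> word_map \<phi> w ` {0..1} \<subseteq> {0..1}"
  by (intro image_subsetI word_maps)

lemma chain_deriv:
  assumes "(f has_real_derivative D) (at (g t) within {0..1})" "(g has_real_derivative D') (at t within {0..1})"
    and "g ` {0..1} \<subseteq> {0..1}"
  shows "(f \<circ> g has_real_derivative D * D') (at t within {0..1})"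
  using DERIV_image_chain[OF DERIV_subset[OF assms(1,3)] assms(2)] .

lemma word_deriv:
  assumes "w \<in> lists {1..m}" "t \<in> {0..1}"
  shows "(word_map \<phi> w has_real_derivative d w t) (at t within {0..1})"
proof -
  have "\<exists>D. (word_map \<phi> w has_real_derivative D) (at t within {0..1})"
    using assms
  proof (induction w rule: list.induct)
    case Nil
    have "(id has_real_derivative 1) (at t within {0..1})" unfolding id_def by (rule DERIV_ident)
    then show ?case unfolding word_map.simps by blast
  next
    case (Cons i w)
    then obtain D where D: "(word_map \<phi> w has_real_derivative D) (at t within {0..1})" by auto
    have w: "i \<in> {1..m}" "w \<in> lists {1..m}" using Cons.prems by auto
    from chain_deriv[OF letter_deriv[OF w(1) word_maps[OF w(2) Cons.prems(2)]] D word_image[OF w(2)]]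
    show ?case unfolding word_map.simps by blast
  qed
  then show ?thesis using deriv01_eq assms(2) by blast
qed

lemma d_append:
  assumes "u \<in> lists {1..m}" "v \<in> lists {1..m}" "t \<in> {0..1}"
  shows "d (u @ v) t = d u (word_map \<phi> v t) * d v t"
proof (rule deriv01_eq[OF _ assms(3)])
  from chain_deriv[OF word_deriv[OF assms(1) word_maps[OF assms(2,3)]] word_deriv[OF assms(2,3)]
      word_image[OF assms(2)]]
  show "(word_map \<phi> (u @ v) has_real_derivative d u (word_map \<phi> v t) * d v t) (at t within {0..1})"
    unfolding word_map_append .
qed

lemma d_Nil: "t \<in> {0..1} \<Longrightarrow> d [] t = 1"
  using deriv01_eq[of "\<lambda>x. x" 1 t] DERIV_ident by (simp add: id_def)

lemma d_single: "d [i] t = deriv01 (\<phi> i) t" by simp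

lemma d_nonzero: "w \<in> lists {1..m} \<Longrightarrow> t \<in> {0..1} \<Longrightarrow> d w t \<noteq> 0"
proof (induction w)
  case Nil
  then show ?case by (simp add: d_Nil del: word_map.simps)
next
  case (Cons i w)
  have "d ([i] @ w) t = d [i] (word_map \<phi> w t) * d w t"
    using Cons.prems by (intro d_append) auto
  moreover have "d [i] (word_map \<phi> w t) \<noteq> 0"
    unfolding d_single using Cons.prems deriv_bounds[of i "word_map \<phi> w t"] word_maps[of w t] by auto
  ultimately show ?case using Cons by (simp del: word_map.simps)
qed

definition C :: real where
  "C = (SOME C. C \<ge> 1 \<and> (\<forall>w\<in>lists {1..m}. \<forall>\<sigma>. \<sigma> permutes {..<length w} \<longrightarrow>
        (\<forall>x\<in>{0..1}. \<forall>y\<in>{0..1}. inverse C \<le> \<bar>d w x / d (permute_list \<sigma> w) y\<bar> \<and>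
           \<bar>d w x / d (permute_list \<sigma> w) y\<bar> \<le> C)))"

lemma C: "C \<ge> 1"
  and C_bound: "w \<in> lists {1..m} \<Longrightarrow> \<sigma> permutes {..<length w} \<Longrightarrow> s \<in> {0..1} \<Longrightarrow> t \<in> {0..1} \<Longrightarrow>
    \<bar>d w s / d (permute_list \<sigma> w) t\<bar> \<le> C"
proof -
  have "\<exists>C. C \<ge> 1 \<and> (\<forall>w\<in>lists {1..m}. \<forall>\<sigma>. \<sigma> permutes {..<length w} \<longrightarrow>
        (\<forall>x\<in>{0..1}. \<forall>y\<in>{0..1}. inverse C \<le> \<bar>d w x / d (permute_list \<sigma> w) y\<bar> \<and>
           \<bar>d w x / d (permute_list \<sigma> w) y\<bar> \<le> C))"
    using SBD unfolding strong_bounded_distortion_def by blast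
  note * = someI_ex[OF this, folded C_def]
  show "C \<ge> 1" using * by blast
  show "w \<in> lists {1..m} \<Longrightarrow> \<sigma> permutes {..<length w} \<Longrightarrow> s \<in> {0..1} \<Longrightarrow> t \<in> {0..1} \<Longrightarrow>
    \<bar>d w s / d (permute_list \<sigma> w) t\<bar> \<le> C"
    using * by blast
qed

text \<open>Equality of multisets supplies the permutation of positions. The case
  \<open>v = w\<close> compares the derivative of one word at two points.\<close>

lemma distortion:
  assumes w: "w \<in> lists {1..m}" and "mset v = mset w" "s \<in> {0..1}" "t \<in> {0..1}"
  shows "\<bar>d w s\<bar> \<le> C * \<bar>d v t\<bar>"
proof -
  obtain \<sigma> where \<sigma>: "\<sigma> permutes {..<length w}" "permute_list \<sigma> w = v"
    using mset_eq_permutation[OF assms(2)] by metis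
  have "v \<in> lists {1..m}" using w mset_eq_setD[OF assms(2)] by (simp add: in_lists_conv_set)
  then have "\<bar>d v t\<bar> > 0" using d_nonzero assms by auto
  then show ?thesis
    using C_bound[OF w \<sigma>(1) assms(3,4)] unfolding \<sigma>(2) by (simp add: abs_divide field_simps)
qed

text \<open>The chain rule evaluates every factor at the fixed point itself, so the derivative is an
  exact power.\<close>

lemma d_replicate_fixpoint:
  assumes i: "i \<in> {1..m}"
  shows "\<bar>d (replicate n i) (x i)\<bar> = r i ^ n" "word_map \<phi> (replicate n i) (x i) = x i"
proof -
  show fx: "word_map \<phi> (replicate n i) (x i) = x i" for n
    using fixpoint[OF i] by (induction n) auto
  show "\<bar>d (replicate n i) (x i)\<bar> = r i ^ n"
  proof (induction n)
    case 0
    then show ?case using fixpoint[OF i] by (simp add: d_Nil del: word_map.simps)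
  next
    case (Suc n)
    have "d ([i] @ replicate n i) (x i) = d [i] (x i) * d (replicate n i) (x i)"
      using d_append[of "[i]" "replicate n i" "x i"] fixpoint[OF i] i by (simp add: fx in_lists_conv_set)
    then have "d (replicate (Suc n) i) (x i) = deriv01 (\<phi> i) (x i) * d (replicate n i) (x i)"
      unfolding d_single by (simp del: word_map.simps)
    then show ?case using Suc by (simp add: abs_mult r_def del: word_map.simps replicate_Suc)
  qed
qed

text \<open>In each block the evaluation point is moved to the fixed point of its letter, at the
  cost of one factor \<open>C\<close>. The exponent thus counts blocks and not letters;
  \<open>n i = 0\<close> is allowed.\<close>

lemma d_blocks:
  fixes n :: "nat \<Rightarrow> nat"
  assumes "ks \<in> lists {1..m}" "t \<in> {0..1}"
  defines "w \<equiv> concat (map (\<lambda>i. replicate (n i) i) ks)"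
  shows "\<bar>d w t\<bar> \<le> C ^ length ks * word_weight r w \<and> word_weight r w \<le> C ^ length ks * \<bar>d w t\<bar>"
  using assms(1,2) unfolding w_def
proof (induction ks arbitrary: t rule: list.induct)
  case Nil
  then show ?case by (simp add: d_Nil del: word_map.simps)
next
  case (Cons k ks)
  define u where "u = replicate (n k) k"
  define v where "v = concat (map (\<lambda>i. replicate (n i) i) ks)"
  have k: "k \<in> {1..m}" using Cons.prems by auto
  have u: "u \<in> lists {1..m}" using k by (auto simp: u_def in_lists_conv_set)
  have v: "v \<in> lists {1..m}" using Cons.prems by (auto simp: v_def in_lists_conv_set)
  have IH: "\<bar>d v t\<bar> \<le> C ^ length ks * word_weight r v" "word_weight r v \<le> C ^ length ks * \<bar>d v t\<bar>"
    using Cons by (auto simp: v_def)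
  define z where "z = word_map \<phi> v t"
  have z: "z \<in> {0..1}" unfolding z_def by (rule word_maps[OF v Cons.prems(2)])
  have wu: "word_weight r u = r k ^ n k" by (simp add: u_def prod_list_replicate)
  have xk: "x k \<in> {0..1}" using fixpoint[OF k] by blast
  have u1: "\<bar>d u z\<bar> \<le> C * word_weight r u"
    using distortion[OF u refl z xk] d_replicate_fixpoint(1)[OF k] unfolding wu by (simp add: u_def)
  have u2: "word_weight r u \<le> C * \<bar>d u z\<bar>"
    using distortion[OF u refl xk z] d_replicate_fixpoint(1)[OF k] unfolding wu by (simp add: u_def)
  have pos: "word_weight r u > 0" "word_weight r v > 0"
    using r_pos u v by (auto intro!: word_weight_pos[of "{1..m}"])
  have duv: "\<bar>d (u @ v) t\<bar> = \<bar>d u z\<bar> * \<bar>d v t\<bar>"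
    using d_append[OF u v Cons.prems(2)] by (simp add: z_def abs_mult)
  have "\<bar>d u z\<bar> * \<bar>d v t\<bar> \<le> (C * word_weight r u) * (C ^ length ks * word_weight r v)"
    using u1 IH(1) pos C by (intro mult_mono) auto
  moreover have "word_weight r u * word_weight r v \<le> (C * \<bar>d u z\<bar>) * (C ^ length ks * \<bar>d v t\<bar>)"
    using u2 IH(2) pos C by (intro mult_mono) auto
  ultimately have "\<bar>d (u @ v) t\<bar> \<le> C ^ length (k # ks) * word_weight r (u @ v) \<and>
      word_weight r (u @ v) \<le> C ^ length (k # ks) * \<bar>d (u @ v) t\<bar>"
    unfolding duv by (simp add: mult_ac)
  then show ?case by (simp add: u_def v_def)
qed

text \<open>One factor \<open>C\<close> for sorting a word and one for each of its \<open>m\<close>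
  blocks.\<close>

definition K :: real where "K = C ^ Suc m"

lemma K: "K \<ge> 1" using C unfolding K_def by (rule one_le_power)

lemma d_bounds:
  assumes w: "w \<in> lists {1..m}" and t: "t \<in> {0..1}"
  shows "\<bar>d w t\<bar> \<le> K * word_weight r w" "word_weight r w \<le> K * \<bar>d w t\<bar>"
proof -
  define v where "v = concat (map (\<lambda>i. filter (\<lambda>j. j = i) w) [1..<Suc m])"
  have "set w \<subseteq> set [1..<Suc m]" using w by (auto simp: in_lists_conv_set)
  then have mv: "mset v = mset w" unfolding v_def by (intro mset_concat_filter) auto
  have v: "v \<in> lists {1..m}" using w mset_eq_setD[OF mv] by (simp add: in_lists_conv_set)
  have wv: "word_weight r v = word_weight r w" by (rule word_weight_mset[OF mv])
  have "v = concat (map (\<lambda>i. replicate (length (filter (\<lambda>j. j = i) w)) i) [1..<Suc m])"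
    unfolding v_def by (intro arg_cong[of _ _ concat] map_cong[OF refl] replicate_eqI) auto
  then have B: "\<bar>d v t\<bar> \<le> C ^ m * word_weight r w" "word_weight r w \<le> C ^ m * \<bar>d v t\<bar>"
    using d_blocks[of "[1..<Suc m]" t "\<lambda>i. length (filter (\<lambda>j. j = i) w)"] t
    by (auto simp: wv[symmetric] in_lists_conv_set simp del: upt_Suc)
  have "\<bar>d w t\<bar> \<le> C * \<bar>d v t\<bar>" by (rule distortion[OF w mv t t])
  also have "\<dots> \<le> C * (C ^ m * word_weight r w)" using B(1) C by (intro mult_left_mono) auto
  finally show "\<bar>d w t\<bar> \<le> K * word_weight r w" by (simp add: K_def)
  have "word_weight r w \<le> C ^ m * \<bar>d v t\<bar>" by (rule B(2))
  also have "\<dots> \<le> C ^ m * (C * \<bar>d w t\<bar>)"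
    using distortion[OF v mv[symmetric] t t] C by (intro mult_left_mono) auto
  finally show "word_weight r w \<le> K * \<bar>d w t\<bar>" by (simp add: K_def mult_ac)
qed

lemma word_continuous: "w \<in> lists {1..m} \<Longrightarrow> continuous_on {0..1} (word_map \<phi> w)"
  using word_deriv by (rule DERIV_continuous_on)

lemma word_mvt:
  assumes w: "w \<in> lists {1..m}" and "s \<in> {0..1}" "t \<in> {0..1}"
  shows "\<exists>z\<in>{0..1}. \<bar>word_map \<phi> w t - word_map \<phi> w s\<bar> = \<bar>d w z\<bar> * \<bar>t - s\<bar>"
proof -
  have *: "\<exists>z\<in>{0..1}. \<bar>word_map \<phi> w t - word_map \<phi> w s\<bar> = \<bar>d w z\<bar> * \<bar>t - s\<bar>"
    if st: "s \<in> {0..1}" "t \<in> {0..1}" "s < t" for s t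
  proof -
    have "\<exists>z\<in>{s<..<t}. word_map \<phi> w t - word_map \<phi> w s = d w z * (t - s)"
    proof (rule mvt_simple[OF st(3), of "word_map \<phi> w" "\<lambda>z. (*) (d w z)"])
      fix z assume "s \<le> z" "z \<le> t"
      then have "z \<in> {0..1}" "{s..t} \<subseteq> {0..1}" using st by auto
      then have "(word_map \<phi> w has_real_derivative d w z) (at z within {s..t})"
        using word_deriv[OF w] DERIV_subset by blast
      then show "(word_map \<phi> w has_derivative (*) (d w z)) (at z within {s..t})"
        by (simp add: has_field_derivative_def)
    qed
    then obtain z where "z \<in> {s<..<t}" "word_map \<phi> w t - word_map \<phi> w s = d w z * (t - s)" by blast
    then show ?thesis using st by (intro bexI[of _ z]) (auto simp: abs_mult)
  qed
  consider "s < t" | "s = t" | "t < s" by linarith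
  then show ?thesis
  proof cases
    case 3
    then show ?thesis using *[OF assms(3,2)] by (simp add: abs_minus_commute)
  qed (use * assms in auto)
qed

lemma word_lipschitz:
  assumes w: "w \<in> lists {1..m}" and "s \<in> {0..1}" "t \<in> {0..1}"
  shows "\<bar>word_map \<phi> w t - word_map \<phi> w s\<bar> \<le> K * word_weight r w * \<bar>t - s\<bar>"
    and "word_weight r w * \<bar>t - s\<bar> \<le> K * \<bar>word_map \<phi> w t - word_map \<phi> w s\<bar>"
proof -
  obtain z where z: "z \<in> {0..1}" "\<bar>word_map \<phi> w t - word_map \<phi> w s\<bar> = \<bar>d w z\<bar> * \<bar>t - s\<bar>"
    using word_mvt[OF assms] by blast
  show "\<bar>word_map \<phi> w t - word_map \<phi> w s\<bar> \<le> K * word_weight r w * \<bar>t - s\<bar>"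
    unfolding z(2) using d_bounds(1)[OF w z(1)] by (intro mult_right_mono) auto
  show "word_weight r w * \<bar>t - s\<bar> \<le> K * \<bar>word_map \<phi> w t - word_map \<phi> w s\<bar>"
    unfolding z(2) mult.assoc[symmetric] using d_bounds(2)[OF w z(1)] by (intro mult_right_mono) auto
qed

lemma r_weight_pos: "w \<in> lists {1..m} \<Longrightarrow> word_weight r w > 0"
  using r_pos by (intro word_weight_pos[of "{1..m}"])

lemma rho_weight_pos: "w \<in> lists {1..m} \<Longrightarrow> word_weight \<rho> w > 0"
  using rho_pos by (intro word_weight_pos[of "{1..m}"])

section \<open>Cells as intervals with disjoint interiors\<close>

lemma word_inj: "w \<in> lists {1..m} \<Longrightarrow> inj_on (word_map \<phi> w) {0..1}"
proof (rule inj_onI)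
  fix s t assume w: "w \<in> lists {1..m}" and "s \<in> {0..1}" "t \<in> {0..1}" "word_map \<phi> w s = word_map \<phi> w t"
  then have "word_weight r w * \<bar>t - s\<bar> \<le> 0" using word_lipschitz(2)[of w s t] by simp
  then show "s = t" using r_weight_pos[OF w] by (simp add: mult_le_0_iff)
qed

text \<open>Word maps may reverse orientation, hence \<open>min\<close> and \<open>max\<close> of
  the images of the end points.\<close>

definition lo :: "nat list \<Rightarrow> real" where "lo w = min (word_map \<phi> w 0) (word_map \<phi> w 1)"
definition hi :: "nat list \<Rightarrow> real" where "hi w = max (word_map \<phi> w 0) (word_map \<phi> w 1)"

lemma lo_hi:
  assumes w: "w \<in> lists {1..m}"
  shows "0 \<le> lo w" "lo w < hi w" "hi w \<le> 1" "hi w - lo w \<le> K * word_weight r w"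
proof -
  have "word_map \<phi> w 0 \<in> {0..1}" "word_map \<phi> w 1 \<in> {0..1}"
    using word_maps[OF w, of 0] word_maps[OF w, of 1] by auto
  moreover have "word_map \<phi> w 0 \<noteq> word_map \<phi> w 1"
    using inj_onD[OF word_inj[OF w], of 0 1] by auto
  ultimately show "0 \<le> lo w" "lo w < hi w" "hi w \<le> 1" by (auto simp: lo_def hi_def)
  show "hi w - lo w \<le> K * word_weight r w"
    using word_lipschitz(1)[OF w, of 0 1] by (auto simp: lo_def hi_def)
qed

lemma open_image:
  assumes w: "w \<in> lists {1..m}"
  shows "word_map \<phi> w ` {0<..<1} = {lo w<..<hi w}"
proof
  show "word_map \<phi> w ` {0<..<1} \<subseteq> {lo w<..<hi w}"
  proof (rule image_subsetI)
    fix t :: real assume "t \<in> {0<..<1}"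
    then show "word_map \<phi> w t \<in> {lo w<..<hi w}"
      using continuous_inj_imp_mono[OF _ _ word_continuous[OF w] word_inj[OF w], of t]
      by (auto simp: lo_def hi_def)
  qed
  show "{lo w<..<hi w} \<subseteq> word_map \<phi> w ` {0<..<1}"
  proof
    fix y assume y: "y \<in> {lo w<..<hi w}"
    have "connected (word_map \<phi> w ` {0..1})"
      by (intro connected_continuous_image word_continuous[OF w]) auto
    then have "is_interval (word_map \<phi> w ` {0..1})" by (simp add: is_interval_connected_1)
    moreover have "lo w \<in> word_map \<phi> w ` {0..1}" "hi w \<in> word_map \<phi> w ` {0..1}"
      by (auto simp: lo_def hi_def min_def max_def)
    ultimately have "y \<in> word_map \<phi> w ` {0..1}"
      using y unfolding is_interval_1 by (meson greaterThanLessThan_iff less_imp_le)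
    then obtain t where t: "t \<in> {0..1}" "y = word_map \<phi> w t" by blast
    then have "t \<noteq> 0" "t \<noteq> 1" using y by (auto simp: lo_def hi_def)
    then show "y \<in> word_map \<phi> w ` {0<..<1}" using t by auto
  qed
qed

lemma closed_image:
  assumes w: "w \<in> lists {1..m}" shows "word_map \<phi> w ` {0..1} = {lo w..hi w}"
proof -
  have "{0..1::real} = {0<..<1} \<union> {0, 1}" by auto
  then have "word_map \<phi> w ` {0..1} = {lo w<..<hi w} \<union> {word_map \<phi> w 0, word_map \<phi> w 1}"
    using open_image[OF w] by (simp add: image_Un)
  also have "{word_map \<phi> w 0, word_map \<phi> w 1} = {lo w, hi w}" by (auto simp: lo_def hi_def min_def max_def)
  also have "{lo w<..<hi w} \<union> {lo w, hi w} = {lo w..hi w}" using lo_hi(2)[OF w] by auto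
  finally show ?thesis .
qed

text \<open>At the first position where the words differ, the images of the two letters are
  disjoint, and the injective map of the common prefix keeps them so.\<close>

lemma open_disjoint:
  assumes w: "w \<in> lists {1..m}" and v: "v \<in> lists {1..m}" and "parallel w v"
  shows "{lo w<..<hi w} \<inter> {lo v<..<hi v} = {}"
proof -
  obtain u i w' j v' where eq: "i \<noteq> j" "w = u @ i # w'" "v = u @ j # v'"
    using parallel_decomp[OF assms(3)] by blast
  have in1: "word_map \<phi> z ` {0<..<1} \<subseteq> {0<..<1}" if "z \<in> lists {1..m}" for z
    using open_image[OF that] lo_hi[OF that] by auto
  have ij: "i \<in> {1..m}" "j \<in> {1..m}" "u \<in> lists {1..m}" "w' \<in> lists {1..m}" "v' \<in> lists {1..m}"
    using w v eq by auto
  have "\<forall>i\<in>{1..m}. \<forall>j\<in>{1..m}. i \<noteq> j \<longrightarrow> \<phi> i ` {0<..<1} \<inter> \<phi> j ` {0<..<1} = {}"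
    using IFS unfolding conformal_IFS_def by (elim conjE)
  with ij(1,2) eq(1) have "\<phi> i ` {0<..<1} \<inter> \<phi> j ` {0<..<1} = {}"
    by blast
  then have *: "word_map \<phi> (i # w') ` {0<..<1} \<inter> word_map \<phi> (j # v') ` {0<..<1} = {}"
    unfolding word_map.simps image_comp[symmetric]
    using image_mono[OF in1[OF ij(4)], of "\<phi> i"] image_mono[OF in1[OF ij(5)], of "\<phi> j"] by blast
  have sub: "word_map \<phi> (i # w') ` {0<..<1} \<subseteq> {0..1}" "word_map \<phi> (j # v') ` {0<..<1} \<subseteq> {0..1}"
    using order_trans[OF in1[of "i # w'"], of "{0..1}"] order_trans[OF in1[of "j # v'"], of "{0..1}"] ij
    by (simp_all add: greaterThanLessThan_subseteq_atLeastAtMost_iff del: word_map.simps)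
  have "{lo w<..<hi w} \<inter> {lo v<..<hi v} = word_map \<phi> w ` {0<..<1} \<inter> word_map \<phi> v ` {0<..<1}"
    using open_image[OF w] open_image[OF v] by simp
  also have "\<dots> = word_map \<phi> u ` (word_map \<phi> (i # w') ` {0<..<1}) \<inter> word_map \<phi> u ` (word_map \<phi> (j # v') ` {0<..<1})"
    unfolding eq word_map_append image_comp ..
  also have "\<dots> = word_map \<phi> u ` (word_map \<phi> (i # w') ` {0<..<1} \<inter> word_map \<phi> (j # v') ` {0<..<1})"
    by (rule inj_on_image_Int[OF word_inj[OF ij(3)] sub, symmetric])
  also have "\<dots> = {}" unfolding * by simp
  finally show ?thesis .
qed

end

section \<open>The self-conformal measure of cells\<close>

locale self_conformal_system = conformal_system m \<phi> \<rho> x + unit_interval_measure \<mu>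
  for m \<phi> \<rho> x \<mu> +
  assumes self_conformal:
    "\<And>E. E \<in> sets \<mu> \<Longrightarrow> prob E = (\<Sum>i=1..m. \<rho> i * prob (\<phi> i -` E \<inter> {0..1}))"
begin

lemma word_vimage_sets:
  assumes w: "w \<in> lists {1..m}" and E: "E \<in> sets \<mu>"
  shows "word_map \<phi> w -` E \<inter> {0..1} \<in> sets \<mu>"
proof -
  have "word_map \<phi> w \<in> measurable \<mu> (restrict_space borel {0..1})"
    using word_maps[OF w] measurable_continuous[OF word_continuous[OF w]]
    by (intro measurable_restrict_space2) (auto simp: space_eq)
  from measurable_sets[OF this, of E] show ?thesis
    using E sets_eq by (simp add: space_eq)
qed

text \<open>Self-conformality, applied to the preimage of \<open>E\<close> under \<open>w\<close>,
  says that the weighted mass at \<open>w\<close> splits among its children.\<close>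

lemma prob_cutset:
  assumes E: "E \<in> sets \<mu>"
  shows "prob E = (\<Sum>w\<in>cutset m P n. word_weight \<rho> w * prob (word_map \<phi> w -` E \<inter> {0..1}))"
proof -
  have "E \<subseteq> {0..1}" using sets.sets_into_space[OF E] by (simp add: space_eq)
  then have E0: "word_map \<phi> [] -` E \<inter> {0..1} = E" by auto
  have "(\<Sum>w\<in>cutset m P n. word_weight \<rho> w * prob (word_map \<phi> w -` E \<inter> {0..1})) =
      word_weight \<rho> [] * prob (word_map \<phi> [] -` E \<inter> {0..1})"
  proof (rule sum_cutset)
    fix w assume w: "w \<in> lists {1..m}"
    have eq: "word_map \<phi> (w @ [i]) -` E \<inter> {0..1} = \<phi> i -` (word_map \<phi> w -` E \<inter> {0..1}) \<inter> {0..1}"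
      if "i \<in> {1..m}" for i
      using letter_maps[OF that] by (auto simp: word_map_append)
    have "(\<Sum>i=1..m. word_weight \<rho> (w @ [i]) * prob (word_map \<phi> (w @ [i]) -` E \<inter> {0..1})) =
        (\<Sum>i=1..m. word_weight \<rho> w * (\<rho> i * prob (\<phi> i -` (word_map \<phi> w -` E \<inter> {0..1}) \<inter> {0..1})))"
      by (rule sum.cong[OF refl]) (simp add: eq)
    also have "\<dots> = word_weight \<rho> w * prob (word_map \<phi> w -` E \<inter> {0..1})"
      unfolding self_conformal[OF word_vimage_sets[OF w E]] sum_distrib_left ..
    finally show "(\<Sum>i=1..m. word_weight \<rho> (w @ [i]) * prob (word_map \<phi> (w @ [i]) -` E \<inter> {0..1})) =
        word_weight \<rho> w * prob (word_map \<phi> w -` E \<inter> {0..1})" .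
  qed
  then show ?thesis unfolding E0 by simp
qed

lemma prob_space_unit: "prob {0..1} = 1"
  using prob_space by (simp add: space_eq)

lemma sum_rho_cutset: "(\<Sum>w\<in>cutset m P n. word_weight \<rho> w) = 1"
proof -
  have "prob {0..1} = (\<Sum>w\<in>cutset m P n. word_weight \<rho> w * prob (word_map \<phi> w -` {0..1} \<inter> {0..1}))"
    by (rule prob_cutset) (rule atLeastAtMost_sets; simp)
  also have "\<dots> = (\<Sum>w\<in>cutset m P n. word_weight \<rho> w)"
  proof (rule sum.cong[OF refl])
    fix w assume "w \<in> cutset m P n"
    then have "word_map \<phi> w -` {0..1} \<inter> {0..1} = {0..1}"
      using word_image[OF cutset_lists] by blast
    then show "word_weight \<rho> w * prob (word_map \<phi> w -` {0..1} \<inter> {0..1}) = word_weight \<rho> w"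
      using prob_space_unit by simp
  qed
  finally show ?thesis using prob_space_unit by simp
qed

lemma rho_less_1: "i \<in> {1..m} \<Longrightarrow> \<rho> i < 1"
proof -
  assume i: "i \<in> {1..m}"
  have "(\<Sum>j\<in>{1..m} - {i}. \<rho> j) > 0"
  proof (rule sum_pos)
    have "card ({1..m} - {i}) > 0" using i m2 by simp
    then show "{1..m} - {i} \<noteq> {}" by (metis card.empty less_numeral_extra(3))
  qed (use rho_pos in auto)
  then show ?thesis using rho_sum sum.remove[OF finite_atLeastAtMost i, of \<rho>] by linarith
qed

text \<open>At level \<open>n\<close> at most two cells contain \<open>p\<close>, and each has
  weight at most \<open>b ^ n\<close>, where \<open>b\<close> is the largest \<open>\<rho> i\<close>
  and lies below 1.\<close>

lemma prob_singleton: "p \<in> {0..1} \<Longrightarrow> prob {p} = 0"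
proof -
  assume p: "p \<in> {0..1}"
  have pm: "{p} \<in> sets \<mu>" using atLeastAtMost_sets[of p p] p by simp
  define b where "b = Max (\<rho> ` {1..m})"
  have ne: "\<rho> ` {1..m} \<noteq> {}" using m2 by simp
  have b1: "b < 1" unfolding b_def using ne rho_less_1 by (subst Max_less_iff) auto
  have rb: "0 < \<rho> i \<and> \<rho> i \<le> b" if "i \<in> {1..m}" for i
    using that rho_pos unfolding b_def by (auto intro!: Max_ge)
  have b0: "0 < b" using rb[of 1] m2 by auto
  have bound: "prob {p} \<le> 2 * b ^ n" for n
  proof -
    let ?\<Gamma> = "cutset m (\<lambda>_. False) n"
    let ?G = "{w \<in> ?\<Gamma>. p \<in> {lo w..hi w}}"
    have wl: "w \<in> lists {1..m}" if "w \<in> ?\<Gamma>" for w by (rule cutset_lists[OF that])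
    \<comment> \<open>Of the cells containing \<open>p\<close>, at most one has \<open>p\<close> as
      its left end and at most one contains it otherwise, so the map into the two truth values is
      injective.\<close>
    have "inj_on (\<lambda>w. lo w = p) ?G"
    proof (rule inj_onI, rule ccontr)
      fix w v assume wv: "w \<in> ?G" "v \<in> ?G" "(lo w = p) = (lo v = p)" "w \<noteq> v"
      then have "{lo w<..<hi w} \<inter> {lo v<..<hi v} = {}"
        using open_disjoint wl cutset_parallel by blast
      then have max: "max (lo w) (lo v) \<ge> min (hi w) (hi v)"
        using dense[of "max (lo w) (lo v)" "min (hi w) (hi v)"] by fastforce
      have "lo w < hi w" "lo v < hi v" using lo_hi(2) wl wv by auto
      then show False using wv(1-3) max by (cases "lo w = p") auto
    qed
    then have card: "card ?G \<le> 2"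
      using card_inj_on_le[of "\<lambda>w. lo w = p" ?G UNIV] by simp
    have "prob {p} = (\<Sum>w\<in>?\<Gamma>. word_weight \<rho> w * prob (word_map \<phi> w -` {p} \<inter> {0..1}))"
      by (rule prob_cutset[OF pm])
    also have "\<dots> = (\<Sum>w\<in>?G. word_weight \<rho> w * prob (word_map \<phi> w -` {p} \<inter> {0..1}))"
    proof (rule sum.mono_neutral_right[OF finite_cutset])
      show "\<forall>w\<in>?\<Gamma> - ?G. word_weight \<rho> w * prob (word_map \<phi> w -` {p} \<inter> {0..1}) = 0"
      proof
        fix w assume w: "w \<in> ?\<Gamma> - ?G"
        then have "p \<notin> word_map \<phi> w ` {0..1}" using closed_image[OF wl] by auto
        then have "word_map \<phi> w -` {p} \<inter> {0..1} = {}" by auto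
        then show "word_weight \<rho> w * prob (word_map \<phi> w -` {p} \<inter> {0..1}) = 0" by simp
      qed
    qed auto
    also have "\<dots> \<le> (\<Sum>w\<in>?G. b ^ n)"
    proof (rule sum_mono)
      fix w assume "w \<in> ?G"
      then have w: "w \<in> lists {1..m}" "length w = n" using wl cutset_stop[of w m "\<lambda>_. False" n] by auto
      have "word_weight \<rho> w * prob (word_map \<phi> w -` {p} \<inter> {0..1}) \<le> word_weight \<rho> w * 1"
        using rho_weight_pos[OF w(1)] by (intro mult_left_mono) auto
      also have "\<dots> \<le> b ^ n" using word_weight_le_power[OF rb w(1)] w(2) by simp
      finally show "word_weight \<rho> w * prob (word_map \<phi> w -` {p} \<inter> {0..1}) \<le> b ^ n" .
    qed
    also have "\<dots> \<le> 2 * b ^ n" using card b0 by simp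
    finally show ?thesis .
  qed
  have "(\<lambda>n. 2 * b ^ n) \<longlonglongrightarrow> 2 * 0"
    using b0 b1 by (intro tendsto_intros LIMSEQ_power_zero) auto
  from LIMSEQ_le_const[OF this, of "prob {p}"] bound have "prob {p} \<le> 0" by auto
  then show ?thesis using measure_nonneg[of \<mu> "{p}"] by linarith
qed

lemma greaterThanLessThan_sets: "0 \<le> p \<Longrightarrow> q \<le> 1 \<Longrightarrow> {p<..<q} \<in> sets \<mu>"
  unfolding sets_eq by (auto simp: sets_restrict_space image_iff intro!: bexI[of _ "{p<..<q}"])

lemma prob_open:
  assumes "0 \<le> p" "p \<le> q" "q \<le> 1"
  shows "prob {p<..<q} = prob {p..q}"
proof (rule antisym)
  have sets: "{p..p} \<in> sets \<mu>" "{q..q} \<in> sets \<mu>" "{p<..<q} \<in> sets \<mu>" "{p..q} \<in> sets \<mu>"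
    using assms by (auto intro: atLeastAtMost_sets greaterThanLessThan_sets simp del: atLeastAtMost_singleton)
  show "prob {p<..<q} \<le> prob {p..q}"
    using sets by (intro finite_measure_mono) auto
  have "prob {p..q} \<le> prob ({p<..<q} \<union> ({p..p} \<union> {q..q}))"
    using sets by (intro finite_measure_mono sets.Un) auto
  also have "\<dots> \<le> prob {p<..<q} + prob ({p..p} \<union> {q..q})"
    using sets by (intro measure_Un_le sets.Un)
  also have "prob ({p..p} \<union> {q..q}) \<le> prob {p..p} + prob {q..q}"
    using sets by (intro measure_Un_le)
  also have "prob {p..p} + prob {q..q} = 0" using prob_singleton assms by simp
  finally show "prob {p..q} \<le> prob {p<..<q}" by simp
qed

lemma prob_word_ge:
  assumes w: "w \<in> cutset m P n" and A: "A \<in> sets \<mu>" and E: "E \<in> sets \<mu>" "word_map \<phi> w ` A \<subseteq> E"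
  shows "word_weight \<rho> w * prob A \<le> prob E"
proof -
  have w': "w \<in> lists {1..m}" by (rule cutset_lists[OF w])
  have "A \<subseteq> word_map \<phi> w -` E \<inter> {0..1}"
    using E(2) sets.sets_into_space[OF A] by (auto simp: space_eq)
  then have "prob A \<le> prob (word_map \<phi> w -` E \<inter> {0..1})"
    by (rule finite_measure_mono[OF _ word_vimage_sets[OF w' E(1)]])
  then have "word_weight \<rho> w * prob A \<le> word_weight \<rho> w * prob (word_map \<phi> w -` E \<inter> {0..1})"
    using rho_weight_pos[OF w'] by (intro mult_left_mono) auto
  also have "\<dots> \<le> (\<Sum>w\<in>cutset m P n. word_weight \<rho> w * prob (word_map \<phi> w -` E \<inter> {0..1}))"
    by (intro member_le_sum finite_cutset w mult_nonneg_nonneg measure_nonneg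
        less_imp_le[OF rho_weight_pos[OF cutset_lists]]) auto
  also have "\<dots> = prob E" by (rule prob_cutset[OF E(1), symmetric])
  finally show ?thesis .
qed

lemma cutset_disjoint: "disjoint_family_on (\<lambda>w. {lo w<..<hi w}) (cutset m P n)"
  unfolding disjoint_family_on_def
  using open_disjoint[OF cutset_lists cutset_lists cutset_parallel] by blast

text \<open>Dropping all other terms of the self-conformal sum bounds the mass of each cell below by
  its weight. The weights add up to 1 and the open cells are disjoint with massless end points, so
  equality holds in every cell.\<close>

lemma prob_cells:
  shows "w \<in> cutset m P n \<Longrightarrow> prob {lo w..hi w} = word_weight \<rho> w"
    and "prob (\<Union>w\<in>cutset m P n. {lo w..hi w}) = 1"
proof -
  let ?\<Gamma> = "cutset m P n"
  have os: "{lo w<..<hi w} \<in> sets \<mu>" and cs: "{lo w..hi w} \<in> sets \<mu>"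
    and oc: "prob {lo w<..<hi w} = prob {lo w..hi w}" if "w \<in> ?\<Gamma>" for w
    using lo_hi[OF cutset_lists[OF that]]
    by (auto intro!: greaterThanLessThan_sets atLeastAtMost_sets prob_open)
  have ge: "word_weight \<rho> w \<le> prob {lo w..hi w}" if w: "w \<in> ?\<Gamma>" for w
    using prob_word_ge[OF w, of "{0..1}" "{lo w..hi w}"] cs[OF w] closed_image[OF cutset_lists[OF w]]
      atLeastAtMost_sets[of 0 1] prob_space_unit by simp
  have "prob (\<Union>w\<in>?\<Gamma>. {lo w<..<hi w}) = (\<Sum>w\<in>?\<Gamma>. prob {lo w<..<hi w})"
    by (rule finite_measure_finite_Union[OF finite_cutset _ cutset_disjoint]) (use os in auto)
  then have sum: "(\<Sum>w\<in>?\<Gamma>. prob {lo w..hi w}) = prob (\<Union>w\<in>?\<Gamma>. {lo w<..<hi w})"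
    using oc by simp
  also have "\<dots> \<le> (\<Sum>w\<in>?\<Gamma>. word_weight \<rho> w)" unfolding sum_rho_cutset by simp
  finally have le: "(\<Sum>w\<in>?\<Gamma>. prob {lo w..hi w}) \<le> (\<Sum>w\<in>?\<Gamma>. word_weight \<rho> w)" .
  have eq: "(\<Sum>w\<in>?\<Gamma>. word_weight \<rho> w) = (\<Sum>w\<in>?\<Gamma>. prob {lo w..hi w})"
    using le sum_mono[of ?\<Gamma> "word_weight \<rho>" "\<lambda>w. prob {lo w..hi w}"] ge by (simp add: antisym)
  show "prob {lo w..hi w} = word_weight \<rho> w" if w: "w \<in> ?\<Gamma>"
    using sum_mono_inv[OF eq ge w finite_cutset] by simp
  have "1 = prob (\<Union>w\<in>?\<Gamma>. {lo w<..<hi w})" using sum eq sum_rho_cutset by simp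
  also have "\<dots> \<le> prob (\<Union>w\<in>?\<Gamma>. {lo w..hi w})"
    using cs by (intro finite_measure_mono sets.finite_UN finite_cutset) force+
  finally show "prob (\<Union>w\<in>?\<Gamma>. {lo w..hi w}) = 1" using prob_le_1 by (intro antisym) auto
qed

text \<open>The points 0 and 1 carry no mass, so countably many closed intervals that exhaust the
  open unit interval cannot all be null.\<close>

lemma ex_central_interval: "\<exists>a. 0 < a \<and> a < 1 / 2 \<and> prob {a..1 - a} > 0"
proof (rule ccontr)
  assume no: "\<not> ?thesis"
  \<comment> \<open>The shift by 3 keeps every margin below 1/2.\<close>
  define I where "I n = {1 / real (n + 3)..1 - 1 / real (n + 3)}" for n
  have Is: "I n \<in> sets \<mu>" for n unfolding I_def by (intro atLeastAtMost_sets) auto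
  have "prob (I n) = 0" for n
  proof -
    have "0 < 1 / real (n + 3) \<and> 1 / real (n + 3) < 1 / 2" by (simp add: field_simps)
    with no have "\<not> prob (I n) > 0" unfolding I_def by blast
    then show ?thesis using measure_nonneg[of \<mu> "I n"] by linarith
  qed
  then have "emeasure \<mu> (I n) = 0" for n by (simp add: emeasure_eq_measure)
  then have "emeasure \<mu> (\<Union>n. I n) = 0" using Is by (intro emeasure_UN_eq_0) auto
  then have "prob (\<Union>n. I n) = 0" by (simp add: measure_def)
  moreover have "{0<..<1} \<subseteq> (\<Union>n. I n)"
  proof
    fix t :: real assume t: "t \<in> {0<..<1}"
    then obtain n where n: "inverse (real (Suc n)) < min t (1 - t)"
      using reals_Archimedean[of "min t (1 - t)"] by auto
    have "1 / real (n + 3) \<le> inverse (real (Suc n))" by (simp add: field_simps)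
    then have "t \<in> I n" using n unfolding I_def by auto
    then show "t \<in> (\<Union>n. I n)" by blast
  qed
  then have "prob {0<..<1} \<le> prob (\<Union>n. I n)" using Is by (intro finite_measure_mono) auto
  ultimately show False using prob_open[of 0 1] prob_space_unit by simp
qed

end

section \<open>The exponent and the spectral asymptotics\<close>

lemma powr_uminus_divide:
  fixes a b c :: real
  shows "0 < a \<Longrightarrow> 0 < b \<Longrightarrow> (a / b) powr (- c) = a powr (- c) * b powr c"
  by (simp add: powr_divide powr_minus, simp add: divide_inverse)

text \<open>With slopes 1 and -1 on the two halves, the energy is the length and the height at a
  point is its distance to the nearer end.\<close>

lemma tent_exists:
  fixes p q :: real
  assumes "0 \<le> p" "p < q" "q \<le> 1"
  obtains u u' where "antideriv u u'" "(\<integral>t. (u' t)\<^sup>2 \<partial>lborel) = q - p"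
    "\<And>t. t \<notin> {p<..<q} \<Longrightarrow> u t = 0" "\<And>t. t \<notin> {p<..<q} \<Longrightarrow> u' t = 0"
    "\<And>t. t \<in> {p..q} \<Longrightarrow> min (t - p) (q - t) \<le> u t"
proof -
  define c where "c = (p + q) / 2"
  have c: "p < c" "c < q" using assms by (auto simp: c_def)
  define u' :: "real \<Rightarrow> real" where "u' t = indicator {p<..<c} t - indicator {c<..<q} t" for t
  have u'_L2: "L2_unit u'"
  proof (rule L2_unit_bounded)
    show "u' \<in> borel_measurable borel" unfolding u'_def by measurable
  qed (use assms c in \<open>auto simp: u'_def indicator_def\<close>)
  define u where "u x = 0 + (\<integral>t. u' t * indicator {..<x} t \<partial>lborel)" for x
  have part: "(\<integral>t. indicator {a<..<b} t * indicator {..<x} t \<partial>lborel) = max 0 (min b x - a)"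
    for a b x :: real
  proof -
    have "(\<lambda>t. indicator {a<..<b} t * indicator {..<x} t) = indicat_real {a<..<min b x}"
      by (auto simp: indicator_def)
    then show ?thesis by (cases "a \<le> min b x") (auto simp: max_def)
  qed
  have int: "integrable lborel (\<lambda>t. indicator {a<..<b} t * indicator {..<x} t :: real)"
    for a b x :: real
    by (intro integrable_real_mult_indicator integrable_real_indicator emeasure_bounded_finite) auto
  have u: "u x = max 0 (min c x - p) - max 0 (min q x - c)" for x
  proof -
    have "u x = (\<integral>t. indicator {p<..<c} t * indicator {..<x} t - indicator {c<..<q} t * indicator {..<x} t \<partial>lborel)"
      unfolding u_def u'_def by (simp add: left_diff_distrib)
    then show ?thesis using int part by simp
  qed
  have sq: "(\<lambda>t. (u' t)\<^sup>2) = (\<lambda>t. indicator {p<..<c} t + indicator {c<..<q} t)"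
    by (auto simp: u'_def indicator_def)
  show thesis
  proof
    show "antideriv u u'" unfolding u_def[abs_def] by (rule antideriv_integral[OF u'_L2])
    have "(\<integral>t. indicator {p<..<c} t + indicator {c<..<q} t \<partial>lborel) = (c - p) + (q - c)"
      using c by (subst Bochner_Integration.integral_add) auto
    then show "(\<integral>t. (u' t)\<^sup>2 \<partial>lborel) = q - p" unfolding sq by simp
    show "u t = 0" if "t \<notin> {p<..<q}" for t
      using that assms c unfolding u c_def by (auto simp: max_def min_def field_simps)
    show "u' t = 0" if "t \<notin> {p<..<q}" for t
      using that c by (auto simp: u'_def indicator_def)
    show "min (t - p) (q - t) \<le> u t" if "t \<in> {p..q}" for t
      using that c unfolding u by (auto simp: max_def min_def c_def field_simps)
  qed
qed

section \<open>The number of stopped words and the exponent\<close>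

context conformal_system
begin

definition s :: "nat \<Rightarrow> real" where "s i = \<rho> i * r i"

lemma word_weight_s: "word_weight s w = word_weight \<rho> w * word_weight r w"
  unfolding s_def[abs_def] by (rule word_weight_mult)

lemma s_pos: "i \<in> {1..m} \<Longrightarrow> s i > 0"
  using rho_pos r_pos by (simp add: s_def)

lemma s_weight_pos: "w \<in> lists {1..m} \<Longrightarrow> word_weight s w > 0"
  using s_pos by (intro word_weight_pos[of "{1..m}"])

lemma rho_le_1: "i \<in> {1..m} \<Longrightarrow> \<rho> i \<le> 1"
  using member_le_sum[of i "{1..m}" \<rho>] rho_pos rho_sum by (auto intro: less_imp_le)

lemma s_less_1: "i \<in> {1..m} \<Longrightarrow> s i < 1"
  using mult_strict_mono'[of "r i" 1 "\<rho> i" 1] rho_le_1[of i] rho_pos[of i] r_pos[of i] r_less_1[of i]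
  unfolding s_def by (smt (verit) mult_left_le mult_less_cancel_left2 mult.commute)

text \<open>The worst factor lost by appending one letter; it bounds how far a stopped product can
  fall below the threshold.\<close>

definition smin :: real where "smin = Min (s ` {1..m})"

lemma smin: "0 < smin" "i \<in> {1..m} \<Longrightarrow> smin \<le> s i"
proof -
  have ne: "s ` {1..m} \<noteq> {}" using m2 by simp
  show "0 < smin" unfolding smin_def using ne s_pos by (subst Min_gr_iff) auto
  show "i \<in> {1..m} \<Longrightarrow> smin \<le> s i" unfolding smin_def by (intro Min_le) auto
qed

lemma stopping_cutset:
  assumes t: "0 < t" "t < 1"
  obtains P n where "\<And>w. w \<in> cutset m P n \<Longrightarrow> t * smin < word_weight s w \<and> word_weight s w \<le> t"
proof -
  define b where "b = Max (s ` {1..m})"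
  have ne: "s ` {1..m} \<noteq> {}" using m2 by simp
  have b1: "b < 1" unfolding b_def using ne s_less_1 by (subst Max_less_iff) auto
  have sb: "0 < s i \<and> s i \<le> b" if "i \<in> {1..m}" for i
    using that s_pos unfolding b_def by (auto intro!: Max_ge)
  \<comment> \<open>At this depth every product is below \<open>t\<close>, so each word of the
    section has stopped by its own weight.\<close>
  obtain n where n: "b ^ n < t" using real_arch_pow_inv[OF t(1) b1] by blast
  let ?P = "\<lambda>w. word_weight s w \<le> t"
  show thesis
  proof
    fix w assume w: "w \<in> cutset m ?P n"
    have wl: "w \<in> lists {1..m}" by (rule cutset_lists[OF w])
    have le: "word_weight s w \<le> t"
      using cutset_stop[OF w] word_weight_le_power[of "{1..m}" s b w, OF sb wl] n by auto
    \<comment> \<open>The empty word has weight 1, above \<open>t\<close>. Hence a stopped word has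
      a parent, and the weight of the parent still exceeds \<open>t\<close>.\<close>
    then have "w \<noteq> []" using t by auto
    then obtain v i where v: "w = v @ [i]" by (metis rev_exhaust)
    then have vi: "v \<in> lists {1..m}" "i \<in> {1..m}" using wl by auto
    have "t < word_weight s v" using cutset_butlast[OF w] v by simp
    then have "t * smin < word_weight s v * smin" using smin(1) by simp
    also have "\<dots> \<le> word_weight s v * s i"
      using s_weight_pos[OF vi(1)] smin(2)[OF vi(2)] by (intro mult_left_mono) auto
    finally show "t * smin < word_weight s w \<and> word_weight s w \<le> t" using le by (simp add: v)
  qed
qed

lemma word_weight_powr:
  "w \<in> lists {1..m} \<Longrightarrow> word_weight s w powr D = word_weight (\<lambda>i. s i powr D) w"
proof (induction w)
  case (Cons i w)
  then show ?case using s_pos[of i] s_weight_pos[of w] by (simp add: powr_mult)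
qed simp

text \<open>The \<open>D\<close>-th powers of the weights sum to 1 over the section, and each lies
  between the \<open>D\<close>-th powers of \<open>t * smin\<close> and of \<open>t\<close>.\<close>

lemma card_cutset:
  assumes D: "D > 0" "(\<Sum>i=1..m. s i powr D) = 1"
    and t: "0 < t" and c: "\<And>w. w \<in> cutset m P n \<Longrightarrow> t * smin < word_weight s w \<and> word_weight s w \<le> t"
  shows "t powr (- D) \<le> card (cutset m P n)" "card (cutset m P n) \<le> (t * smin) powr (- D)"
proof -
  have "(\<Sum>w\<in>cutset m P n. word_weight (\<lambda>i. s i powr D) w) = word_weight (\<lambda>i. s i powr D) []"
    by (rule sum_cutset) (use D(2) in \<open>simp flip: sum_distrib_left\<close>)
  then have sum1: "(\<Sum>w\<in>cutset m P n. word_weight s w powr D) = 1"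
    using word_weight_powr[OF cutset_lists] by (simp cong: sum.cong)
  have "1 \<le> (\<Sum>w\<in>cutset m P n. t powr D)"
    unfolding sum1[symmetric]
    using c s_weight_pos[OF cutset_lists] D(1) by (intro sum_mono powr_mono2) (auto intro: less_imp_le)
  then have "1 \<le> card (cutset m P n) * t powr D" by simp
  then show "t powr (- D) \<le> card (cutset m P n)"
    using t by (simp add: powr_minus field_simps)
  have "(\<Sum>w\<in>cutset m P n. (t * smin) powr D) \<le> 1"
    unfolding sum1[symmetric]
    using c t smin(1) D(1) by (intro sum_mono powr_mono2) (auto intro: less_imp_le)
  then have "card (cutset m P n) * (t * smin) powr D \<le> 1" by simp
  then show "card (cutset m P n) \<le> (t * smin) powr (- D)"
    using t smin(1) by (simp add: powr_minus field_simps)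
qed

text \<open>The sum decreases strictly in the exponent and equals \<open>m\<close> at 0. At 1/2 the
  inequality of arithmetic and geometric means bounds it by half of
  \<open>(\<Sum> \<rho> i) + (\<Sum> r i)\<close>; here the contraction hypothesis on the sup norms
  makes the second sum smaller than 1.\<close>

lemma exponent_exists:
  assumes contr: "(\<Sum>i=1..m. SUP t\<in>{0..1}. \<bar>deriv01 (\<phi> i) t\<bar>) < 1"
  obtains D where "0 < D" "D < 1 / 2" "(\<Sum>i=1..m. s i powr D) = 1"
    "\<And>D'. (\<Sum>i=1..m. s i powr D') = 1 \<Longrightarrow> D' = D"
proof -
  let ?G = "\<lambda>D. \<Sum>i=1..m. s i powr D"
  have anti: "?G b < ?G a" if "a < b" for a b
  proof (rule sum_strict_mono)
    show "{1..m} \<noteq> {}" using m2 by simp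
    fix i assume i: "i \<in> {1..m}"
    show "s i powr b < s i powr a" using powr_less_mono'[OF s_pos[OF i] s_less_1[OF i] that] .
  qed simp
  have "?G 0 = (\<Sum>i=1..m. 1)"
    by (rule sum.cong[OF refl]) (use s_pos in force)
  then have G0: "1 < ?G 0" using m2 by simp
  have "(\<Sum>i=1..m. r i) \<le> (\<Sum>i=1..m. SUP t\<in>{0..1}. \<bar>deriv01 (\<phi> i) t\<bar>)"
  proof (rule sum_mono)
    fix i assume i: "i \<in> {1..m}"
    have "bdd_above ((\<lambda>t. \<bar>deriv01 (\<phi> i) t\<bar>) ` {0..1})"
      using deriv_bounds[OF i] by (intro bdd_aboveI2[of _ _ 1]) (auto intro: less_imp_le)
    then show "r i \<le> (SUP t\<in>{0..1}. \<bar>deriv01 (\<phi> i) t\<bar>)"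
      unfolding r_def using fixpoint[OF i] by (intro cSUP_upper) auto
  qed
  then have rsum: "(\<Sum>i=1..m. r i) < 1" using contr by linarith
  have "?G (1 / 2) = (\<Sum>i=1..m. sqrt (\<rho> i) * sqrt (r i))"
  proof (rule sum.cong[OF refl])
    fix i assume "i \<in> {1..m}"
    then show "s i powr (1 / 2) = sqrt (\<rho> i) * sqrt (r i)"
      using rho_pos r_pos s_pos by (simp add: powr_half_sqrt less_imp_le s_def real_sqrt_mult)
  qed
  also have "\<dots> \<le> (\<Sum>i=1..m. (\<rho> i + r i) / 2)"
  proof (rule sum_mono)
    fix i assume i: "i \<in> {1..m}"
    show "sqrt (\<rho> i) * sqrt (r i) \<le> (\<rho> i + r i) / 2"
      using arith_geo_mean_sqrt[of "\<rho> i" "r i"] rho_pos[OF i] r_pos[OF i] by (simp add: real_sqrt_mult)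
  qed
  also have "\<dots> = ((\<Sum>i=1..m. \<rho> i) + (\<Sum>i=1..m. r i)) / 2"
    by (simp add: sum.distrib flip: sum_divide_distrib)
  also have "\<dots> < 1" using rsum unfolding rho_sum by simp
  finally have G2: "?G (1 / 2) < 1" .
  have "continuous_on {0..1 / 2} ?G"
    using s_pos by (intro continuous_intros) (auto simp: less_imp_neq[symmetric])
  then obtain D where D: "0 \<le> D" "D \<le> 1 / 2" "?G D = 1"
    using IVT2'[of ?G "1 / 2" 1 0] G0 G2 by auto
  show thesis
  proof
    show "0 < D" using D G0 by (cases "D = 0") auto
    show "D < 1 / 2" using D G2 by (cases "D = 1 / 2") auto
    show "?G D = 1" by (rule D(3))
    show "D' = D" if "?G D' = 1" for D' using anti[of D D'] anti[of D' D] that D(3) by (cases D D' rule: linorder_cases) auto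
  qed
qed

end

section \<open>Two-sided bounds for the counting function\<close>

context self_conformal_system
begin

lemma count_upper:
  assumes D: "D > 0" "(\<Sum>i=1..m. s i powr D) = 1" and t: "0 < t" "t < 1" and L: "0 < L" "L * K * t \<le> 1"
  shows "finite {l. neumann_eigenvalue \<mu> l \<and> l < L}" "neumann_count L \<mu> \<le> (t * smin) powr (- D)"
proof -
  obtain P n where c: "\<And>w. w \<in> cutset m P n \<Longrightarrow> t * smin < word_weight s w \<and> word_weight s w \<le> t"
    using stopping_cutset[OF t] by metis
  have "finite {l. neumann_eigenvalue \<mu> l \<and> l < L} \<and>
      card {l. neumann_eigenvalue \<mu> l \<and> l < L} \<le> card (cutset m P n)"
  proof (rule eigenvalue_count_le[OF finite_cutset _ cutset_disjoint prob_cells(2) _ L(1)])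
    fix w assume w: "w \<in> cutset m P n"
    note wl = cutset_lists[OF w]
    show "0 \<le> lo w \<and> lo w \<le> hi w \<and> hi w \<le> 1" using lo_hi[OF wl] by simp
    have "L * ((hi w - lo w) * prob {lo w..hi w}) \<le> L * ((K * word_weight r w) * word_weight \<rho> w)"
      unfolding prob_cells(1)[OF w] using lo_hi(4)[OF wl] rho_weight_pos[OF wl] L(1)
      by (intro mult_left_mono mult_right_mono) auto
    also have "\<dots> = L * K * word_weight s w" by (simp add: word_weight_s)
    also have "\<dots> \<le> L * K * t" using c[OF w] L(1) K by (intro mult_left_mono) auto
    finally show "L * ((hi w - lo w) * prob {lo w..hi w}) \<le> 1" using L(2) by simp
  qed
  then have fin: "finite {l. neumann_eigenvalue \<mu> l \<and> l < L}"
    and "neumann_count L \<mu> \<le> card (cutset m P n)"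
    unfolding neumann_count_def by blast+
  then show "real (neumann_count L \<mu>) \<le> (t * smin) powr (- D)"
    using card_cutset(2)[where P = P and n = n, OF D t(1) c] by linarith
  show "finite {l. neumann_eigenvalue \<mu> l \<and> l < L}" by (rule fin)
qed

lemma finite_eigenvalues:
  assumes "D > 0" "(\<Sum>i=1..m. s i powr D) = 1" "0 < L"
  shows "finite {l. neumann_eigenvalue \<mu> l \<and> l < L}"
proof -
  have "0 < min (1 / 2) (1 / (L * K))" "L * K * min (1 / 2) (1 / (L * K)) \<le> 1"
    using assms(3) K by (auto simp: min_def field_simps)
  then show ?thesis using assms by (intro count_upper(1)[of D "min (1 / 2) (1 / (L * K))"]) auto
qed

lemma neumann_count_upper:
  assumes D: "D > 0" "(\<Sum>i=1..m. s i powr D) = 1" and "L0 > 0"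
  shows "\<exists>C2>0. \<forall>L\<in>{0} \<union> {L0..}. real (neumann_count L \<mu>) \<le> C2 * L powr D"
proof -
  \<comment> \<open>With \<open>t = c / L\<close>, the first entry gives
    \<open>t \<le> 1 / 2\<close> for all \<open>L \<ge> L0\<close>, and the second gives
    \<open>L * K * t \<le> 1\<close>.\<close>
  define c where "c = min (L0 / 2) (1 / K)"
  have c: "0 < c" using assms(3) K by (simp add: c_def)
  show ?thesis
  proof (intro exI[of _ "(c * smin) powr (- D)"] conjI ballI)
    show "(c * smin) powr (- D) > 0" using c smin(1) by simp
    fix L assume "L \<in> {0} \<union> {L0..}"
    then consider "L = 0" | "L \<ge> L0" by auto
    then show "real (neumann_count L \<mu>) \<le> (c * smin) powr (- D) * L powr D"
    proof cases
      case 1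
      \<comment> \<open>Eigenvalues are nonnegative, so none is counted at
        \<open>L = 0\<close>.\<close>
      then have e: "{l. neumann_eigenvalue \<mu> l \<and> l < L} = {}" using eigenvalue_nonneg by force
      show ?thesis unfolding neumann_count_def e by simp
    next
      case 2
      then have L: "0 < L" using assms(3) by simp
      define t where "t = c / L"
      have "c \<le> L / 2" using 2 by (simp add: c_def)
      then have t: "0 < t" "t < 1" using c L by (auto simp: t_def field_simps)
      have "L * K * t = K * c" using L by (simp add: t_def)
      also have "\<dots> \<le> K * (1 / K)" using K by (intro mult_left_mono) (auto simp: c_def)
      finally have "L * K * t \<le> 1" using K by simp
      from count_upper(2)[OF D t L this] have "neumann_count L \<mu> \<le> (t * smin) powr (- D)" .
      also have "t * smin = (c * smin) / L" by (simp add: t_def)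
      also have "((c * smin) / L) powr (- D) = (c * smin) powr (- D) * L powr D"
        by (rule powr_uminus_divide) (use c smin(1) L in auto)
      finally show ?thesis .
    qed
  qed
qed

text \<open>The central interval is carried into the cell. Its image keeps a share of mass
  proportional to the weight in \<open>\<rho>\<close>, and by the lower Lipschitz bound it stays at
  distance \<open>a * R / K\<close> from both ends, so the tent is at least that high on it.\<close>

lemma cell_test_function:
  assumes w: "w \<in> cutset m P n" and a: "0 < a" "a < 1 / 2"
  defines "R \<equiv> word_weight r w"
  obtains u u' where "antideriv u u'"
    "\<And>t. t \<notin> {lo w<..<hi w} \<Longrightarrow> u t = 0" "\<And>t. t \<notin> {lo w<..<hi w} \<Longrightarrow> u' t = 0"
    "(\<integral>t. (u' t)\<^sup>2 \<partial>lborel) \<le> K * R"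
    "(a * R / K)\<^sup>2 * (word_weight \<rho> w * prob {a..1 - a}) \<le> norm2 u"
proof -
  note wl = cutset_lists[OF w]
  obtain u u' where u: "antideriv u u'" "(\<integral>t. (u' t)\<^sup>2 \<partial>lborel) = hi w - lo w"
    "\<And>t. t \<notin> {lo w<..<hi w} \<Longrightarrow> u t = 0" "\<And>t. t \<notin> {lo w<..<hi w} \<Longrightarrow> u' t = 0"
    "\<And>t. t \<in> {lo w..hi w} \<Longrightarrow> min (t - lo w) (hi w - t) \<le> u t"
    by (rule tent_exists[OF lo_hi(1,2,3)[OF wl]]) (rule that)
  have R: "0 < R" unfolding R_def by (rule r_weight_pos[OF wl])
  define E where "E = word_map \<phi> w ` {a..1 - a}"
  have a01: "{a..1 - a} \<subseteq> {0..1}" "{a..1 - a} \<in> sets \<mu>" using a by (auto intro: atLeastAtMost_sets)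
  have E01: "E \<subseteq> {0..1}" unfolding E_def using a01(1) word_image[OF wl] by blast
  have "compact E"
    unfolding E_def using continuous_on_subset[OF word_continuous[OF wl] a01(1)]
    by (intro compact_continuous_image) auto
  then have "E \<in> sets borel" by (intro borel_closed compact_imp_closed)
  then have E: "E \<in> sets \<mu>"
    unfolding sets_eq sets_restrict_space using E01 by (intro image_eqI[of _ _ E]) auto
  have pE: "word_weight \<rho> w * prob {a..1 - a} \<le> prob E"
    by (rule prob_word_ge[OF w a01(2) E]) (simp add: E_def)
  have lowu: "a * R / K \<le> u z" if z: "z \<in> E" for z
  proof -
    obtain y where y: "y \<in> {a..1 - a}" "z = word_map \<phi> w y" using z unfolding E_def by blast
    have y01: "y \<in> {0..1}" using a01(1) y(1) by blast
    have z01: "z \<in> {lo w..hi w}" using closed_image[OF wl] y(2) y01 by blast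
    have "a * R / K \<le> \<bar>z - word_map \<phi> w e\<bar>" if e: "e \<in> {0, 1}" for e
    proof -
      have "R * a \<le> R * \<bar>y - e\<bar>" using y(1) R e by (intro mult_left_mono) auto
      also have "\<dots> \<le> K * \<bar>z - word_map \<phi> w e\<bar>"
        unfolding R_def y(2) using e by (intro word_lipschitz(2)[OF wl _ y01]) auto
      finally show ?thesis using K by (simp add: field_simps)
    qed
    from this[of 0] this[of 1] have "a * R / K \<le> min (z - lo w) (hi w - z)"
      using z01 by (auto simp: lo_def hi_def min_def max_def split: if_splits)
    then show ?thesis using u(5)[OF z01] by linarith
  qed
  have cu: "continuous_on {0..1} u" by (rule antideriv_continuous[OF u(1)])
  have "(\<integral>z. (a * R / K)\<^sup>2 * indicator E z \<partial>\<mu>) \<le> norm2 u"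
  proof (rule integral_mono)
    show "integrable \<mu> (\<lambda>z. (a * R / K)\<^sup>2 * indicator E z)"
      by (intro integrable_real_mult_indicator E integrable_const)
    show "integrable \<mu> (\<lambda>x. (u x)\<^sup>2)" by (intro integrable_continuous continuous_intros cu)
    fix z
    show "(a * R / K)\<^sup>2 * indicator E z \<le> (u z)\<^sup>2"
    proof (cases "z \<in> E")
      case True
      have "(a * R / K)\<^sup>2 \<le> (u z)\<^sup>2" using lowu[OF True] a R K by (intro power_mono) auto
      then show ?thesis using True by simp
    qed simp
  qed
  moreover have "(\<integral>z. (a * R / K)\<^sup>2 * indicator E z \<partial>\<mu>) = (a * R / K)\<^sup>2 * prob E"
    using sets.sets_into_space[OF E] by (simp add: Int_absorb2)
  moreover have "(a * R / K)\<^sup>2 * (word_weight \<rho> w * prob {a..1 - a}) \<le> (a * R / K)\<^sup>2 * prob E"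
    using pE by (intro mult_left_mono) auto
  ultimately have "(a * R / K)\<^sup>2 * (word_weight \<rho> w * prob {a..1 - a}) \<le> norm2 u" by linarith
  moreover have "(\<integral>t. (u' t)\<^sup>2 \<partial>lborel) \<le> K * R"
    unfolding u(2) R_def by (rule lo_hi(4)[OF wl])
  ultimately show thesis by (intro that[OF u(1,3,4)])
qed

lemma neumann_count_lower:
  assumes D: "D > 0" "(\<Sum>i=1..m. s i powr D) = 1"
  shows "\<exists>C1>0. \<forall>L\<ge>0. C1 * L powr D \<le> real (neumann_count L \<mu>)"
proof -
  obtain a where a: "0 < a" "a < 1 / 2" "prob {a..1 - a} > 0" using ex_central_interval by blast
  define \<beta> where "\<beta> = prob {a..1 - a}"
  have \<beta>: "0 < \<beta>" using a by (simp add: \<beta>_def)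
  \<comment> \<open>The test function of a cell with weights \<open>R\<close> in \<open>r\<close>
    and \<open>q\<close> in \<open>\<rho>\<close> has Rayleigh quotient at most
    \<open>K * R / ((a * R / K)\<^sup>2 * (q * \<beta>)) = M / (q * R)\<close>.\<close>
  define M where "M = K ^ 3 / (a\<^sup>2 * \<beta>)"
  have M: "0 < M" using K a \<beta> by (simp add: M_def)
  \<comment> \<open>With \<open>t = L1 / L\<close>, every stopped word has
    \<open>q * R > t * smin = M / L\<close>, hence a quotient below \<open>L\<close>.\<close>
  define L1 where "L1 = M / smin"
  have L1: "0 < L1" using M smin(1) by (simp add: L1_def)
  show ?thesis
  proof (intro exI[of _ "L1 powr (- D)"] conjI allI impI)
    show "L1 powr (- D) > 0" using L1 by simp
    fix L :: real assume "L \<ge> 0"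
    then consider "L = 0" | "0 < L" "L \<le> L1" | "L1 < L" by linarith
    then show "L1 powr (- D) * L powr D \<le> real (neumann_count L \<mu>)"
    proof cases
      case 1
      then show ?thesis by simp
    next
      case 2
      \<comment> \<open>For small \<open>L\<close> the eigenvalue 0 alone is enough; finiteness
        ensures that \<open>card\<close> counts it.\<close>
      have "{l. neumann_eigenvalue \<mu> l \<and> l < L} \<noteq> {}" using neumann_eigenvalue_zero 2 by blast
      with finite_eigenvalues[OF D 2(1)] have "0 < card {l. neumann_eigenvalue \<mu> l \<and> l < L}"
        by (simp only: card_gt_0_iff simp_thms)
      then have "1 \<le> real (neumann_count L \<mu>)" unfolding neumann_count_def by linarith
      moreover have "L powr D \<le> L1 powr D" using 2 D by (intro powr_mono2) auto
      then have "L1 powr (- D) * L powr D \<le> 1" using L1 by (simp add: powr_minus field_simps)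
      ultimately show ?thesis by linarith
    next
      case 3
      then have L: "0 < L" using L1 by simp
      define t where "t = L1 / L"
      have t: "0 < t" "t < 1" using L1 L 3 by (auto simp: t_def)
      obtain P n where c: "\<And>w. w \<in> cutset m P n \<Longrightarrow> t * smin < word_weight s w \<and> word_weight s w \<le> t"
        using stopping_cutset[OF t] by metis
      define Q where "Q w u u' \<longleftrightarrow> antideriv u u' \<and>
          (\<forall>t. t \<notin> {lo w<..<hi w} \<longrightarrow> u t = 0) \<and> (\<forall>t. t \<notin> {lo w<..<hi w} \<longrightarrow> u' t = 0) \<and>
          (\<integral>t. (u' t)\<^sup>2 \<partial>lborel) \<le> K * word_weight r w \<and>
          (a * word_weight r w / K)\<^sup>2 * (word_weight \<rho> w * \<beta>) \<le> norm2 u" for w u u'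
      have "\<exists>u u'. Q w u u'" if w: "w \<in> cutset m P n" for w
      proof (rule cell_test_function[OF w a(1,2)])
        fix u u' assume u: "antideriv u u'"
          "\<And>t. t \<notin> {lo w<..<hi w} \<Longrightarrow> u t = 0" "\<And>t. t \<notin> {lo w<..<hi w} \<Longrightarrow> u' t = 0"
          "(\<integral>t. (u' t)\<^sup>2 \<partial>lborel) \<le> K * word_weight r w"
          "(a * word_weight r w / K)\<^sup>2 * (word_weight \<rho> w * prob {a..1 - a}) \<le> norm2 u"
        have "Q w u u'"
          unfolding Q_def \<beta>_def
          by (intro conjI allI impI; (rule u(1) | erule u(2) | erule u(3) | rule u(4) | rule u(5)))
        then show "\<exists>u u'. Q w u u'" by (intro exI)
      qed
      then have "\<forall>w\<in>cutset m P n. \<exists>u. \<exists>u'. Q w u u'" by (rule ballI)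
      from bchoice[OF this] obtain U where "\<forall>w\<in>cutset m P n. \<exists>u'. Q w (U w) u'" ..
      from bchoice[OF this] obtain U' where Q: "\<forall>w\<in>cutset m P n. Q w (U w) (U' w)" ..
      have U: "antideriv (U w) (U' w)" "\<forall>t. t \<notin> {lo w<..<hi w} \<longrightarrow> U w t = 0"
        "\<forall>t. t \<notin> {lo w<..<hi w} \<longrightarrow> U' w t = 0"
        "(\<integral>t. (U' w t)\<^sup>2 \<partial>lborel) \<le> K * word_weight r w"
        "(a * word_weight r w / K)\<^sup>2 * (word_weight \<rho> w * \<beta>) \<le> norm2 (U w)"
        if "w \<in> cutset m P n" for w
        using bspec[OF Q that] unfolding Q_def by - (elim conjE, assumption)+
      have less: "(\<integral>t. (U' w t)\<^sup>2 \<partial>lborel) < L * norm2 (U w)" if w: "w \<in> cutset m P n" for w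
      proof -
        note wl = cutset_lists[OF w]
        define R where "R = word_weight r w"
        define q where "q = word_weight \<rho> w"
        have R: "0 < R" unfolding R_def by (rule r_weight_pos[OF wl])
        have N: "(a * R / K)\<^sup>2 * (q * \<beta>) \<le> norm2 (U w)" "(\<integral>t. (U' w t)\<^sup>2 \<partial>lborel) \<le> K * R"
          unfolding R_def q_def using U(4,5)[OF w] by auto
        have "t * smin = M / L" unfolding t_def L1_def using smin(1) by simp
        then have "M / L < q * R" using c[OF w] by (simp add: word_weight_s R_def q_def)
        then have "M < q * R * L" using L by (simp add: pos_divide_less_eq)
        then have "K ^ 3 < q * R * L * (a\<^sup>2 * \<beta>)"
          unfolding M_def using a \<beta> by (simp add: pos_divide_less_eq)
        \<comment> \<open>The factor \<open>R / K\<^sup>2\<close> turns the left side into the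
          energy bound and the right side into \<open>L\<close> times the norm bound of the test
          function.\<close>
        then have "K ^ 3 * (R / K\<^sup>2) < q * R * L * (a\<^sup>2 * \<beta>) * (R / K\<^sup>2)"
          using R K by (intro mult_strict_right_mono) auto
        moreover have "K ^ 3 * (R / K\<^sup>2) = K * R"
          using K by (simp add: power2_eq_square power3_eq_cube)
        moreover have "q * R * L * (a\<^sup>2 * \<beta>) * (R / K\<^sup>2) = L * ((a * R / K)\<^sup>2 * (q * \<beta>))"
          by (simp add: power2_eq_square)
        moreover have "L * ((a * R / K)\<^sup>2 * (q * \<beta>)) \<le> L * norm2 (U w)"
          using N(1) L by (intro mult_left_mono) auto
        ultimately show ?thesis using N(2) by linarith
      qed
      have disj: "t \<notin> {lo w<..<hi w} \<or> t \<notin> {lo v<..<hi v}"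
        if "w \<in> cutset m P n" "v \<in> cutset m P n" "w \<noteq> v" for w v t
        using disjoint_family_onD[OF cutset_disjoint that] by auto
      have "card (cutset m P n) \<le> card {l. neumann_eigenvalue \<mu> l \<and> l < L}"
      proof (rule eigenvalue_count_ge[OF finite_cutset U(1) _ _ less L finite_eigenvalues[OF D L]])
        fix w v t assume wv: "w \<in> cutset m P n" "v \<in> cutset m P n" "w \<noteq> v"
        show "U w t * U v t = 0" "U' w t * U' v t = 0"
          using disj[OF wv, of t] U(2,3)[OF wv(1), THEN spec, of t] U(2,3)[OF wv(2), THEN spec, of t] by auto
      qed
      then have "t powr (- D) \<le> neumann_count L \<mu>"
        using card_cutset(1)[where P = P and n = n, OF D t(1) c] unfolding neumann_count_def by linarith
      moreover have "t powr (- D) = L1 powr (- D) * L powr D"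
        unfolding t_def using L L1 by (intro powr_uminus_divide)
      ultimately show ?thesis by simp
    qed
  qed
qed

end

theorem theorem2:
  fixes m :: nat and \<phi> :: "nat \<Rightarrow> real \<Rightarrow> real" and \<rho> x :: "nat \<Rightarrow> real" and \<mu> :: "real measure"
  assumes "m \<ge> 2"
    and "conformal_IFS m \<phi> \<rho>"
    and "self_conformal_measure m \<phi> \<rho> \<mu>"
    and "(\<Sum>i=1..m. SUP t\<in>{0..1}. \<bar>deriv01 (\<phi> i) t\<bar>) < 1"
    and "strong_bounded_distortion m \<phi>"
    and "\<And>i. i \<in> {1..m} \<Longrightarrow> x i \<in> {0..1} \<and> \<phi> i (x i) = x i"
  shows "\<exists>D. 0 < D \<and> D < 1/2 \<and>
    (\<Sum>i=1..m. (\<rho> i * \<bar>deriv01 (\<phi> i) (x i)\<bar>) powr D) = 1 \<and>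
    (\<forall>D'. (\<Sum>i=1..m. (\<rho> i * \<bar>deriv01 (\<phi> i) (x i)\<bar>) powr D') = 1 \<longrightarrow> D' = D) \<and>
    (\<exists>C\<^sub>1>0. \<forall>L\<ge>0. C\<^sub>1 * L powr D \<le> real (neumann_count L \<mu>)) \<and>
    (\<forall>L\<^sub>0>0. \<exists>C\<^sub>2>0. \<forall>L\<in>{0} \<union> {L\<^sub>0..}. real (neumann_count L \<mu>) \<le> C\<^sub>2 * L powr D)"
proof -
  interpret conformal_system m \<phi> \<rho> x
    using assms by unfold_locales auto
  interpret prob_space \<mu> using assms(3) by (simp add: self_conformal_measure_def)
  interpret self_conformal_system m \<phi> \<rho> x \<mu>
    using assms(3) by unfold_locales (auto simp: self_conformal_measure_def)
  have s_eq: "(\<rho> i * \<bar>deriv01 (\<phi> i) (x i)\<bar>) = s i" for i by (simp add: s_def r_def)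
  obtain D where D: "0 < D" "D < 1 / 2" "(\<Sum>i=1..m. s i powr D) = 1"
    "\<And>D'. (\<Sum>i=1..m. s i powr D') = 1 \<Longrightarrow> D' = D"
    using exponent_exists[OF assms(4)] by metis
  show ?thesis
    unfolding s_eq
  proof (rule exI[of _ D], intro conjI allI impI D(1,2,3))
    show "D' = D" if "(\<Sum>i=1..m. s i powr D') = 1" for D' using D(4) that .
    show "\<exists>C\<^sub>1>0. \<forall>L\<ge>0. C\<^sub>1 * L powr D \<le> real (neumann_count L \<mu>)"
      by (rule neumann_count_lower[OF D(1,3)])
    show "\<exists>C\<^sub>2>0. \<forall>L\<in>{0} \<union> {L\<^sub>0..}. real (neumann_count L \<mu>) \<le> C\<^sub>2 * L powr D" if "L\<^sub>0 > 0" for L\<^sub>0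
      by (rule neumann_count_upper[OF D(1,3) that])
  qed
qed

end
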